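(* Let $T>0$ and let $(\Omega,(\mathcal{F}_t)_{t\in[0,T]},P)$ be a filtered probability space satisfying the usual conditions, with $\mathcal{F}_0$ trivial. Let $W$ be an $n$-dimensional Brownian motion in the filtration $(\mathcal{F}_t)$ and let $X$ be the $n$-dimensional Itô process \[ dX_i(t)=\mu_i(t)\,dt+\sum_{\nu=1}^n\sigma_{i\nu}(t)\,dW_\nu(t),\qquad i=1,\dots,n,\ t\in[0,T], \] with progressively measurable coefficients. Assume that $|\mu|$ is bounded and that there are finite constants $\varepsilon,M>0$ with \[ \varepsilon|\xi|^2\le|\sigma'(t)\xi|^2\le M|\xi|^2\quad\text{a.s. for all } t\in[0,T],\ \xi\in\mathbb{R}^n. \] Then $X$ has conditional full support (in $\mathbb{R}^n$).
   Context: $\sigma'(t)$ denotes the transpose of the matrix $\sigma(t)$. $X$ has conditional full support (in $\mathbb{R}^n$) means: for all $t\in[0,T]$ and every open set $G\subset C([0,T],\mathbb{R}^n)$ (topology of uniform convergence), $P(X\in G\mid\mathcal{F}_t)>0$ almost surely on the event $\{X|_{[0,t]}\in\{g|_{[0,t]}: g\in G\}\}$. *)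

theory Defs
  imports "HOL-Probability.Probability"
begin

text \<open>Time runs through the interval [0,T]. A filtration is given as a family of
  sub-sigma-algebras F t of M (measures whose sets matter only).\<close>

definition filtration_usual :: "'a measure \<Rightarrow> (real \<Rightarrow> 'a measure) \<Rightarrow> real \<Rightarrow> bool" where
  "filtration_usual M F T \<longleftrightarrow>
     (\<forall>t\<in>{0..T}. subalgebra M (F t)) \<and>
     (\<forall>s t. 0 \<le> s \<longrightarrow> s \<le> t \<longrightarrow> t \<le> T \<longrightarrow> sets (F s) \<subseteq> sets (F t)) \<and>
     \<comment> \<open>right continuity\<close>
     (\<forall>t\<in>{0..<T}. sets (F t) = (\<Inter>s\<in>{t<..T}. sets (F s))) \<and>
     \<comment> \<open>completeness: M is complete and F 0 contains all null sets\<close>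
     (\<forall>A N. N \<in> null_sets M \<longrightarrow> A \<subseteq> N \<longrightarrow> A \<in> sets M) \<and>
     null_sets M \<subseteq> sets (F 0)"

definition trivial_sigma :: "'a measure \<Rightarrow> 'a measure \<Rightarrow> bool" where
  "trivial_sigma M F0 \<longleftrightarrow> (\<forall>A\<in>sets F0. measure M A = 0 \<or> measure M A = 1)"

definition gauss_vec :: "real \<Rightarrow> (real ^ 'n) measure" where
  "gauss_vec v = density lborel (\<lambda>x. \<Prod>i\<in>UNIV. ennreal (normal_density 0 (sqrt v) (x $ i)))"

definition brownian_motion ::
  "'a measure \<Rightarrow> (real \<Rightarrow> 'a measure) \<Rightarrow> real \<Rightarrow> (real \<Rightarrow> 'a \<Rightarrow> real ^ 'n) \<Rightarrow> bool" where
  "brownian_motion M F T W \<longleftrightarrow>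
     (\<forall>t\<in>{0..T}. W t \<in> borel_measurable (F t)) \<and>
     (AE \<omega> in M. W 0 \<omega> = 0) \<and>
     (AE \<omega> in M. continuous_on {0..T} (\<lambda>t. W t \<omega>)) \<and>
     (\<forall>s t. 0 \<le> s \<longrightarrow> s < t \<longrightarrow> t \<le> T \<longrightarrow>
        distr M borel (\<lambda>\<omega>. W t \<omega> - W s \<omega>) = gauss_vec (t - s) \<and>
        (\<forall>A\<in>sets (F s). \<forall>B\<in>sets borel.
           measure M {\<omega> \<in> space M. \<omega> \<in> A \<and> W t \<omega> - W s \<omega> \<in> B}
           = measure M A * measure M {\<omega> \<in> space M. W t \<omega> - W s \<omega> \<in> B}))"

definition progressive ::
  "'a measure \<Rightarrow> (real \<Rightarrow> 'a measure) \<Rightarrow> real \<Rightarrow> (real \<Rightarrow> 'a \<Rightarrow> 'b::topological_space) \<Rightarrow> bool" where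
  "progressive M F T H \<longleftrightarrow>
     (\<forall>t\<in>{0..T}. (\<lambda>(s, \<omega>). H s \<omega>) \<in> borel_measurable (restrict_space borel {0..t} \<Otimes>\<^sub>M F t))"

definition elem_proc :: "nat \<Rightarrow> (nat \<Rightarrow> real) \<Rightarrow> (nat \<Rightarrow> 'a \<Rightarrow> real) \<Rightarrow> real \<Rightarrow> 'a \<Rightarrow> real" where
  "elem_proc m \<tau> h s \<omega> = (\<Sum>k<m. h k \<omega> * indicator {\<tau> k<..\<tau> (Suc k)} s)"

definition elem_int ::
  "(real \<Rightarrow> 'a \<Rightarrow> real) \<Rightarrow> nat \<Rightarrow> (nat \<Rightarrow> real) \<Rightarrow> (nat \<Rightarrow> 'a \<Rightarrow> real) \<Rightarrow> real \<Rightarrow> 'a \<Rightarrow> real" where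
  "elem_int B m \<tau> h t \<omega> = (\<Sum>k<m. h k \<omega> * (B (min t (\<tau> (Suc k))) \<omega> - B (min t (\<tau> k)) \<omega>))"

definition admissible_elem ::
  "'a measure \<Rightarrow> (real \<Rightarrow> 'a measure) \<Rightarrow> real \<Rightarrow> nat \<Rightarrow> (nat \<Rightarrow> real) \<Rightarrow> (nat \<Rightarrow> 'a \<Rightarrow> real) \<Rightarrow> bool" where
  "admissible_elem M F T m \<tau> h \<longleftrightarrow>
     \<tau> 0 = 0 \<and> \<tau> m = T \<and> (\<forall>k<m. \<tau> k < \<tau> (Suc k)) \<and>
     (\<forall>k<m. h k \<in> borel_measurable (F (\<tau> k)) \<and> (\<exists>C. \<forall>\<omega>\<in>space M. \<bar>h k \<omega>\<bar> \<le> C))"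

definition is_ito_integral ::
  "'a measure \<Rightarrow> (real \<Rightarrow> 'a measure) \<Rightarrow> real \<Rightarrow> (real \<Rightarrow> 'a \<Rightarrow> real) \<Rightarrow> (real \<Rightarrow> 'a \<Rightarrow> real)
     \<Rightarrow> (real \<Rightarrow> 'a \<Rightarrow> real) \<Rightarrow> bool" where
  "is_ito_integral M F T B H I \<longleftrightarrow>
     (\<forall>t\<in>{0..T}. I t \<in> borel_measurable (F t)) \<and>
     (AE \<omega> in M. continuous_on {0..T} (\<lambda>t. I t \<omega>)) \<and>
     (\<exists>m \<tau> h. (\<forall>j. admissible_elem M F T (m j) (\<tau> j) (h j)) \<and>
        (\<lambda>j. \<integral>\<^sup>+ \<omega>. (\<integral>\<^sup>+ s. ennreal ((H s \<omega> - elem_proc (m j) (\<tau> j) (h j) s \<omega>)\<^sup>2)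
                 * indicator {0..T} s \<partial>lborel) \<partial>M) \<longlonglongrightarrow> 0 \<and>
        (\<forall>t\<in>{0..T}. (\<lambda>j. \<integral>\<^sup>+ \<omega>. ennreal ((I t \<omega> - elem_int B (m j) (\<tau> j) (h j) t \<omega>)\<^sup>2) \<partial>M)
                 \<longlonglongrightarrow> 0))"

definition ito_process ::
  "'a measure \<Rightarrow> (real \<Rightarrow> 'a measure) \<Rightarrow> real \<Rightarrow> (real \<Rightarrow> 'a \<Rightarrow> real ^ 'n)
     \<Rightarrow> (real \<Rightarrow> 'a \<Rightarrow> real ^ 'n) \<Rightarrow> (real \<Rightarrow> 'a \<Rightarrow> real ^ 'n ^ 'n)
     \<Rightarrow> (real \<Rightarrow> 'a \<Rightarrow> real ^ 'n) \<Rightarrow> bool" where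
  "ito_process M F T W \<mu> \<sigma> X \<longleftrightarrow>
     (\<forall>t\<in>{0..T}. X t \<in> borel_measurable (F t)) \<and>
     (AE \<omega> in M. continuous_on {0..T} (\<lambda>t. X t \<omega>)) \<and>
     (\<exists>I :: 'n \<Rightarrow> 'n \<Rightarrow> real \<Rightarrow> 'a \<Rightarrow> real.
        (\<forall>i \<nu>. is_ito_integral M F T (\<lambda>t \<omega>. W t \<omega> $ \<nu>) (\<lambda>t \<omega>. \<sigma> t \<omega> $ i $ \<nu>) (I i \<nu>)) \<and>
        (\<forall>t\<in>{0..T}. AE \<omega> in M. \<forall>i.
           X t \<omega> $ i = X 0 \<omega> $ i + (LINT s:{0..t}|lborel. \<mu> s \<omega> $ i) + (\<Sum>\<nu>\<in>UNIV. I i \<nu> t \<omega>)))"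

text \<open>Open sets of C([0,T],R^n) with the topology of uniform convergence. Paths are
  functions real => R^n, only their values on [0,T] matter.\<close>
definition uniform_open :: "real \<Rightarrow> (real \<Rightarrow> 'b::metric_space) set \<Rightarrow> bool" where
  "uniform_open T G \<longleftrightarrow>
     (\<forall>g\<in>G. continuous_on {0..T} g \<and>
        (\<exists>e>0. \<forall>h. continuous_on {0..T} h \<and> (\<forall>s\<in>{0..T}. dist (h s) (g s) < e) \<longrightarrow> h \<in> G))"

definition cond_full_support ::
  "'a measure \<Rightarrow> (real \<Rightarrow> 'a measure) \<Rightarrow> real \<Rightarrow> (real \<Rightarrow> 'a \<Rightarrow> 'b::metric_space) \<Rightarrow> bool" where
  "cond_full_support M F T X \<longleftrightarrow>
     (\<forall>t\<in>{0..T}. \<forall>G. uniform_open T G \<longrightarrow>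
        (AE \<omega> in M. (\<exists>g\<in>G. \<forall>s\<in>{0..t}. X s \<omega> = g s) \<longrightarrow>
           real_cond_exp M (F t) (indicator {\<omega>' \<in> space M. (\<lambda>s. X s \<omega>') \<in> G}) \<omega> > 0))"

end

theory Submission
  imports Defs
begin

text \<open>For a Lipschitz path p and a radius r let b be the cubed positive part of r^2 - |y|^2. By
  ellipticity and boundedness of the coefficients, exp (l s) b (X s - p s) is a submartingale once l is
  large: near the boundary of the ball the second-order term of b wins, inside it the factor
  exp (l s) does. This is proved without an Ito formula, by expanding b over the steps of the
  elementary approximations of the stochastic integrals and passing to the limit.

  Since b is positive exactly inside the ball, the submartingale inequality may be iterated
  while discarding all paths that have left the tube of radius r around p at one of finitely
  many times. The lower bound so obtained for the conditional probability of remaining in the tube is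
  independent of these times, hence holds for a countable dense set of times and, by continuity, for
  the whole path. Open sets of paths are countable unions of tubes around Bernstein polynomials.\<close>

subsection \<open>The bump function\<close>

text \<open>The cube is the least integer power of the positive part that is twice continuously
  differentiable; its second derivative is even Lipschitz, so a second-order expansion has a cubic
  remainder. Put \<open>q = r^2 - |x|^2\<close>. The second-order term yields
  \<open>12 q |\<sigma>'x|^2\<close>, linear in \<open>q\<close>, and ellipticity keeps
  \<open>|\<sigma>'x|^2\<close> away from 0 near the sphere. All adverse terms, the bounded drift
  included, carry \<open>q^2\<close>, so no change of measure has to remove the drift. After
  division by \<open>q\<close> a quadratic polynomial in \<open>q\<close> remains, and
  \<open>l\<close> is the value at which its discriminant vanishes. The obstacle is that \<sigma> is
  only progressive and the integral is known only as a limit of elementary ones, whose integrands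
  are neither elliptic nor bounded uniformly along the sequence. Hence there are two limits in a
  fixed order: the step length tends to 0 for one fixed approximation, whatever its bound, and only
  then does the approximation vary. Using \<open>H\<close> in place of \<sigma> costs a multiple of
  \<open>|H - \<sigma>|^2\<close>, whose integral over time and probability vanishes in the second
  limit.\<close>

definition bump :: "real \<Rightarrow> 'b::real_inner \<Rightarrow> real" where
  "bump r y = (max 0 (r\<^sup>2 - (norm y)\<^sup>2)) ^ 3"

lemma bump_nonneg: "0 \<le> bump r y"
  by (simp add: bump_def)

lemma bump_le: "bump r y \<le> r ^ 6"
proof -
  have "(max 0 (r\<^sup>2 - (norm y)\<^sup>2)) ^ 3 \<le> (r\<^sup>2) ^ 3"
    by (intro power_mono) auto
  then show ?thesis
    by (simp add: bump_def flip: power_mult)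
qed

lemma bump_pos_iff:
  assumes "r > 0"
  shows "bump r y > 0 \<longleftrightarrow> norm y < r"
proof -
  have "bump r y > 0 \<longleftrightarrow> (norm y)\<^sup>2 < r\<^sup>2"
    by (auto simp: bump_def max_def zero_less_power_eq)
  also have "\<dots> \<longleftrightarrow> norm y < r"
    using assms by (metis abs_norm_cancel abs_of_pos abs_square_less_1 norm_ge_zero power2_less_imp_less power_strict_mono less_imp_le pos2)
  finally show ?thesis .
qed

lemma bump_measurable [measurable]:
  "bump r \<in> borel_measurable (borel :: 'b::euclidean_space measure)"
  unfolding bump_def by measurable

text \<open>For \<open>q + d < 0\<close> one has \<open>\<bar>d\<bar> = -d\<close>, so the
  right-hand side is exactly \<open>(q + d)^3\<close>, which is negative. Only a lower bound is
  wanted, since a submartingale inequality is the goal.\<close>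

lemma max_cube_ge:
  fixes q d :: real
  assumes "q \<ge> 0"
  shows "(max 0 (q + d)) ^ 3 \<ge> q ^ 3 + 3 * q\<^sup>2 * d + 3 * q * d\<^sup>2 - \<bar>d\<bar> ^ 3"
proof -
  have e: "(q + d) ^ 3 = q ^ 3 + 3 * q\<^sup>2 * d + 3 * q * d\<^sup>2 + d ^ 3"
    by (simp add: power2_eq_square power3_eq_cube algebra_simps)
  have "d ^ 3 \<ge> - (\<bar>d\<bar> ^ 3)"
    by (metis abs_ge_minus_self abs_minus_cancel minus_le_iff power_abs)
  show ?thesis
  proof (cases "q + d \<ge> 0")
    case True
    then show ?thesis using e \<open>d ^ 3 \<ge> _\<close> by (simp add: max_def)
  next
    case False
    then have "\<bar>d\<bar> = - d" using assms by simp
    then have "\<bar>d\<bar> ^ 3 = - (d ^ 3)" by (simp add: power3_eq_cube)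
    moreover have "(q + d) ^ 3 \<le> 0" using False
      by (simp add: power_le_zero_eq)
    ultimately show ?thesis using e False by (simp add: max_def)
  qed
qed

text \<open>Truncating the norm at \<open>r\<close> turns the positive part into a plain difference
  of squares of bounded numbers. The constant is \<open>2 r\<close> from that difference times
  \<open>3 r^4\<close> from the cube. This is what carries expectations of the bump through the
  \<open>L^1\<close> limit.\<close>

lemma bump_lipschitz:
  assumes "r > 0"
  shows "\<bar>bump r x - bump r y\<bar> \<le> 6 * r ^ 5 * norm (x - y)"
proof -
  define a where "a = min (norm x) r"
  define b where "b = min (norm y) r"
  have ab: "0 \<le> a" "a \<le> r" "0 \<le> b" "b \<le> r" "\<bar>a - b\<bar> \<le> norm (x - y)"
    using assms norm_triangle_ineq3[of x y] by (auto simp: a_def b_def min_def)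
  have eq: "max 0 (r\<^sup>2 - (norm z)\<^sup>2) = r\<^sup>2 - (min (norm z) r)\<^sup>2" for z :: 'a
  proof (cases "norm z \<le> r")
    case True
    then have "(norm z)\<^sup>2 \<le> r\<^sup>2" by (intro power_mono) auto
    with True show ?thesis by (simp add: max_def min_def)
  next
    case False
    then have "r\<^sup>2 \<le> (norm z)\<^sup>2" using assms by (intro power_mono) auto
    with False show ?thesis by (simp add: max_def min_def)
  qed
  define p where "p = r\<^sup>2 - a\<^sup>2"
  define q where "q = r\<^sup>2 - b\<^sup>2"
  have pq: "0 \<le> p" "p \<le> r\<^sup>2" "0 \<le> q" "q \<le> r\<^sup>2"
    using ab assms by (auto simp: p_def q_def intro!: power_mono)
  have "p - q = (b - a) * (b + a)"
    by (simp add: p_def q_def power2_eq_square algebra_simps)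
  then have "\<bar>p - q\<bar> = \<bar>a - b\<bar> * (b + a)"
    using ab by (simp add: abs_mult abs_minus_commute)
  also have "\<dots> \<le> norm (x - y) * (2 * r)"
    using ab by (intro mult_mono) auto
  finally have d: "\<bar>p - q\<bar> \<le> norm (x - y) * (2 * r)" .
  have "p ^ 3 - q ^ 3 = (p - q) * (p\<^sup>2 + p * q + q\<^sup>2)"
    by (simp add: power2_eq_square power3_eq_cube algebra_simps)
  then have "\<bar>p ^ 3 - q ^ 3\<bar> = \<bar>p - q\<bar> * (p\<^sup>2 + p * q + q\<^sup>2)"
    using pq by (simp add: abs_mult)
  also have "\<dots> \<le> (norm (x - y) * (2 * r)) * ((r\<^sup>2)\<^sup>2 + r\<^sup>2 * r\<^sup>2 + (r\<^sup>2)\<^sup>2)"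
    using pq d assms by (intro mult_mono add_mono power_mono) auto
  also have "\<dots> = 6 * r ^ 5 * norm (x - y)"
    by (simp add: power2_eq_square power_numeral_reduce algebra_simps)
  finally show ?thesis
    by (simp add: bump_def eq p_def q_def a_def b_def)
qed

text \<open>Here h is the square root of the step length, so that summing error terms of order h^3 over all
  steps still gives a vanishing total.\<close>

lemma bump_increment:
  fixes x b w :: "'b::real_inner"
  assumes r: "r > 0" and l: "l \<ge> 0" and c: "c \<ge> 1" and h: "0 < h" "h \<le> 1"
    and q: "norm x < r" and b: "norm b \<le> c * h\<^sup>2" and w: "norm w \<le> h * \<rho>"
  defines "q \<equiv> r\<^sup>2 - (norm x)\<^sup>2"
  shows "(1 + l * h\<^sup>2) * bump r (x + b + w) - bump r x
    \<ge> h\<^sup>2 * (l * q ^ 3 - 6 * q\<^sup>2 * r * c) - 6 * q\<^sup>2 * (x \<bullet> w) - 3 * q\<^sup>2 * (norm w)\<^sup>2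
      + 12 * q * (x \<bullet> w)\<^sup>2
      - (9 * r ^ 4 + 12 * r ^ 3 * (2 * r + 1) + (2 * r + 1) ^ 3
          + l * (3 * r ^ 4 * (2 * r + 1) + (2 * r + 1) ^ 3)) * h ^ 3 * (c + \<rho>) ^ 6"
proof -
  \<comment> \<open>As \<open>k \<ge> 1\<close>, every power of \<open>c\<close> and \<rho> in the
    remainder may be raised to \<open>k^6\<close>; the sixth power is forced by
    \<open>\<bar>d\<bar>^3\<close>, where \<open>d\<close> is of order \<open>h k^2\<close>.\<close>
  define k where "k = c + \<rho>"
  have "0 \<le> h * \<rho>" using w norm_ge_zero order_trans by blast
  then have rho: "\<rho> \<ge> 0" using h by (simp add: zero_le_mult_iff)
  have k: "k \<ge> 1" "k \<ge> c" "k \<ge> \<rho>" using c rho by (auto simp: k_def)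
  have q0: "q > 0" using q r unfolding q_def by (simp add: power_strict_mono)
  have qr: "q \<le> r\<^sup>2" unfolding q_def by simp
  \<comment> \<open>\<open>d\<close> is the change of \<open>r^2 - |.|^2\<close> caused by adding
    \<open>b + w\<close> to \<open>x\<close>; it has order \<open>h\<close>. Its part
    \<open>-e\<close> has order \<open>h^2\<close> and contains everything except the first-order
    term in \<open>w\<close>.\<close>
  define d where "d = - 2 * (x \<bullet> (b + w)) - (norm (b + w))\<^sup>2"
  define e where "e = 2 * (x \<bullet> b) + (norm (b + w))\<^sup>2"
  have de: "d = - 2 * (x \<bullet> w) - e"
    by (simp add: d_def e_def inner_add_right)
  have h2: "h\<^sup>2 \<le> h" using h by (simp add: power2_eq_square mult_left_le)
  have kk: "k \<le> k\<^sup>2" using k by (simp add: power2_eq_square)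
  have k26: "k\<^sup>2 \<le> k ^ 6" and k36: "k ^ 3 \<le> k ^ 6" using k by (auto intro: power_increasing)
  have wk: "norm w \<le> h * k" using w k h by (meson mult_left_mono order_trans less_imp_le)
  have zk: "norm (b + w) \<le> h * k"
  proof -
    have "norm (b + w) \<le> c * h\<^sup>2 + h * \<rho>" using b w norm_triangle_le add_mono by blast
    also have "\<dots> \<le> c * h + h * \<rho>" using h2 c by simp
    finally show ?thesis by (simp add: k_def algebra_simps)
  qed
  have zk2: "(norm (b + w))\<^sup>2 \<le> h\<^sup>2 * k\<^sup>2"
    using zk by (metis norm_ge_zero power_mono power_mult_distrib)
  have xb: "\<bar>x \<bullet> b\<bar> \<le> r * (c * h\<^sup>2)"
    using Cauchy_Schwarz_ineq2[of x b] q b r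
    by (meson mult_mono order_trans less_imp_le norm_ge_zero)
  have xw: "\<bar>x \<bullet> w\<bar> \<le> r * (h * k)"
    using Cauchy_Schwarz_ineq2[of x w] q wk r
    by (meson mult_mono order_trans less_imp_le norm_ge_zero)
  have e: "\<bar>e\<bar> \<le> (2 * r + 1) * h\<^sup>2 * k\<^sup>2"
  proof -
    have "\<bar>e\<bar> \<le> 2 * (r * (c * h\<^sup>2)) + h\<^sup>2 * k\<^sup>2"
      using xb zk2 zero_le_power2[of "norm (b + w)"] unfolding e_def by linarith
    also have "\<dots> \<le> 2 * (r * (k\<^sup>2 * h\<^sup>2)) + h\<^sup>2 * k\<^sup>2"
      using k kk r by (intro add_mono mult_left_mono mult_right_mono) auto
    finally show ?thesis by (simp add: algebra_simps)
  qed
  have d: "\<bar>d\<bar> \<le> (2 * r + 1) * h * k\<^sup>2"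
  proof -
    have "\<bar>x \<bullet> (b + w)\<bar> \<le> r * (h * k)"
      using Cauchy_Schwarz_ineq2[of x "b + w"] q zk r
      by (meson mult_mono order_trans less_imp_le norm_ge_zero)
    then have "\<bar>d\<bar> \<le> 2 * (r * (h * k)) + h\<^sup>2 * k\<^sup>2"
      using zk2 zero_le_power2[of "norm (b + w)"] unfolding d_def by linarith
    also have "\<dots> \<le> 2 * (r * (h * k\<^sup>2)) + h * k\<^sup>2"
      using kk r h h2 by (intro add_mono mult_left_mono mult_right_mono) auto
    finally show ?thesis by (simp add: algebra_simps)
  qed
  have d3: "\<bar>d\<bar> ^ 3 \<le> (2 * r + 1) ^ 3 * h ^ 3 * k ^ 6"
  proof -
    have "\<bar>d\<bar> ^ 3 \<le> ((2 * r + 1) * h * k\<^sup>2) ^ 3" using d by (intro power_mono) auto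
    then show ?thesis by (simp add: power_mult_distrib flip: power_mult)
  qed
  have h33: "h * h\<^sup>2 = h ^ 3" by (simp add: power_numeral_reduce)
  have "(norm (x + (b + w)))\<^sup>2 = (norm x)\<^sup>2 + 2 * (x \<bullet> (b + w)) + (norm (b + w))\<^sup>2"
    by (simp only: power2_norm_eq_inner) (simp add: inner_add_left inner_add_right inner_commute algebra_simps)
  then have "r\<^sup>2 - (norm (x + b + w))\<^sup>2 = q + d"
    by (simp add: q_def d_def add.assoc)
  then have B: "bump r (x + b + w) \<ge> q ^ 3 + 3 * q\<^sup>2 * d + 3 * q * d\<^sup>2 - \<bar>d\<bar> ^ 3"
    using max_cube_ge[of q d] q0 unfolding bump_def by simp
  have Bx: "bump r x = q ^ 3" using q0 unfolding bump_def q_def by simp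
  have q4: "q\<^sup>2 \<le> r ^ 4" using power_mono[OF qr, of 2] q0 by (simp flip: power_mult)
  have t1: "3 * q\<^sup>2 * d \<ge> - 6 * q\<^sup>2 * (x \<bullet> w) - 6 * q\<^sup>2 * r * c * h\<^sup>2 - 3 * q\<^sup>2 * (norm w)\<^sup>2
      - 9 * r ^ 4 * h ^ 3 * k ^ 6"
  proof -
    \<comment> \<open>Of this square only \<open>|w|^2\<close> has order \<open>h^2\<close>; the
      cross term and \<open>|b|^2\<close> have order at least \<open>h^3\<close> and go into the
      remainder.\<close>
    have zexp: "(norm (b + w))\<^sup>2 = (norm w)\<^sup>2 + (2 * (b \<bullet> w) + (norm b)\<^sup>2)"
      by (simp only: power2_norm_eq_inner) (simp add: inner_add_left inner_add_right inner_commute algebra_simps)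
    have "\<bar>b \<bullet> w\<bar> \<le> (c * h\<^sup>2) * (h * k)"
      using Cauchy_Schwarz_ineq2[of b w] b wk c h
      by (meson mult_mono order_trans norm_ge_zero)
    also have "\<dots> \<le> (k * h\<^sup>2) * (h * k)" using k h by (intro mult_right_mono) auto
    also have "\<dots> = h ^ 3 * k\<^sup>2" by (simp add: power_numeral_reduce)
    finally have "\<bar>b \<bullet> w\<bar> \<le> h ^ 3 * k ^ 6"
      using k26 h by (meson mult_left_mono order_trans zero_le_power less_imp_le)
    moreover have "(norm b)\<^sup>2 \<le> h ^ 3 * k ^ 6"
    proof -
      have "(norm b)\<^sup>2 \<le> (c * h\<^sup>2)\<^sup>2" using b by (intro power_mono) auto
      also have "\<dots> = h ^ 4 * c\<^sup>2" by (simp add: power_mult_distrib flip: power_mult)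
      also have "\<dots> \<le> h ^ 3 * k\<^sup>2" using h k c by (intro mult_mono power_mono power_decreasing) auto
      also have "\<dots> \<le> h ^ 3 * k ^ 6" using k26 h by (intro mult_left_mono) auto
      finally show ?thesis .
    qed
    ultimately have "2 * (b \<bullet> w) + (norm b)\<^sup>2 \<le> 3 * (h ^ 3 * k ^ 6)" by linarith
    then have "d \<ge> - 2 * (x \<bullet> w) - 2 * (r * (c * h\<^sup>2)) - (norm w)\<^sup>2 - 3 * (h ^ 3 * k ^ 6)"
      using xb unfolding de e_def zexp by linarith
    then have "3 * q\<^sup>2 * d \<ge> 3 * q\<^sup>2 * (- 2 * (x \<bullet> w) - 2 * (r * (c * h\<^sup>2)) - (norm w)\<^sup>2 - 3 * (h ^ 3 * k ^ 6))"
      by (intro mult_left_mono) auto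
    moreover have "q\<^sup>2 * (h ^ 3 * k ^ 6) \<le> r ^ 4 * (h ^ 3 * k ^ 6)"
      using q4 h k by (intro mult_right_mono) auto
    ultimately show ?thesis by (simp add: algebra_simps)
  qed
  have t2: "3 * q * d\<^sup>2 \<ge> 12 * q * (x \<bullet> w)\<^sup>2 - 12 * r ^ 3 * (2 * r + 1) * h ^ 3 * k ^ 6"
  proof -
    have "d\<^sup>2 = 4 * (x \<bullet> w)\<^sup>2 + 4 * ((x \<bullet> w) * e) + e\<^sup>2"
      by (simp add: de power2_eq_square algebra_simps)
    then have 1: "d\<^sup>2 \<ge> 4 * (x \<bullet> w)\<^sup>2 - 4 * (\<bar>x \<bullet> w\<bar> * \<bar>e\<bar>)"
      using abs_ge_minus_self[of "(x \<bullet> w) * e"] by (simp add: abs_mult) (smt (verit) zero_le_power2)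
    have "\<bar>x \<bullet> w\<bar> * \<bar>e\<bar> \<le> (r * (h * k)) * ((2 * r + 1) * h\<^sup>2 * k\<^sup>2)"
      using xw e r h k by (intro mult_mono) auto
    also have "\<dots> = (r * (2 * r + 1) * h ^ 3) * k ^ 3" by (simp add: power_numeral_reduce)
    also have "\<dots> \<le> (r * (2 * r + 1) * h ^ 3) * k ^ 6" using k36 r h by (intro mult_left_mono) auto
    finally have 2: "\<bar>x \<bullet> w\<bar> * \<bar>e\<bar> \<le> (r * (2 * r + 1) * h ^ 3) * k ^ 6" .
    have "3 * q * d\<^sup>2 \<ge> 3 * q * (4 * (x \<bullet> w)\<^sup>2 - 4 * ((r * (2 * r + 1) * h ^ 3) * k ^ 6))"
      using 1 2 q0 by (intro mult_left_mono) auto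
    moreover have "q * ((r * (2 * r + 1) * h ^ 3) * k ^ 6) \<le> r\<^sup>2 * ((r * (2 * r + 1) * h ^ 3) * k ^ 6)"
      using qr r h k by (intro mult_right_mono) auto
    moreover have "r\<^sup>2 * ((r * (2 * r + 1) * h ^ 3) * k ^ 6) = r ^ 3 * (2 * r + 1) * h ^ 3 * k ^ 6"
      by (simp add: power_numeral_reduce)
    ultimately show ?thesis by (simp add: algebra_simps)
  qed
  \<comment> \<open>The factor \<open>l h^2\<close> leaves room: here the bump is needed only up to
    an error of order \<open>h\<close>.\<close>
  have t3: "l * h\<^sup>2 * bump r (x + b + w) \<ge> l * h\<^sup>2 * q ^ 3
      - l * (3 * r ^ 4 * (2 * r + 1) + (2 * r + 1) ^ 3) * h ^ 3 * k ^ 6"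
  proof -
    have "q\<^sup>2 * \<bar>d\<bar> \<le> r ^ 4 * ((2 * r + 1) * h * k\<^sup>2)"
      using q4 d by (intro mult_mono) auto
    also have "\<dots> \<le> r ^ 4 * ((2 * r + 1) * h * k ^ 6)"
      using k26 r h by (intro mult_left_mono) auto
    finally have 1: "q\<^sup>2 * \<bar>d\<bar> \<le> r ^ 4 * ((2 * r + 1) * h * k ^ 6)" .
    have "h ^ 3 \<le> h" using power_decreasing[of 1 3 h] h by simp
    then have "(2 * r + 1) ^ 3 * h ^ 3 * k ^ 6 \<le> (2 * r + 1) ^ 3 * h * k ^ 6"
      using r k h by (intro mult_mono) auto
    with d3 have 2: "\<bar>d\<bar> ^ 3 \<le> (2 * r + 1) ^ 3 * h * k ^ 6" by linarith
    have 3: "q\<^sup>2 * d \<ge> - (q\<^sup>2 * \<bar>d\<bar>)"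
      by (smt (verit) abs_ge_minus_self mult_minus_right mult_left_mono zero_le_power2)
    have 4: "q * d\<^sup>2 \<ge> 0" using q0 by simp
    have "bump r (x + b + w) \<ge> q ^ 3 - 3 * (r ^ 4 * ((2 * r + 1) * h * k ^ 6)) - (2 * r + 1) ^ 3 * h * k ^ 6"
      using B 1 2 3 4 by linarith
    then have "l * h\<^sup>2 * bump r (x + b + w) \<ge> l * h\<^sup>2 *
        (q ^ 3 - 3 * (r ^ 4 * ((2 * r + 1) * h * k ^ 6)) - (2 * r + 1) ^ 3 * h * k ^ 6)"
      using l h by (intro mult_left_mono) auto
    also have "l * h\<^sup>2 * (q ^ 3 - 3 * (r ^ 4 * ((2 * r + 1) * h * k ^ 6)) - (2 * r + 1) ^ 3 * h * k ^ 6)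
        = l * h\<^sup>2 * q ^ 3 - l * (3 * r ^ 4 * (2 * r + 1) + (2 * r + 1) ^ 3) * (h * h\<^sup>2) * k ^ 6"
      by (simp add: algebra_simps)
    finally show ?thesis by (simp add: h33)
  qed
  have "(1 + l * h\<^sup>2) * bump r (x + b + w) - bump r x
      = bump r (x + b + w) - q ^ 3 + l * h\<^sup>2 * bump r (x + b + w)"
    by (simp add: Bx algebra_simps)
  then show ?thesis
    using B t1 t2 t3 d3 unfolding k_def[symmetric] by (simp add: algebra_simps)
qed

text \<open>\<open>N\<close> stands for a bound on \<open>|\<sigma>|^2\<close> and \<open>E\<close>
  for \<open>|H - \<sigma>|^2\<close>. Apart from the terms in \<open>E\<close>, the left-hand side
  is at least \<open>q (l q^2 - C q + 6 \<epsilon> r^2)\<close>, and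
  \<open>l \<ge> C^2 / (24 \<epsilon> r^2)\<close> makes the quadratic factor nonnegative by
  completing the square. The terms in \<open>E\<close> cost \<open>6 r^4\<close> and
  \<open>12 r^4\<close>.\<close>

lemma drift_nonneg:
  fixes q r c N E S V \<epsilon> l :: real
  assumes q: "0 < q" "q \<le> r\<^sup>2" and r: "r > 0" and e: "\<epsilon> > 0" and E: "E \<ge> 0"
    and l: "l \<ge> (6 * r * c + 6 * N + 6 * \<epsilon>)\<^sup>2 / (24 * \<epsilon> * r\<^sup>2)"
    and S: "S \<le> 2 * N + 2 * E" and V: "V \<ge> \<epsilon> * (r\<^sup>2 - q) / 2 - r\<^sup>2 * E"
  shows "l * q ^ 3 - 6 * q\<^sup>2 * r * c - 3 * q\<^sup>2 * S + 12 * q * V \<ge> - 18 * r ^ 4 * E"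
proof -
  define C where "C = 6 * r * c + 6 * N + 6 * \<epsilon>"
  define D where "D = 24 * \<epsilon> * r\<^sup>2"
  have D: "D > 0" using e r by (simp add: D_def)
  have "C\<^sup>2 / D * q\<^sup>2 - C * q + D / 4 = (C * q - D / 2)\<^sup>2 / D"
    using D by (simp add: field_simps power2_eq_square)
  also have "\<dots> \<ge> 0" using D by simp
  finally have "C\<^sup>2 / D * q\<^sup>2 - C * q + D / 4 \<ge> 0" .
  moreover have "l * q\<^sup>2 \<ge> C\<^sup>2 / D * q\<^sup>2"
    using l unfolding C_def D_def by (intro mult_right_mono) auto
  ultimately have "l * q\<^sup>2 - C * q + 6 * \<epsilon> * r\<^sup>2 \<ge> 0" unfolding D_def by simp
  then have 1: "q * (l * q\<^sup>2 - C * q + 6 * \<epsilon> * r\<^sup>2) \<ge> 0" using q by simp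
  have 2: "3 * q\<^sup>2 * S \<le> 3 * q\<^sup>2 * (2 * N + 2 * E)" using S by (intro mult_left_mono) auto
  have 3: "12 * q * V \<ge> 12 * q * (\<epsilon> * (r\<^sup>2 - q) / 2 - r\<^sup>2 * E)" using V q by (intro mult_left_mono) auto
  have "q\<^sup>2 \<le> (r\<^sup>2)\<^sup>2" using q by (intro power_mono) auto
  then have 4: "q\<^sup>2 * E \<le> r ^ 4 * E" using E by (intro mult_right_mono) (auto simp flip: power_mult)
  have "q * r\<^sup>2 \<le> r\<^sup>2 * r\<^sup>2" using q by (intro mult_right_mono) auto
  then have 5: "q * r\<^sup>2 * E \<le> r ^ 4 * E" using E by (intro mult_right_mono) (auto simp: power_numeral_reduce)
  have "l * q ^ 3 - 6 * q\<^sup>2 * r * c - 3 * q\<^sup>2 * (2 * N + 2 * E) + 12 * q * (\<epsilon> * (r\<^sup>2 - q) / 2 - r\<^sup>2 * E)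
    = q * (l * q\<^sup>2 - C * q + 6 * \<epsilon> * r\<^sup>2) - 6 * (q\<^sup>2 * E) - 12 * (q * r\<^sup>2 * E)"
    by (simp add: C_def power_numeral_reduce field_simps)
  then show ?thesis using 1 2 3 4 5 by linarith
qed

subsection \<open>Moments of the Gaussian vector\<close>

lemma prod_Basis_vec:
  fixes f :: "real ^ 'n::finite \<Rightarrow> 'b::comm_monoid_mult"
  shows "(\<Prod>b\<in>Basis. f b) = (\<Prod>i\<in>UNIV. f (axis i 1))"
proof -
  have B: "(Basis :: (real ^ 'n) set) = range (\<lambda>i. axis i 1)"
    by (auto simp: Basis_vec_def)
  have "inj (\<lambda>i::'n. axis i (1::real))"
    by (auto simp: inj_on_def axis_eq_axis)
  then show ?thesis unfolding B by (simp add: prod.reindex)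
qed

lemma sum_Basis_vec:
  fixes f :: "real ^ 'n::finite \<Rightarrow> 'b::comm_monoid_add"
  shows "(\<Sum>b\<in>Basis. f b) = (\<Sum>i\<in>UNIV. f (axis i 1))"
proof -
  have B: "(Basis :: (real ^ 'n) set) = range (\<lambda>i. axis i 1)"
    by (auto simp: Basis_vec_def)
  have "inj (\<lambda>i::'n. axis i (1::real))"
    by (auto simp: inj_on_def axis_eq_axis)
  then show ?thesis unfolding B by (simp add: sum.reindex)
qed

lemma nn_integral_lborel_prod_vec:
  fixes f :: "'n::finite \<Rightarrow> real \<Rightarrow> ennreal"
  assumes [measurable]: "\<And>i. f i \<in> borel_measurable borel"
  shows "(\<integral>\<^sup>+x. (\<Prod>i\<in>UNIV. f i (x $ i)) \<partial>lborel) = (\<Prod>i\<in>UNIV. \<integral>\<^sup>+y. f i y \<partial>lborel)"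
proof -
  \<comment> \<open>\<open>j\<close> reads the coordinate off a basis vector, which translates
    between products over \<open>Basis\<close> and products over coordinates.\<close>
  define j where "j b = (SOME i. b = axis i (1::real))" for b :: "real ^ 'n"
  have j: "j (axis i 1) = i" for i
    unfolding j_def by (rule some_equality) (auto simp: axis_eq_axis)
  have "(\<integral>\<^sup>+x. (\<Prod>b\<in>Basis. f (j b) (x \<bullet> b)) \<partial>lborel) = (\<Prod>b\<in>Basis. \<integral>\<^sup>+y. f (j b) y \<partial>lborel)"
    by (rule nn_integral_lborel_prod) auto
  then show ?thesis
    by (simp add: prod_Basis_vec j inner_axis)
qed

lemma gauss_vec_even_moment:
  fixes i :: "'n::finite"
  assumes "v > 0"
  shows "has_bochner_integral (gauss_vec v) (\<lambda>x :: real ^ 'n. (x $ i) ^ (2 * k))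
           (fact (2 * k) / ((2 / v) ^ k * fact k))"
proof -
  have s: "sqrt v > 0" using assms by simp
  have fin: "(\<integral>\<^sup>+y. ennreal (normal_density 0 (sqrt v) y) * ennreal (y ^ (2 * l)) \<partial>lborel)
      = ennreal (fact (2 * l) / ((2 / v) ^ l * fact l))" for l
  proof -
    have "(\<integral>\<^sup>+y. ennreal (normal_density 0 (sqrt v) y) * ennreal (y ^ (2 * l)) \<partial>lborel)
      = (\<integral>\<^sup>+y. ennreal (normal_density 0 (sqrt v) y * (y - 0) ^ (2 * l)) \<partial>lborel)"
      by (simp add: ennreal_mult')
    also have "\<dots> = ennreal (fact (2 * l) / ((2 / (sqrt v)\<^sup>2) ^ l * fact l))"
      using normal_moment_even[OF s, of 0 l]
      by (subst nn_integral_eq_integral) (auto simp: has_bochner_integral_iff)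
    finally show ?thesis using assms by simp
  qed
  have "(\<integral>\<^sup>+x. ennreal ((x $ i) ^ (2 * k)) \<partial>gauss_vec v)
     = (\<integral>\<^sup>+x. (\<Prod>j\<in>UNIV. ennreal (normal_density 0 (sqrt v) (x $ j))
          * ennreal ((x $ j) ^ (2 * (if j = i then k else 0)))) \<partial>lborel)"
  proof -
    \<comment> \<open>A power at coordinate \<open>i\<close> alone is written as an even power at
      every coordinate, with exponent 0 away from \<open>i\<close>, so that one moment formula
      evaluates all factors.\<close>
    have "(\<Prod>j\<in>UNIV. ennreal (normal_density 0 (sqrt v) (x $ j)) * ennreal ((x $ j) ^ (2 * (if j = i then k else 0))))
      = (\<Prod>j\<in>UNIV. ennreal (normal_density 0 (sqrt v) (x $ j))) * ennreal ((x $ i) ^ (2 * k))" for x :: "real ^ 'n"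
    proof -
      have "(\<Prod>j\<in>UNIV. ennreal ((x $ j) ^ (2 * (if j = i then k else 0))))
         = (\<Prod>j\<in>UNIV. if j = i then ennreal ((x $ j) ^ (2 * k)) else 1)"
        by (intro prod.cong) auto
      then show ?thesis by (simp add: prod.distrib)
    qed
    then show ?thesis
      unfolding gauss_vec_def by (subst nn_integral_density) auto
  qed
  also have "\<dots> = (\<Prod>j\<in>UNIV. ennreal (fact (2 * (if j = i then k else 0)) /
        ((2 / v) ^ (if j = i then k else 0) * fact (if j = i then k else 0))))"
    by (subst nn_integral_lborel_prod_vec) (auto simp del: if_distrib simp: fin)
  also have "\<dots> = (\<Prod>j\<in>UNIV. if j = i then ennreal (fact (2 * k) / ((2 / v) ^ k * fact k)) else 1)"
    by (intro prod.cong) auto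
  finally show ?thesis
    using assms by (intro has_bochner_integral_nn_integral) (auto simp: gauss_vec_def)
qed

text \<open>The Gaussian law is invariant under this reflection, so functions odd in one coordinate
  integrate to 0. That yields the mean and the mixed covariances at once.\<close>

definition flip :: "'n \<Rightarrow> real ^ 'n::finite \<Rightarrow> real ^ 'n" where
  "flip i x = (\<chi> j. if j = i then - x $ j else x $ j)"

lemma flip_measurable [measurable]: "flip i \<in> borel_measurable borel"
  unfolding flip_def
proof (rule borel_measurable_continuous_onI, rule continuous_on_vec_lambda)
  show "continuous_on UNIV (\<lambda>x :: real ^ 'a. if j = i then - x $ j else x $ j)" for j
    by (cases "j = i") (auto intro!: continuous_intros)
qed

lemma gauss_vec_flip: "distr (gauss_vec v) borel (flip i) = (gauss_vec v :: (real ^ 'n::finite) measure)"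
proof -
  define c :: "real ^ 'n \<Rightarrow> real" where "c b = (if b = axis i 1 then - 1 else 1)" for b
  have "(0 + (\<Sum>j\<in>Basis. (c j * (x \<bullet> j)) *\<^sub>R j)) = flip i x" for x :: "real ^ 'n"
  proof -
    have "(\<Sum>j\<in>Basis. (c j * (x \<bullet> j)) *\<^sub>R j) $ k = flip i x $ k" for k
    proof -
      have "(\<Sum>j\<in>Basis. (c j * (x \<bullet> j)) *\<^sub>R j) $ k
        = (\<Sum>j\<in>UNIV. if j = k then (if j = i then - 1 else 1) * x $ j else 0)"
        by (simp only: sum_Basis_vec sum_component, intro sum.cong)
          (auto simp: c_def inner_axis axis_eq_axis, auto simp: axis_def)
      then show ?thesis by (simp add: flip_def)
    qed
    then show ?thesis by (simp add: vec_eq_iff)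
  qed
  moreover have "(\<Prod>j\<in>Basis. \<bar>c j\<bar>) = 1"
    by (intro prod.neutral) (auto simp: c_def)
  ultimately have L: "(lborel :: (real ^ 'n) measure) = distr lborel borel (flip i)"
    using lborel_affine_euclidean[of c 0] by (simp add: c_def density_1)
  define g where "g = (\<lambda>x :: real ^ 'n. \<Prod>i\<in>UNIV. ennreal (normal_density 0 (sqrt v) (x $ i)))"
  have [measurable]: "g \<in> borel_measurable borel" unfolding g_def by measurable
  have "normal_density 0 s (- y) = normal_density 0 s y" for s y :: real
    by (simp add: normal_density_def)
  then have g: "g (flip i x) = g x" for x
    unfolding g_def flip_def by (intro prod.cong) auto
  have "gauss_vec v = density (distr lborel borel (flip i)) g"
    unfolding gauss_vec_def g_def using L by simp
  also have "\<dots> = distr (density lborel (\<lambda>x. g (flip i x))) borel (flip i)"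
    by (rule density_distr) auto
  also have "\<dots> = distr (gauss_vec v) borel (flip i)"
    unfolding g by (simp add: gauss_vec_def g_def)
  finally show ?thesis by simp
qed

lemma gauss_vec_odd_integral:
  fixes g :: "real ^ 'n::finite \<Rightarrow> real"
  assumes [measurable]: "g \<in> borel_measurable borel" and "\<And>x. g (flip i x) = - g x"
  shows "(\<integral>x. g x \<partial>gauss_vec v) = 0"
proof -
  have "(\<integral>x. g x \<partial>gauss_vec v) = (\<integral>x. g x \<partial>distr (gauss_vec v) borel (flip i))"
    by (simp add: gauss_vec_flip)
  also have "\<dots> = (\<integral>x. g (flip i x) \<partial>gauss_vec v)"
    by (rule integral_distr) (auto simp: gauss_vec_def)
  finally show ?thesis using assms(2) by simp
qed

lemma integrable_gauss_vec_product:
  fixes i j :: "'n::finite"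
  assumes "v > 0"
  shows "integrable (gauss_vec v) (\<lambda>x :: real ^ 'n. x $ i * x $ j)"
proof -
  have I: "integrable (gauss_vec v) (\<lambda>x :: real ^ 'n. (x $ l)\<^sup>2)" for l
    using gauss_vec_even_moment[OF assms, of l 1] by (auto simp: has_bochner_integral_iff)
  show ?thesis
  proof (rule Bochner_Integration.integrable_bound)
    show "integrable (gauss_vec v) (\<lambda>x :: real ^ 'n. (x $ i)\<^sup>2 + (x $ j)\<^sup>2)"
      using I by auto
    show "(\<lambda>x :: real ^ 'n. x $ i * x $ j) \<in> borel_measurable (gauss_vec v)"
      by (simp add: gauss_vec_def)
    have "\<bar>a * b\<bar> \<le> a\<^sup>2 + b\<^sup>2" for a b :: real
    proof -
      have "2 * (\<bar>a\<bar> * \<bar>b\<bar>) \<le> a\<^sup>2 + b\<^sup>2"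
        using sum_squares_bound[of "\<bar>a\<bar>" "\<bar>b\<bar>"] by (simp add: mult.assoc)
      moreover have "0 \<le> \<bar>a\<bar> * \<bar>b\<bar>" by simp
      ultimately show ?thesis unfolding abs_mult by linarith
    qed
    then show "AE x in gauss_vec v. norm (x $ i * x $ j) \<le> norm ((x $ i)\<^sup>2 + (x $ j)\<^sup>2)"
      by (auto simp: abs_of_nonneg)
  qed
qed

lemma gauss_vec_covariance:
  fixes i j :: "'n::finite"
  assumes "v > 0"
  shows "(\<integral>x. x $ i * x $ j \<partial>(gauss_vec v :: (real ^ 'n) measure)) = (if i = j then v else 0)"
proof (cases "i = j")
  case True
  then show ?thesis
    using gauss_vec_even_moment[OF assms, of i 1]
    by (auto simp: has_bochner_integral_iff power2_eq_square)
next
  case False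
  then show ?thesis
    by (simp add: gauss_vec_odd_integral[where i = i] flip_def)
qed

lemma gauss_vec_mean:
  fixes i :: "'n::finite"
  shows "(\<integral>x. x $ i \<partial>(gauss_vec v :: (real ^ 'n) measure)) = 0"
  by (rule gauss_vec_odd_integral[where i = i]) (auto simp: flip_def)

text \<open>Compare with the largest coordinate. The power 5 is generous: with the sum over the
  coordinates it becomes a sixth power of the dimension, which later merges with the matrix bound
  into \<open>(real CARD('n) * B) ^ 6\<close>.\<close>

lemma norm_power6_le:
  fixes x :: "real ^ 'n::finite"
  shows "(norm x) ^ 6 \<le> (real CARD('n)) ^ 5 * (\<Sum>i\<in>UNIV. (x $ i) ^ 6)"
proof -
  define a where "a = Max (range (\<lambda>i. \<bar>x $ i\<bar>))"
  have le: "\<bar>x $ i\<bar> \<le> a" for i unfolding a_def by (intro Max_ge) auto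
  have "a \<in> range (\<lambda>i. \<bar>x $ i\<bar>)" unfolding a_def by (intro Max_in) auto
  then obtain i where i: "a = \<bar>x $ i\<bar>" by auto
  have "(norm x)\<^sup>2 = (\<Sum>i\<in>UNIV. (x $ i)\<^sup>2)"
    by (simp add: norm_vec_def L2_set_def sum_nonneg)
  also have "\<dots> \<le> (\<Sum>i\<in>(UNIV :: 'n set). a\<^sup>2)"
    using le by (intro sum_mono) (metis abs_ge_zero power2_abs power_mono)
  finally have "((norm x)\<^sup>2) ^ 3 \<le> (real CARD('n) * a\<^sup>2) ^ 3"
    by (intro power_mono) auto
  then have "(norm x) ^ 6 \<le> (real CARD('n)) ^ 3 * a ^ 6"
    by (simp add: power_mult_distrib flip: power_mult)
  also have "\<dots> = (real CARD('n)) ^ 3 * (x $ i) ^ 6"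
    by (simp add: i)
  also have "\<dots> \<le> (real CARD('n)) ^ 5 * (\<Sum>i\<in>UNIV. (x $ i) ^ 6)"
    by (intro mult_mono power_increasing member_le_sum[of i UNIV "\<lambda>i. (x $ i) ^ 6"]) (auto simp: Suc_le_eq)
  finally show ?thesis .
qed

text \<open>Order \<open>v^3\<close> is the point: divided by \<open>sqrt v\<close>, the increment
  has a sixth moment bounded uniformly in \<open>v\<close>, which controls the factor
  \<open>(c + \<rho>)^6\<close> of \<open>bump_increment\<close>.\<close>

lemma gauss_vec_norm_moment6:
  assumes "v > 0"
  shows "integrable (gauss_vec v) (\<lambda>x :: real ^ 'n::finite. (norm x) ^ 6)"
    and "(\<integral>x. (norm x) ^ 6 \<partial>(gauss_vec v :: (real ^ 'n) measure)) \<le> 15 * real CARD('n) ^ 6 * v ^ 3"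
proof -
  have m: "has_bochner_integral (gauss_vec v) (\<lambda>x :: real ^ 'n. (x $ i) ^ 6) (15 * v ^ 3)" for i
    using gauss_vec_even_moment[OF assms, of i 3] assms
    by (simp add: fact_numeral field_simps power_divide)
  have I: "integrable (gauss_vec v) (\<lambda>x :: real ^ 'n. real CARD('n) ^ 5 * (\<Sum>i\<in>UNIV. (x $ i) ^ 6))"
    using m by (intro integrable_mult_right integrable_sum) (auto simp: has_bochner_integral_iff)
  show 1: "integrable (gauss_vec v) (\<lambda>x :: real ^ 'n. (norm x) ^ 6)"
    using norm_power6_le
    by (intro Bochner_Integration.integrable_bound[OF I]) (auto simp: gauss_vec_def intro!: AE_I2 order_trans[OF norm_power6_le])
  have "(\<integral>x. (norm x) ^ 6 \<partial>(gauss_vec v :: (real ^ 'n) measure))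
      \<le> (\<integral>x. real CARD('n) ^ 5 * (\<Sum>i\<in>UNIV. (x $ i) ^ 6) \<partial>(gauss_vec v :: (real ^ 'n) measure))"
    using norm_power6_le by (intro integral_mono 1 I) auto
  also have "\<dots> = real CARD('n) ^ 5 * (\<Sum>i\<in>(UNIV :: 'n set). 15 * v ^ 3)"
    using m by (simp add: has_bochner_integral_iff)
  also have "\<dots> = 15 * real CARD('n) ^ 6 * v ^ 3"
    by (simp add: power_numeral_reduce)
  finally show "(\<integral>x. (norm x) ^ 6 \<partial>(gauss_vec v :: (real ^ 'n) measure)) \<le> 15 * real CARD('n) ^ 6 * v ^ 3" .
qed

subsection \<open>Brownian increments\<close>

lemma borel_measurable_vec_nth_comp [measurable (raw)]:
  fixes f :: "'a \<Rightarrow> ('b::real_normed_vector) ^ 'n::finite"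
  assumes "f \<in> borel_measurable M"
  shows "(\<lambda>x. f x $ i) \<in> borel_measurable M"
  by (rule measurable_compose[OF assms borel_measurable_continuous_onI]) (intro continuous_intros)

locale filtered_brownian = prob_space M
  for M :: "'a measure" and F :: "real \<Rightarrow> 'a measure" and T :: real
    and W :: "real \<Rightarrow> 'a \<Rightarrow> real ^ 'n::finite" +
  assumes T_pos: "T > 0"
    and filtration: "filtration_usual M F T"
    and brownian: "brownian_motion M F T W"
begin

lemma subalgebra_F: "t \<in> {0..T} \<Longrightarrow> subalgebra M (F t)"
  using filtration by (auto simp: filtration_usual_def)

lemma space_F: "t \<in> {0..T} \<Longrightarrow> space (F t) = space M"
  using subalgebra_F by (auto simp: subalgebra_def)

lemma sets_F: "t \<in> {0..T} \<Longrightarrow> A \<in> sets (F t) \<Longrightarrow> A \<in> sets M"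
  using subalgebra_F by (auto simp: subalgebra_def)

lemma sets_F_mono:
  "0 \<le> s \<Longrightarrow> s \<le> t \<Longrightarrow> t \<le> T \<Longrightarrow> A \<in> sets (F s) \<Longrightarrow> A \<in> sets (F t)"
  using filtration by (auto simp: filtration_usual_def)

lemma measurable_F: "t \<in> {0..T} \<Longrightarrow> f \<in> measurable (F t) N \<Longrightarrow> f \<in> measurable M N"
  using subalgebra_F measurable_from_subalg by blast

lemma measurable_F_mono:
  assumes "0 \<le> s" "s \<le> t" "t \<le> T" "f \<in> measurable (F s) N"
  shows "f \<in> measurable (F t) N"
proof (rule measurable_from_subalg)
  show "subalgebra (F t) (F s)"
    using sets_F_mono[OF assms(1-3)] space_F[of s] space_F[of t] assms(1-3)
    by (auto simp: subalgebra_def)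
qed (rule assms)

lemma W_measurable_F: "t \<in> {0..T} \<Longrightarrow> W t \<in> borel_measurable (F t)"
  using brownian by (auto simp: brownian_motion_def)

lemma W_measurable [measurable (raw)]: "t \<in> {0..T} \<Longrightarrow> W t \<in> borel_measurable M"
  using W_measurable_F measurable_F by blast

context
  fixes u v :: real
  assumes uv: "0 \<le> u" "u < v" "v \<le> T"
begin

lemma increment_measurable [measurable]: "(\<lambda>\<omega>. W v \<omega> - W u \<omega>) \<in> borel_measurable M"
  using uv by (intro borel_measurable_diff W_measurable) auto

lemma increment_distr: "distr M borel (\<lambda>\<omega>. W v \<omega> - W u \<omega>) = gauss_vec (v - u)"
  using brownian uv by (auto simp: brownian_motion_def)

text \<open>The product formula in \<open>brownian_motion\<close> speaks of events; here it is read
  for preimages under \<open>Y\<close> and under \<open>g\<close> of the increment, so that the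
  product rule for expectations applies.\<close>

lemma increment_indep:
  fixes g :: "real ^ 'n \<Rightarrow> real"
  assumes Y: "Y \<in> borel_measurable (F u)" and [measurable]: "g \<in> borel_measurable borel"
  shows "indep_var borel Y borel (\<lambda>\<omega>. g (W v \<omega> - W u \<omega>))"
proof -
  let ?D = "\<lambda>\<omega>. W v \<omega> - W u \<omega>"
  have u: "u \<in> {0..T}" using uv by auto
  have [measurable]: "Y \<in> borel_measurable M" using measurable_F[OF u Y] .
  \<comment> \<open>Preimages of Borel sets already form a sigma-algebra, so independence has to be
    checked on them only and no generator argument is required.\<close>
  have vimage: "sigma_sets (space M) {f -` A \<inter> space M |A. A \<in> sets borel} = {f -` A \<inter> space M |A. A \<in> sets borel}"
    for f :: "'a \<Rightarrow> real"
    using sigma_sets_vimage_commute[of f "space M" UNIV "sets (borel :: real measure)"]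
      sets.sigma_sets_eq[of "borel :: real measure"] by auto
  show ?thesis
    unfolding indep_var_eq vimage
  proof (intro conjI indep_setI)
    show "{Y -` A \<inter> space M |A. A \<in> sets borel} \<subseteq> events"
      "{(\<lambda>\<omega>. g (?D \<omega>)) -` A \<inter> space M |A. A \<in> sets borel} \<subseteq> events"
      by (auto intro: measurable_sets)
    fix a b
    assume "a \<in> {Y -` A \<inter> space M |A. A \<in> sets borel}"
      and "b \<in> {(\<lambda>\<omega>. g (?D \<omega>)) -` A \<inter> space M |A. A \<in> sets borel}"
    then obtain A B where A: "A \<in> sets borel" "a = Y -` A \<inter> space (F u)"
      and B: "B \<in> sets borel" "b = (\<lambda>\<omega>. g (?D \<omega>)) -` B \<inter> space M"
      by (auto simp: space_F[OF u])
    have a: "a \<in> sets (F u)" using A Y by (auto intro: measurable_sets)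
    have "g -` B \<in> sets borel" using measurable_sets[of g borel borel B] B by simp
    then have "prob {\<omega> \<in> space M. \<omega> \<in> a \<and> ?D \<omega> \<in> g -` B} = prob a * prob {\<omega> \<in> space M. ?D \<omega> \<in> g -` B}"
      using brownian uv a unfolding brownian_motion_def by blast
    moreover have "a \<inter> b = {\<omega> \<in> space M. \<omega> \<in> a \<and> ?D \<omega> \<in> g -` B}" "b = {\<omega> \<in> space M. ?D \<omega> \<in> g -` B}"
      using B by auto
    ultimately show "prob (a \<inter> b) = prob a * prob b" by simp
  qed auto
qed

lemma increment_expectation:
  fixes g :: "real ^ 'n \<Rightarrow> real"
  assumes g [measurable]: "g \<in> borel_measurable borel" and "integrable (gauss_vec (v - u)) g"
  shows "integrable M (\<lambda>\<omega>. g (W v \<omega> - W u \<omega>))"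
    and "expectation (\<lambda>\<omega>. g (W v \<omega> - W u \<omega>)) = (\<integral>x. g x \<partial>gauss_vec (v - u))"
proof -
  have "integrable (distr M borel (\<lambda>\<omega>. W v \<omega> - W u \<omega>)) g"
    using assms(2) unfolding increment_distr .
  then show "integrable M (\<lambda>\<omega>. g (W v \<omega> - W u \<omega>))"
    by (rule integrable_distr[OF increment_measurable])
  show "expectation (\<lambda>\<omega>. g (W v \<omega> - W u \<omega>)) = (\<integral>x. g x \<partial>gauss_vec (v - u))"
    unfolding increment_distr[symmetric] by (rule integral_distr[OF increment_measurable g, symmetric])
qed

lemma increment_product:
  fixes g :: "real ^ 'n \<Rightarrow> real"
  assumes Y: "Y \<in> borel_measurable (F u)" "integrable M Y"
    and g: "g \<in> borel_measurable borel" "integrable (gauss_vec (v - u)) g"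
  shows "integrable M (\<lambda>\<omega>. Y \<omega> * g (W v \<omega> - W u \<omega>))"
    and "expectation (\<lambda>\<omega>. Y \<omega> * g (W v \<omega> - W u \<omega>)) = expectation Y * (\<integral>x. g x \<partial>gauss_vec (v - u))"
proof -
  note I = increment_indep[OF Y(1) g(1)]
  show "integrable M (\<lambda>\<omega>. Y \<omega> * g (W v \<omega> - W u \<omega>))"
    using indep_var_integrable[OF I Y(2) increment_expectation(1)[OF g]] .
  show "expectation (\<lambda>\<omega>. Y \<omega> * g (W v \<omega> - W u \<omega>)) = expectation Y * (\<integral>x. g x \<partial>gauss_vec (v - u))"
    using indep_var_lebesgue_integral[OF I Y(2) increment_expectation(1)[OF g]]
      increment_expectation(2)[OF g] by simp
qed

lemma bounded_integrable_F:
  fixes Y :: "'a \<Rightarrow> real"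
  assumes "Y \<in> borel_measurable (F u)" "\<And>\<omega>. \<omega> \<in> space M \<Longrightarrow> \<bar>Y \<omega>\<bar> \<le> C"
  shows "integrable M Y"
proof (rule integrable_const_bound[of _ C])
  show "AE \<omega> in M. norm (Y \<omega>) \<le> C" using assms(2) by (intro AE_I2) simp
  show "Y \<in> borel_measurable M" using assms(1) uv by (intro measurable_F[of u]) auto
qed

lemma increment_linear:
  fixes a :: "'a \<Rightarrow> real ^ 'n"
  assumes [measurable]: "a \<in> borel_measurable (F u)" "Y \<in> borel_measurable (F u)"
    and a: "\<And>\<omega>. \<omega> \<in> space M \<Longrightarrow> norm (a \<omega>) \<le> B"
    and Y: "\<And>\<omega>. \<omega> \<in> space M \<Longrightarrow> \<bar>Y \<omega>\<bar> \<le> C"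
  shows "has_bochner_integral M (\<lambda>\<omega>. Y \<omega> * (a \<omega> \<bullet> (W v \<omega> - W u \<omega>))) 0"
proof -
  have vu: "v - u > 0" using uv by simp
  have int: "integrable (gauss_vec (v - u)) (\<lambda>x. x $ i)" for i :: 'n
  proof (rule Bochner_Integration.integrable_bound)
    \<comment> \<open>The power 0 is the constant 1 in disguise, so both summands are instances of
      the even moment formula.\<close>
    show "integrable (gauss_vec (v - u)) (\<lambda>x. (x $ i) ^ 0 + (x $ i)\<^sup>2)"
      using gauss_vec_even_moment[OF vu, of i 0] gauss_vec_even_moment[OF vu, of i 1]
      by (intro Bochner_Integration.integrable_add) (auto simp: has_bochner_integral_iff)
    have "\<bar>y\<bar> \<le> 1 + y\<^sup>2" for y :: real
      using sum_squares_bound[of 1 "\<bar>y\<bar>"] by simp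
    then show "AE x in gauss_vec (v - u). norm (x $ i) \<le> norm ((x $ i) ^ 0 + (x $ i)\<^sup>2)"
      by simp
  qed (simp add: gauss_vec_def)
  have bd: "\<bar>Y \<omega> * a \<omega> $ i\<bar> \<le> C * B" if "\<omega> \<in> space M" for \<omega> i
    using Y[OF that] a[OF that] component_le_norm_cart[of "a \<omega>" i]
    unfolding abs_mult by (intro mult_mono) auto
  have 0: "has_bochner_integral M (\<lambda>\<omega>. Y \<omega> * a \<omega> $ i * (W v \<omega> - W u \<omega>) $ i) 0" for i
  proof -
    have m: "(\<lambda>\<omega>. Y \<omega> * a \<omega> $ i) \<in> borel_measurable (F u)" by measurable
    have g: "(\<lambda>x :: real ^ 'n. x $ i) \<in> borel_measurable borel" by measurable
    show ?thesis
      using increment_product[OF m bounded_integrable_F[OF m bd] g int]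
      unfolding has_bochner_integral_iff gauss_vec_mean by simp
  qed
  have "has_bochner_integral M (\<lambda>\<omega>. \<Sum>i\<in>UNIV. Y \<omega> * a \<omega> $ i * (W v \<omega> - W u \<omega>) $ i) (\<Sum>i\<in>(UNIV::'n set). 0)"
    by (intro has_bochner_integral_sum 0)
  then show ?thesis
    unfolding inner_vec_def sum_distrib_left by (simp add: mult.assoc)
qed

text \<open>The Ito isometry for a single step with weight \<open>Y\<close>: coefficients known at
  time \<open>u\<close> factor out, and the covariance matrix \<open>(v - u)\<close> times the
  identity leaves only the diagonal.\<close>

lemma increment_quadratic:
  fixes a :: "'a \<Rightarrow> real ^ 'n"
  assumes [measurable]: "a \<in> borel_measurable (F u)" "Y \<in> borel_measurable (F u)"
    and a: "\<And>\<omega>. \<omega> \<in> space M \<Longrightarrow> norm (a \<omega>) \<le> B"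
    and Y: "\<And>\<omega>. \<omega> \<in> space M \<Longrightarrow> \<bar>Y \<omega>\<bar> \<le> C"
  shows "has_bochner_integral M (\<lambda>\<omega>. Y \<omega> * (a \<omega> \<bullet> (W v \<omega> - W u \<omega>))\<^sup>2)
           ((v - u) * expectation (\<lambda>\<omega>. Y \<omega> * (norm (a \<omega>))\<^sup>2))"
proof -
  have vu: "v - u > 0" using uv by simp
  have bd: "\<bar>Y \<omega> * (a \<omega> $ i * a \<omega> $ j)\<bar> \<le> C * (B * B)" if "\<omega> \<in> space M" for \<omega> i j
  proof -
    have "\<bar>a \<omega> $ i\<bar> \<le> B" "\<bar>a \<omega> $ j\<bar> \<le> B"
      using a[OF that] component_le_norm_cart[of "a \<omega>"] order_trans by blast+
    moreover from this have "0 \<le> B" by linarith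
    moreover have "0 \<le> C" using Y[OF that] by linarith
    ultimately show ?thesis
      using Y[OF that] unfolding abs_mult by (intro mult_mono) auto
  qed
  have 0: "has_bochner_integral M (\<lambda>\<omega>. Y \<omega> * (a \<omega> $ i * a \<omega> $ j) * ((W v \<omega> - W u \<omega>) $ i * (W v \<omega> - W u \<omega>) $ j))
      (expectation (\<lambda>\<omega>. Y \<omega> * (a \<omega> $ i * a \<omega> $ j)) * (if i = j then v - u else 0))" for i j
  proof -
    have m: "(\<lambda>\<omega>. Y \<omega> * (a \<omega> $ i * a \<omega> $ j)) \<in> borel_measurable (F u)" by measurable
    have g: "(\<lambda>x :: real ^ 'n. x $ i * x $ j) \<in> borel_measurable borel" by measurable
    show ?thesis
      using increment_product[OF m bounded_integrable_F[OF m bd] g integrable_gauss_vec_product[OF vu]]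
      unfolding has_bochner_integral_iff gauss_vec_covariance[OF vu] by blast
  qed
  have 1: "has_bochner_integral M (\<lambda>\<omega>. \<Sum>i\<in>UNIV. \<Sum>j\<in>UNIV.
         Y \<omega> * (a \<omega> $ i * a \<omega> $ j) * ((W v \<omega> - W u \<omega>) $ i * (W v \<omega> - W u \<omega>) $ j))
      (\<Sum>i\<in>UNIV. \<Sum>j\<in>UNIV. expectation (\<lambda>\<omega>. Y \<omega> * (a \<omega> $ i * a \<omega> $ j)) * (if i = j then v - u else 0))"
    by (intro has_bochner_integral_sum 0)
  have 2: "(\<Sum>i\<in>UNIV. \<Sum>j\<in>UNIV. Y \<omega> * (a \<omega> $ i * a \<omega> $ j) * ((W v \<omega> - W u \<omega>) $ i * (W v \<omega> - W u \<omega>) $ j))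
      = Y \<omega> * (a \<omega> \<bullet> (W v \<omega> - W u \<omega>))\<^sup>2" for \<omega>
  proof -
    have "Y \<omega> * (a \<omega> \<bullet> d)\<^sup>2 = (\<Sum>i\<in>UNIV. \<Sum>j\<in>UNIV. Y \<omega> * (a \<omega> $ i * a \<omega> $ j) * (d $ i * d $ j))" for d
    proof -
      have "(a \<omega> \<bullet> d)\<^sup>2 = (\<Sum>i\<in>UNIV. \<Sum>j\<in>UNIV. (a \<omega> $ i * d $ i) * (a \<omega> $ j * d $ j))"
        by (simp add: inner_vec_def power2_eq_square sum_product)
      then show ?thesis by (simp only: sum_distrib_left) (intro sum.cong refl, simp)
    qed
    then show ?thesis by (rule sym)
  qed
  have 3: "(\<Sum>i\<in>UNIV. \<Sum>j\<in>UNIV. expectation (\<lambda>\<omega>. Y \<omega> * (a \<omega> $ i * a \<omega> $ j)) * (if i = j then v - u else 0))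
      = (v - u) * expectation (\<lambda>\<omega>. Y \<omega> * (norm (a \<omega>))\<^sup>2)"
  proof -
    have "(\<Sum>i\<in>UNIV. \<Sum>j\<in>UNIV. expectation (\<lambda>\<omega>. Y \<omega> * (a \<omega> $ i * a \<omega> $ j)) * (if i = j then v - u else 0))
      = (v - u) * (\<Sum>i\<in>UNIV. expectation (\<lambda>\<omega>. Y \<omega> * (a \<omega> $ i * a \<omega> $ i)))"
    proof -
      have "e * (if P then v - u else 0) = (if P then (v - u) * e else 0)" for e P by simp
      then show ?thesis by (simp add: sum_distrib_left)
    qed
    also have "(\<Sum>i\<in>UNIV. expectation (\<lambda>\<omega>. Y \<omega> * (a \<omega> $ i * a \<omega> $ i)))
      = expectation (\<lambda>\<omega>. \<Sum>i\<in>UNIV. Y \<omega> * (a \<omega> $ i * a \<omega> $ i))"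
      by (intro Bochner_Integration.integral_sum[symmetric] bounded_integrable_F[OF _ bd]; measurable)
    also have "(\<lambda>\<omega>. \<Sum>i\<in>UNIV. Y \<omega> * (a \<omega> $ i * a \<omega> $ i)) = (\<lambda>\<omega>. Y \<omega> * (norm (a \<omega>))\<^sup>2)"
      by (simp add: power2_norm_eq_inner inner_vec_def sum_distrib_left)
    finally show ?thesis .
  qed
  show ?thesis using 1 unfolding 2 3 .
qed

end

end

subsection \<open>One step with a predictable diffusion matrix\<close>

text \<open>So the norm of a matrix is the Frobenius norm. It dominates the operator norm, is
  invariant under transposition, and its square is the trace term of the generator.\<close>

lemma norm_matrix_sq:
  fixes A :: "real ^ 'n::finite ^ 'm::finite"
  shows "(norm A)\<^sup>2 = (\<Sum>i\<in>UNIV. (norm (A $ i))\<^sup>2)"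
  by (simp add: norm_vec_def[of A] L2_set_def sum_nonneg)

lemma norm_matrix_vector_le:
  fixes A :: "real ^ 'n::finite ^ 'm::finite"
  shows "norm (A *v x) \<le> norm A * norm x"
proof (rule power2_le_imp_le)
  have "(norm (A *v x))\<^sup>2 = (\<Sum>i\<in>UNIV. (A $ i \<bullet> x)\<^sup>2)"
    by (simp add: norm_vec_def L2_set_def sum_nonneg matrix_vector_mul_component)
  also have "\<dots> \<le> (\<Sum>i\<in>UNIV. (norm (A $ i))\<^sup>2 * (norm x)\<^sup>2)"
    by (intro sum_mono) (metis Cauchy_Schwarz_ineq2 abs_ge_zero power2_abs power_mono power_mult_distrib)
  also have "\<dots> = (norm A * norm x)\<^sup>2"
    by (simp add: norm_matrix_sq power_mult_distrib sum_distrib_right)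
  finally show "(norm (A *v x))\<^sup>2 \<le> (norm A * norm x)\<^sup>2" .
qed simp

lemma norm_transpose:
  fixes A :: "real ^ 'n::finite ^ 'm::finite"
  shows "norm (transpose A) = norm A"
proof -
  have "(norm (transpose A))\<^sup>2 = (\<Sum>i\<in>UNIV. \<Sum>j\<in>UNIV. (A $ j $ i)\<^sup>2)"
    unfolding norm_matrix_sq by (simp add: norm_vec_def L2_set_def sum_nonneg transpose_def)
  also have "\<dots> = (norm A)\<^sup>2"
    unfolding norm_matrix_sq by (subst sum.swap) (simp add: norm_vec_def L2_set_def sum_nonneg)
  finally show ?thesis by simp
qed

lemma norm_row_le:
  fixes A :: "real ^ 'n::finite ^ 'm::finite"
  shows "norm (A $ i) \<le> norm A"
  by (rule Finite_Cartesian_Product.norm_nth_le)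

lemma borel_measurable_transpose_mult [measurable (raw)]:
  fixes f :: "'a \<Rightarrow> real ^ 'n::finite ^ 'm::finite"
  assumes "f \<in> borel_measurable N" "g \<in> borel_measurable N"
  shows "(\<lambda>\<omega>. transpose (f \<omega>) *v g \<omega>) \<in> borel_measurable N"
  by (rule borel_measurable_continuous_Pair[OF assms])
    (auto simp: transpose_def matrix_vector_mult_def intro!: continuous_intros)

lemma power6_sum_le:
  fixes a b :: real
  assumes "a \<ge> 0" "b \<ge> 0"
  shows "(a + b) ^ 6 \<le> 64 * (a ^ 6 + b ^ 6)"
proof -
  have "(a + b) ^ 6 \<le> (2 * max a b) ^ 6" using assms by (intro power_mono) auto
  also have "\<dots> = 64 * (max a b) ^ 6" by (simp add: power_mult_distrib)
  also have "\<dots> \<le> 64 * (a ^ 6 + b ^ 6)" using assms by (simp add: max_def)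
  finally show ?thesis .
qed

text \<open>A lower bound, valid for every drift of norm at most c, for the derivative along the process of
  exp (l s) times the bump, divided by exp (l s), at position x when the diffusion matrix is H.\<close>

definition generator_bound :: "real \<Rightarrow> real \<Rightarrow> real \<Rightarrow> real ^ 'n::finite ^ 'n \<Rightarrow> real ^ 'n \<Rightarrow> real" where
  "generator_bound r l c H x = (let q = max 0 (r\<^sup>2 - (norm x)\<^sup>2) in
     l * q ^ 3 - 6 * q\<^sup>2 * r * c - 3 * q\<^sup>2 * (norm H)\<^sup>2 + 12 * q * (norm (transpose H *v x))\<^sup>2)"

text \<open>The constant in front of \<open>h^3 (c + \<rho>)^6\<close> in
  \<open>bump_increment\<close>: one summand each for the first, second and third order in
  \<open>d\<close>, then the contribution of the factor \<open>1 + l h^2\<close>.\<close>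

definition step_error :: "real \<Rightarrow> real \<Rightarrow> real" where
  "step_error r l = 9 * r ^ 4 + 12 * r ^ 3 * (2 * r + 1) + (2 * r + 1) ^ 3
      + l * (3 * r ^ 4 * (2 * r + 1) + (2 * r + 1) ^ 3)"

lemma generator_bound_measurable [measurable (raw)]:
  assumes "f \<in> borel_measurable N" "g \<in> borel_measurable N"
  shows "(\<lambda>\<omega>. generator_bound r l c (f \<omega>) (g \<omega>)) \<in> borel_measurable N"
  using assms unfolding generator_bound_def Let_def by measurable

lemma (in prob_space) integrable_indicator_bump:
  fixes Y :: "'a \<Rightarrow> 'b::euclidean_space"
  assumes [measurable]: "A \<in> sets M" "Y \<in> borel_measurable M"
  shows "integrable M (\<lambda>\<omega>. indicator A \<omega> * bump r (Y \<omega>))"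
proof (rule integrable_const_bound[of _ "r ^ 6"])
  show "AE \<omega> in M. norm (indicator A \<omega> * bump r (Y \<omega>)) \<le> r ^ 6"
    by (intro AE_I2) (auto simp: indicator_def abs_of_nonneg bump_le bump_nonneg)
qed measurable

text \<open>\<open>bump_increment\<close> is integrated over an event known at time
  \<open>u\<close>. The term linear in the Brownian increment disappears, the two quadratic ones
  become \<open>v - u\<close> times squared norms, and together with the drift they form
  \<open>generator_bound\<close>. The remainder has order \<open>(v - u)^(3/2)\<close>, small enough
  to be summed over a partition.\<close>

lemma (in filtered_brownian) bump_step:
  assumes uv: "0 \<le> u" "u < v" "v \<le> T" "v - u \<le> 1"
    and pos: "r > 0" "l \<ge> 0" "c \<ge> 1"
    and A: "A \<in> sets (F u)"
    and x [measurable]: "x \<in> borel_measurable (F u)"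
    and H [measurable]: "H \<in> borel_measurable (F u)"
    and B: "\<And>\<omega>. \<omega> \<in> space M \<Longrightarrow> norm (H \<omega>) \<le> B"
    and Z [measurable]: "Z \<in> borel_measurable M"
    and incr: "AE \<omega> in M. norm (Z \<omega> - x \<omega> - H \<omega> *v (W v \<omega> - W u \<omega>)) \<le> c * (v - u)"
  shows "(1 + l * (v - u)) * expectation (\<lambda>\<omega>. indicator A \<omega> * bump r (Z \<omega>))
       - expectation (\<lambda>\<omega>. indicator A \<omega> * bump r (x \<omega>))
     \<ge> (v - u) * expectation (\<lambda>\<omega>. indicator A \<omega> * generator_bound r l c (H \<omega>) (x \<omega>))
       - step_error r l * 64 * (c ^ 6 + 15 * (real CARD('n) * B) ^ 6) * (v - u) * sqrt (v - u)"
proof -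
  let ?D = "\<lambda>\<omega>. W v \<omega> - W u \<omega>"
  define h where "h = sqrt (v - u)"
  have h: "0 < h" "h \<le> 1" "h\<^sup>2 = v - u" using uv by (auto simp: h_def)
  have h3: "h ^ 3 = (v - u) * sqrt (v - u)"
    using h by (simp add: power3_eq_cube h_def)
  have u: "u \<in> {0..T}" using uv by auto
  note uv3 = uv(1-3)
  obtain \<omega>0 where "\<omega>0 \<in> space M" using not_empty by auto
  then have B0: "B \<ge> 0" using B norm_ge_zero order_trans by blast
  define q where "q \<omega> = max 0 (r\<^sup>2 - (norm (x \<omega>))\<^sup>2)" for \<omega>
  \<comment> \<open>\<open>G\<close> cuts down to the open ball. Outside it the bump at
    \<open>x\<close> is 0 and the later bump is nonnegative, so nothing is lost, while all
    coefficients become bounded although \<open>x\<close> is not.\<close>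
  define G where "G \<omega> = indicator A \<omega> * (if norm (x \<omega>) < r then 1 else 0 :: real)" for \<omega>
  define a where "a \<omega> = G \<omega> *\<^sub>R (transpose (H \<omega>) *v x \<omega>)" for \<omega>
  have [measurable]: "q \<in> borel_measurable (F u)" unfolding q_def by measurable
  have [measurable]: "A \<in> sets (F u)" by fact
  have [measurable]: "G \<in> borel_measurable (F u)" unfolding G_def by measurable
  have [measurable]: "a \<in> borel_measurable (F u)" unfolding a_def by measurable
  have q: "0 \<le> q \<omega>" "q \<omega> \<le> r\<^sup>2" for \<omega> unfolding q_def by auto
  have G: "G \<omega> = 0 \<or> G \<omega> = 1" for \<omega> by (auto simp: G_def indicator_def)
  have Gq: "q \<omega> = 0" if "\<not> norm (x \<omega>) < r" for \<omega>
    using that pos power_mono[of r "norm (x \<omega>)" 2] by (auto simp: q_def)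
  have Gb: "\<bar>G \<omega> * (k * q \<omega> ^ m)\<bar> \<le> \<bar>k\<bar> * (r\<^sup>2) ^ m" for \<omega> k and m :: nat
  proof -
    have "\<bar>G \<omega> * (k * q \<omega> ^ m)\<bar> \<le> \<bar>k * q \<omega> ^ m\<bar>" using G[of \<omega>] by auto
    also have "\<dots> \<le> \<bar>k\<bar> * (r\<^sup>2) ^ m"
      using q[of \<omega>] by (auto simp: abs_mult intro!: mult_left_mono power_mono)
    finally show ?thesis .
  qed
  have ab: "norm (a \<omega>) \<le> B * r" if "\<omega> \<in> space M" for \<omega>
  proof (cases "norm (x \<omega>) < r")
    case True
    have "norm (a \<omega>) \<le> norm (transpose (H \<omega>) *v x \<omega>)"
      using G[of \<omega>] by (auto simp: a_def)
    also have "\<dots> \<le> norm (transpose (H \<omega>)) * norm (x \<omega>)" by (rule norm_matrix_vector_le)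
    also have "\<dots> \<le> B * r" using B[OF that] True B0 unfolding norm_transpose by (intro mult_mono) auto
    finally show ?thesis .
  next
    case False
    then show ?thesis using B0 pos by (simp add: a_def G_def)
  qed
  have Hb: "norm (H \<omega> $ i) \<le> B" if "\<omega> \<in> space M" for \<omega> i
    using norm_row_le[of "H \<omega>" i] B[OF that] by linarith
  define C where "C = step_error r l * h ^ 3 * 64"
  have C: "C \<ge> 0" unfolding C_def step_error_def using pos h by simp

  \<comment> \<open>An integrable minorant whose expectation can be computed exactly. Each
    coefficient has the shape \<open>G * (k * q^m)\<close>, so the single bound \<open>Gb\<close>
    serves them all. The last term is not cut by \<open>G\<close>; it is only subtracted, so
    \<open>L\<close> stays below 0 where \<open>G\<close> vanishes.\<close>
  define L where "L \<omega> = h\<^sup>2 * (G \<omega> * (l * q \<omega> ^ 3) - G \<omega> * ((6 * r * c) * q \<omega> ^ 2))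
      - (G \<omega> * (6 * q \<omega> ^ 2)) * (a \<omega> \<bullet> ?D \<omega>)
      - (\<Sum>i\<in>UNIV. (G \<omega> * (3 * q \<omega> ^ 2)) * (H \<omega> $ i \<bullet> ?D \<omega>)\<^sup>2)
      + (G \<omega> * (12 * q \<omega> ^ 1)) * (a \<omega> \<bullet> ?D \<omega>)\<^sup>2
      - C * (c ^ 6 + (B / h) ^ 6 * (norm (?D \<omega>)) ^ 6)" for \<omega>

  have pointwise: "AE \<omega> in M. L \<omega> \<le> (1 + l * (v - u)) * (indicator A \<omega> * bump r (Z \<omega>)) - indicator A \<omega> * bump r (x \<omega>)"
    using incr
  proof (rule AE_mp, intro AE_I2 impI)
    fix \<omega> assume \<omega>: "\<omega> \<in> space M" and Zx: "norm (Z \<omega> - x \<omega> - H \<omega> *v ?D \<omega>) \<le> c * (v - u)"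
    have err: "0 \<le> C * (c ^ 6 + (B / h) ^ 6 * (norm (?D \<omega>)) ^ 6)"
      using C pos B0 h by simp
    show "L \<omega> \<le> (1 + l * (v - u)) * (indicator A \<omega> * bump r (Z \<omega>)) - indicator A \<omega> * bump r (x \<omega>)"
    proof (cases "\<omega> \<in> A \<and> norm (x \<omega>) < r")
      case False
      then have "G \<omega> = 0" by (auto simp: G_def)
      then have "L \<omega> \<le> 0" using err by (simp add: L_def)
      moreover have "indicator A \<omega> * bump r (x \<omega>) = 0"
      proof (cases "\<omega> \<in> A")
        case True
        then have "\<not> 0 < bump r (x \<omega>)" using False bump_pos_iff[OF pos(1)] by auto
        then show ?thesis using bump_nonneg[of r "x \<omega>"] by simp
      qed simp
      moreover have "0 \<le> (1 + l * (v - u)) * (indicator A \<omega> * bump r (Z \<omega>))"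
        using uv pos bump_nonneg by (intro mult_nonneg_nonneg) auto
      ultimately show ?thesis by linarith
    next
      case True
      then have G1: "G \<omega> = 1" by (simp add: G_def)
      define b where "b = Z \<omega> - x \<omega> - H \<omega> *v ?D \<omega>"
      define w where "w = H \<omega> *v ?D \<omega>"
      \<comment> \<open>The size of the Brownian increment in units of its standard deviation per
        coordinate, times the bound on the matrix.\<close>
      define \<rho> where "\<rho> = B / h * norm (?D \<omega>)"
      have Zeq: "Z \<omega> = x \<omega> + b + w" by (simp add: b_def w_def)
      have "norm w \<le> B * norm (?D \<omega>)"
        unfolding w_def using norm_matrix_vector_le[of "H \<omega>" "?D \<omega>"] B[OF \<omega>]
        by (meson mult_right_mono norm_ge_zero order_trans)
      then have w: "norm w \<le> h * \<rho>" using h by (simp add: \<rho>_def)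
      have qq: "q \<omega> = r\<^sup>2 - (norm (x \<omega>))\<^sup>2"
        using True pos power_mono[of "norm (x \<omega>)" r 2] by (auto simp: q_def)
      have "norm b \<le> c * h\<^sup>2" using Zx h by (simp add: b_def)
      note bi = bump_increment[OF pos h(1,2) conjunct2[OF True] this w]
      have xw: "x \<omega> \<bullet> w = a \<omega> \<bullet> ?D \<omega>"
        by (simp add: w_def a_def G1 dot_lmul_matrix)
      have nw: "(norm w)\<^sup>2 = (\<Sum>i\<in>UNIV. (H \<omega> $ i \<bullet> ?D \<omega>)\<^sup>2)"
        unfolding w_def by (simp add: norm_vec_def L2_set_def sum_nonneg matrix_vector_mul_component)
      have "(c + \<rho>) ^ 6 \<le> 64 * (c ^ 6 + \<rho> ^ 6)"
        using pos B0 h by (intro power6_sum_le) (auto simp: \<rho>_def)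
      then have "step_error r l * h ^ 3 * (c + \<rho>) ^ 6 \<le> step_error r l * h ^ 3 * (64 * (c ^ 6 + \<rho> ^ 6))"
        using C by (intro mult_left_mono) (auto simp: C_def)
      also have "\<dots> = C * (c ^ 6 + (B / h) ^ 6 * (norm (?D \<omega>)) ^ 6)"
        by (simp add: C_def \<rho>_def power_mult_distrib power_divide)
      finally have e: "step_error r l * h ^ 3 * (c + \<rho>) ^ 6 \<le> C * (c ^ 6 + (B / h) ^ 6 * (norm (?D \<omega>)) ^ 6)" .
      have "L \<omega> = h\<^sup>2 * (l * q \<omega> ^ 3 - 6 * (q \<omega>)\<^sup>2 * r * c) - 6 * (q \<omega>)\<^sup>2 * (x \<omega> \<bullet> w)
         - 3 * (q \<omega>)\<^sup>2 * (norm w)\<^sup>2 + 12 * q \<omega> * (x \<omega> \<bullet> w)\<^sup>2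
         - C * (c ^ 6 + (B / h) ^ 6 * (norm (?D \<omega>)) ^ 6)"
        unfolding L_def nw xw G1 by (simp add: sum_distrib_left)
      also have "\<dots> \<le> (1 + l * h\<^sup>2) * bump r (Z \<omega>) - bump r (x \<omega>)"
        using bi e unfolding Zeq qq[symmetric] step_error_def by linarith
      finally show ?thesis using True h by simp
    qed
  qed

  define E where "E f = expectation (\<lambda>\<omega>. f \<omega>)" for f :: "'a \<Rightarrow> real"
  have int1: "has_bochner_integral M (\<lambda>\<omega>. G \<omega> * (k * q \<omega> ^ m)) (E (\<lambda>\<omega>. G \<omega> * (k * q \<omega> ^ m)))" for k m
  proof -
    have "(\<lambda>\<omega>. G \<omega> * (k * q \<omega> ^ m)) \<in> borel_measurable (F u)" by measurable
    then have "integrable M (\<lambda>\<omega>. G \<omega> * (k * q \<omega> ^ m))"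
      by (rule bounded_integrable_F[OF uv3]) (rule Gb)
    then show ?thesis unfolding E_def has_bochner_integral_iff by simp
  qed
  have V: "G \<omega> * (12 * q \<omega> ^ 1) * (norm (a \<omega>))\<^sup>2 = G \<omega> * (12 * q \<omega> * (norm (transpose (H \<omega>) *v x \<omega>))\<^sup>2)" for \<omega>
    using G[of \<omega>] by (auto simp: a_def)
  have int2: "has_bochner_integral M (\<lambda>\<omega>. (G \<omega> * (6 * q \<omega> ^ 2)) * (a \<omega> \<bullet> ?D \<omega>)) 0"
    by (rule increment_linear[OF uv3 _ _ ab Gb]) measurable
  have int3: "has_bochner_integral M (\<lambda>\<omega>. (G \<omega> * (3 * q \<omega> ^ 2)) * (H \<omega> $ i \<bullet> ?D \<omega>)\<^sup>2)
      ((v - u) * E (\<lambda>\<omega>. (G \<omega> * (3 * q \<omega> ^ 2)) * (norm (H \<omega> $ i))\<^sup>2))" for i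
    unfolding E_def by (rule increment_quadratic[OF uv3 _ _ Hb Gb]) measurable
  have int4: "has_bochner_integral M (\<lambda>\<omega>. (G \<omega> * (12 * q \<omega> ^ 1)) * (a \<omega> \<bullet> ?D \<omega>)\<^sup>2)
      ((v - u) * E (\<lambda>\<omega>. G \<omega> * (12 * q \<omega> ^ 1) * (norm (a \<omega>))\<^sup>2))"
    unfolding E_def by (rule increment_quadratic[OF uv3 _ _ ab Gb]) measurable
  have vu: "v - u > 0" using uv by simp
  define m6 where "m6 = E (\<lambda>\<omega>. (norm (?D \<omega>)) ^ 6)"
  have g6: "(\<lambda>x :: real ^ 'n. (norm x) ^ 6) \<in> borel_measurable borel" by measurable
  have int5: "has_bochner_integral M (\<lambda>\<omega>. (norm (?D \<omega>)) ^ 6) m6"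
    unfolding E_def has_bochner_integral_iff m6_def
    using increment_expectation(1)[OF uv3 g6 gauss_vec_norm_moment6(1)[OF vu]] by simp
  have m6: "m6 \<le> 15 * real CARD('n) ^ 6 * (v - u) ^ 3"
    unfolding m6_def E_def increment_expectation(2)[OF uv3 g6 gauss_vec_norm_moment6(1)[OF vu]]
    by (rule gauss_vec_norm_moment6(2)[OF vu])
  have const: "has_bochner_integral M (\<lambda>\<omega>. c ^ 6) (c ^ 6)"
    by (simp add: has_bochner_integral_iff prob_space)
  have LI: "has_bochner_integral M L (h\<^sup>2 * (E (\<lambda>\<omega>. G \<omega> * (l * q \<omega> ^ 3)) - E (\<lambda>\<omega>. G \<omega> * ((6 * r * c) * q \<omega> ^ 2)))
      - 0 - (\<Sum>i\<in>UNIV. (v - u) * E (\<lambda>\<omega>. (G \<omega> * (3 * q \<omega> ^ 2)) * (norm (H \<omega> $ i))\<^sup>2))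
      + (v - u) * E (\<lambda>\<omega>. G \<omega> * (12 * q \<omega> ^ 1) * (norm (a \<omega>))\<^sup>2)
      - C * (c ^ 6 + (B / h) ^ 6 * m6))"
    unfolding L_def
    by (intro has_bochner_integral_diff has_bochner_integral_add has_bochner_integral_sum
        has_bochner_integral_mult_right int1 int2 int3 int4 int5 const)
  have S: "(\<Sum>i\<in>UNIV. E (\<lambda>\<omega>. (G \<omega> * (3 * q \<omega> ^ 2)) * (norm (H \<omega> $ i))\<^sup>2)) = E (\<lambda>\<omega>. (G \<omega> * (3 * q \<omega> ^ 2)) * (norm (H \<omega>))\<^sup>2)"
    and Sint: "integrable M (\<lambda>\<omega>. (G \<omega> * (3 * q \<omega> ^ 2)) * (norm (H \<omega>))\<^sup>2)"
  proof -
    have I: "integrable M (\<lambda>\<omega>. (G \<omega> * (3 * q \<omega> ^ 2)) * (norm (H \<omega> $ i))\<^sup>2)" for i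
    proof (rule bounded_integrable_F[OF uv3])
      show "\<bar>(G \<omega> * (3 * q \<omega> ^ 2)) * (norm (H \<omega> $ i))\<^sup>2\<bar> \<le> (\<bar>3\<bar> * (r\<^sup>2) ^ 2) * B\<^sup>2" if "\<omega> \<in> space M" for \<omega>
        unfolding abs_mult[of _ "(norm (H \<omega> $ i))\<^sup>2"] using Gb[of \<omega> 3 2] Hb[OF that, of i]
        by (intro mult_mono) (auto intro: power_mono)
    qed measurable
    show "(\<Sum>i\<in>UNIV. E (\<lambda>\<omega>. (G \<omega> * (3 * q \<omega> ^ 2)) * (norm (H \<omega> $ i))\<^sup>2)) = E (\<lambda>\<omega>. (G \<omega> * (3 * q \<omega> ^ 2)) * (norm (H \<omega>))\<^sup>2)"
      unfolding E_def norm_matrix_sq sum_distrib_left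
      by (rule Bochner_Integration.integral_sum[symmetric]) (rule I)
    show "integrable M (\<lambda>\<omega>. (G \<omega> * (3 * q \<omega> ^ 2)) * (norm (H \<omega>))\<^sup>2)"
      unfolding norm_matrix_sq sum_distrib_left by (rule Bochner_Integration.integrable_sum) (rule I)
  qed
  have Vint: "integrable M (\<lambda>\<omega>. G \<omega> * (12 * q \<omega> ^ 1) * (norm (a \<omega>))\<^sup>2)"
  proof (rule bounded_integrable_F[OF uv3])
    show "\<bar>G \<omega> * (12 * q \<omega> ^ 1) * (norm (a \<omega>))\<^sup>2\<bar> \<le> (\<bar>12\<bar> * (r\<^sup>2) ^ 1) * (B * r)\<^sup>2" if "\<omega> \<in> space M" for \<omega>
      unfolding abs_mult[of _ "(norm (a \<omega>))\<^sup>2"] using Gb[of \<omega> 12 1] ab[OF that]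
      by (intro mult_mono) (auto intro: power_mono)
  qed measurable
  have gen: "indicator A \<omega> * generator_bound r l c (H \<omega>) (x \<omega>)
      = G \<omega> * (l * q \<omega> ^ 3) - G \<omega> * ((6 * r * c) * q \<omega> ^ 2) - (G \<omega> * (3 * q \<omega> ^ 2)) * (norm (H \<omega>))\<^sup>2
        + G \<omega> * (12 * q \<omega> ^ 1) * (norm (a \<omega>))\<^sup>2" for \<omega>
  proof (cases "norm (x \<omega>) < r")
    case True
    then show ?thesis unfolding V
      by (simp add: generator_bound_def Let_def q_def[symmetric] G_def algebra_simps)
  next
    case False
    then show ?thesis unfolding V
      by (simp add: generator_bound_def Let_def q_def[symmetric] Gq)
  qed
  have EG: "E (\<lambda>\<omega>. indicator A \<omega> * generator_bound r l c (H \<omega>) (x \<omega>))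
      = E (\<lambda>\<omega>. G \<omega> * (l * q \<omega> ^ 3)) - E (\<lambda>\<omega>. G \<omega> * ((6 * r * c) * q \<omega> ^ 2))
        - E (\<lambda>\<omega>. (G \<omega> * (3 * q \<omega> ^ 2)) * (norm (H \<omega>))\<^sup>2) + E (\<lambda>\<omega>. G \<omega> * (12 * q \<omega> ^ 1) * (norm (a \<omega>))\<^sup>2)"
  proof -
    have "has_bochner_integral M (\<lambda>\<omega>. indicator A \<omega> * generator_bound r l c (H \<omega>) (x \<omega>))
      (E (\<lambda>\<omega>. G \<omega> * (l * q \<omega> ^ 3)) - E (\<lambda>\<omega>. G \<omega> * ((6 * r * c) * q \<omega> ^ 2))
        - E (\<lambda>\<omega>. (G \<omega> * (3 * q \<omega> ^ 2)) * (norm (H \<omega>))\<^sup>2) + E (\<lambda>\<omega>. G \<omega> * (12 * q \<omega> ^ 1) * (norm (a \<omega>))\<^sup>2))"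
      unfolding gen using Sint Vint
      by (intro has_bochner_integral_diff has_bochner_integral_add int1)
        (auto simp: has_bochner_integral_iff E_def)
    then show ?thesis by (simp add: has_bochner_integral_iff E_def)
  qed
  have EL: "E L = (v - u) * E (\<lambda>\<omega>. indicator A \<omega> * generator_bound r l c (H \<omega>) (x \<omega>)) - C * (c ^ 6 + (B / h) ^ 6 * m6)"
  proof -
    have ring: "d * (e1 - e2) - 0 - d * e3 + d * e4 - k = d * (e1 - e2 - e3 + e4) - k" for d e1 e2 e3 e4 k :: real
      by (simp add: algebra_simps)
    show ?thesis
      unfolding EG using has_bochner_integral_integral_eq[OF LI]
      unfolding sum_distrib_left[symmetric] S h(3) ring by (simp only: E_def)
  qed
  \<comment> \<open>Since \<open>h^6 = (v - u)^3\<close>, the sixth moment cancels the negative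
    power of \<open>h\<close>; the smallness of the error is the factor \<open>h^3\<close> in
    \<open>C\<close>.\<close>
  have "(B / h) ^ 6 * m6 \<le> (B / h) ^ 6 * (15 * real CARD('n) ^ 6 * (v - u) ^ 3)"
    using m6 B0 h by (intro mult_left_mono) auto
  also have "\<dots> = 15 * (real CARD('n) * B) ^ 6"
  proof -
    have "h ^ 6 = (v - u) ^ 3" unfolding h(3)[symmetric] by (simp flip: power_mult)
    then show ?thesis using vu by (simp add: power_divide power_mult_distrib)
  qed
  finally have "C * (c ^ 6 + (B / h) ^ 6 * m6) \<le> C * (c ^ 6 + 15 * (real CARD('n) * B) ^ 6)"
    using C by (intro mult_left_mono) auto
  also have "\<dots> = step_error r l * 64 * (c ^ 6 + 15 * (real CARD('n) * B) ^ 6) * (v - u) * sqrt (v - u)"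
    by (simp add: C_def h3)
  finally have err: "C * (c ^ 6 + (B / h) ^ 6 * m6)
      \<le> step_error r l * 64 * (c ^ 6 + 15 * (real CARD('n) * B) ^ 6) * (v - u) * sqrt (v - u)" .
  have A' [measurable]: "A \<in> sets M" using sets_F[OF u A] .
  have [measurable]: "x \<in> borel_measurable M" using measurable_F[OF u x] .
  have bi: "integrable M (\<lambda>\<omega>. indicator A \<omega> * bump r (Y \<omega>))" if [measurable]: "Y \<in> borel_measurable M" for Y :: "'a \<Rightarrow> real ^ 'n"
    by (rule integrable_indicator_bump) measurable
  have "E L \<le> E (\<lambda>\<omega>. (1 + l * (v - u)) * (indicator A \<omega> * bump r (Z \<omega>)) - indicator A \<omega> * bump r (x \<omega>))"
    unfolding E_def using LI pointwise bi[of Z] bi[of x]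
    by (intro integral_mono_AE) (auto simp: has_bochner_integral_iff)
  also have "\<dots> = (1 + l * (v - u)) * E (\<lambda>\<omega>. indicator A \<omega> * bump r (Z \<omega>)) - E (\<lambda>\<omega>. indicator A \<omega> * bump r (x \<omega>))"
    unfolding E_def using bi[of Z] bi[of x] by simp
  finally show ?thesis using EL err unfolding E_def by linarith
qed

subsection \<open>Elementary processes\<close>

text \<open>Split at a point of \<open>S\<close>, by induction on the number of such points inside,
  until none is left; an interval free of \<open>S\<close> is walked through in steps of length
  \<open>d\<close>. This spares the construction of a common refinement of the partitions belonging
  to the different matrix entries.\<close>

lemma le_by_local_steps:
  fixes f :: "real \<Rightarrow> real"
  assumes S: "finite S" and d: "d > 0" and st: "s \<le> t"
    and step: "\<And>u v. s \<le> u \<Longrightarrow> u < v \<Longrightarrow> v \<le> t \<Longrightarrow> {u<..<v} \<inter> S = {} \<Longrightarrow> v - u \<le> d \<Longrightarrow> f u \<le> f v"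
  shows "f s \<le> f t"
proof -
  have free: "f u \<le> f v" if "s \<le> u" "u \<le> v" "v \<le> t" "{u<..<v} \<inter> S = {}" "v - u \<le> real n * d" for n u v
    using that
  proof (induction n arbitrary: u)
    case 0
    then show ?case by simp
  next
    case (Suc n)
    show ?case
    proof (cases "v - u \<le> d")
      case True
      then show ?thesis using step[of u v] Suc.prems by (cases "u = v") auto
    next
      case False
      have sub: "{u<..<u + d} \<subseteq> {u<..<v}" "{u + d<..<v} \<subseteq> {u<..<v}"
        using False d by auto
      have "f u \<le> f (u + d)"
        using False d Suc.prems sub by (intro step) auto
      also have "\<dots> \<le> f v"
        using False d Suc.prems sub by (intro Suc.IH) (auto simp: algebra_simps)
      finally show ?thesis .
    qed
  qed
  have "f u \<le> f v" if "s \<le> u" "u \<le> v" "v \<le> t" for u v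
    using that
  proof (induction "card ({u<..<v} \<inter> S)" arbitrary: u v rule: less_induct)
    case less
    show ?case
    proof (cases "{u<..<v} \<inter> S = {}")
      case True
      obtain n where "(v - u) / d \<le> real n" using real_arch_simple by blast
      then show ?thesis using free[of u v n] True less.prems d by (simp add: field_simps)
    next
      case False
      then obtain w where w: "u < w" "w < v" "w \<in> S" by auto
      have "card ({u<..<w} \<inter> S) < card ({u<..<v} \<inter> S)"
        using S w by (intro psubset_card_mono) auto
      moreover have "card ({w<..<v} \<inter> S) < card ({u<..<v} \<inter> S)"
        using S w by (intro psubset_card_mono) auto
      ultimately have "f u \<le> f w" "f w \<le> f v"
        using less w by (auto intro!: less.hyps)
      then show ?thesis by simp
    qed
  qed
  then show ?thesis using st by simp
qed

lemma admissible_elem_times: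
  assumes "admissible_elem M F T m \<tau> h"
  shows "i \<le> j \<Longrightarrow> j \<le> m \<Longrightarrow> \<tau> i \<le> \<tau> j" and "k \<le> m \<Longrightarrow> 0 \<le> \<tau> k" and "k \<le> m \<Longrightarrow> \<tau> k \<le> T"
proof -
  have a: "\<tau> 0 = 0" "\<tau> m = T" "\<And>k. k < m \<Longrightarrow> \<tau> k < \<tau> (Suc k)"
    using assms by (auto simp: admissible_elem_def)
  have mono: "\<tau> i \<le> \<tau> j" if "i \<le> j" "j \<le> m" for i j
    using that
  proof (induction rule: dec_induct)
    case (step k)
    then show ?case using a(3)[of k] by simp
  qed simp
  show "i \<le> j \<Longrightarrow> j \<le> m \<Longrightarrow> \<tau> i \<le> \<tau> j" by (rule mono)
  show "k \<le> m \<Longrightarrow> 0 \<le> \<tau> k" using mono[of 0 k] a by simp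
  show "k \<le> m \<Longrightarrow> \<tau> k \<le> T" using mono[of k m] a by simp
qed

text \<open>An interval without partition points inside lies in one cell or outside it. Cells are
  open on the left and closed on the right, so the value that represents the step is the one at the
  right end \<open>v\<close>, never the one at \<open>u\<close>.\<close>

lemma elem_step:
  assumes "u < v" and free: "{u<..<v} \<inter> \<tau> ` {..m} = {}"
    and mono: "\<And>k. k < m \<Longrightarrow> \<tau> k < \<tau> (Suc k)"
  shows "elem_int B m \<tau> h v \<omega> - elem_int B m \<tau> h u \<omega> = elem_proc m \<tau> h v \<omega> * (B v \<omega> - B u \<omega>)"
    and "s \<in> {u<..v} \<Longrightarrow> elem_proc m \<tau> h s \<omega> = elem_proc m \<tau> h v \<omega>"
proof -
  have cases: "(\<tau> k \<le> u \<and> v \<le> \<tau> (Suc k)) \<or> v \<le> \<tau> k \<or> \<tau> (Suc k) \<le> u" if "k < m" for k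
  proof -
    have "\<tau> k \<notin> {u<..<v}" "\<tau> (Suc k) \<notin> {u<..<v}" using free that by auto
    then show ?thesis by auto
  qed
  have "h k \<omega> * (B (min v (\<tau> (Suc k))) \<omega> - B (min v (\<tau> k)) \<omega>) - h k \<omega> * (B (min u (\<tau> (Suc k))) \<omega> - B (min u (\<tau> k)) \<omega>)
      = h k \<omega> * indicator {\<tau> k<..\<tau> (Suc k)} v * (B v \<omega> - B u \<omega>)" if "k < m" for k
    using cases[OF that] mono[OF that] \<open>u < v\<close> by (auto simp: min_def indicator_def algebra_simps)
  then show "elem_int B m \<tau> h v \<omega> - elem_int B m \<tau> h u \<omega> = elem_proc m \<tau> h v \<omega> * (B v \<omega> - B u \<omega>)"
    unfolding elem_int_def elem_proc_def sum_distrib_right sum_subtractf[symmetric]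
    by (intro sum.cong) auto
  show "elem_proc m \<tau> h s \<omega> = elem_proc m \<tau> h v \<omega>" if "s \<in> {u<..v}"
    unfolding elem_proc_def
  proof (intro sum.cong refl)
    fix k assume "k \<in> {..<m}"
    then show "h k \<omega> * indicator {\<tau> k<..\<tau> (Suc k)} s = h k \<omega> * indicator {\<tau> k<..\<tau> (Suc k)} v"
      using cases[of k] mono[of k] that \<open>u < v\<close> by (auto simp: indicator_def)
  qed
qed

lemma elem_proc_bounded:
  assumes "admissible_elem M F T m \<tau> h"
  shows "\<exists>C. \<forall>s. \<forall>\<omega>\<in>space M. \<bar>elem_proc m \<tau> h s \<omega>\<bar> \<le> C"
proof -
  obtain C where C: "\<And>k \<omega>. k < m \<Longrightarrow> \<omega> \<in> space M \<Longrightarrow> \<bar>h k \<omega>\<bar> \<le> C k"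
    using assms unfolding admissible_elem_def by metis
  have "\<bar>elem_proc m \<tau> h s \<omega>\<bar> \<le> (\<Sum>k<m. C k)" if "\<omega> \<in> space M" for s \<omega>
    unfolding elem_proc_def
  proof (rule order_trans[OF sum_abs], rule sum_mono)
    fix k assume "k \<in> {..<m}"
    then have "\<bar>h k \<omega>\<bar> \<le> C k" using C that by simp
    then show "\<bar>h k \<omega> * indicator {\<tau> k<..\<tau> (Suc k)} s\<bar> \<le> C k"
      by (cases "s \<in> {\<tau> k<..\<tau> (Suc k)}") auto
  qed
  then show ?thesis by blast
qed

context filtered_brownian
begin

lemma elem_int_measurable:
  assumes adm: "admissible_elem M F T m \<tau> h" and t: "t \<in> {0..T}"
    and B: "\<And>s. s \<in> {0..T} \<Longrightarrow> B s \<in> borel_measurable (F s)"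
  shows "elem_int B m \<tau> h t \<in> borel_measurable (F t)"
proof -
  note times = admissible_elem_times[OF adm]
  have "(\<lambda>\<omega>. h k \<omega> * (B (min t (\<tau> (Suc k))) \<omega> - B (min t (\<tau> k)) \<omega>)) \<in> borel_measurable (F t)" if "k < m" for k
  proof (cases "\<tau> k \<le> t")
    case True
    have "h k \<in> borel_measurable (F (\<tau> k))"
      using adm that by (auto simp: admissible_elem_def)
    then have 1: "h k \<in> borel_measurable (F t)"
      using True t times(2)[of k] that by (intro measurable_F_mono[of "\<tau> k" t]) auto
    have 2: "B (min t s) \<in> borel_measurable (F t)" if "0 \<le> s" for s
      using t that by (intro measurable_F_mono[of "min t s" t] B) auto
    have "B (min t (\<tau> (Suc k))) \<in> borel_measurable (F t)" "B (min t (\<tau> k)) \<in> borel_measurable (F t)"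
      using 2 times(2)[of k] times(2)[of "Suc k"] that by auto
    with 1 show ?thesis by measurable
  next
    case False
    moreover have "\<tau> k \<le> \<tau> (Suc k)" using times(1)[of k "Suc k"] that by simp
    ultimately show ?thesis by (simp add: min_def)
  qed
  then show ?thesis
    unfolding elem_int_def[abs_def] by (intro borel_measurable_sum) auto
qed

text \<open>A cell that contains \<open>v\<close> must begin no later than \<open>u\<close>, as no
  partition point lies strictly between; its coefficient is therefore already known at time
  \<open>u\<close>, although the process is evaluated at \<open>v\<close>.\<close>

lemma elem_proc_predictable:
  assumes adm: "admissible_elem M F T m \<tau> h" and uv: "0 \<le> u" "u < v" "v \<le> T"
    and free: "{u<..<v} \<inter> \<tau> ` {..m} = {}"
  shows "elem_proc m \<tau> h v \<in> borel_measurable (F u)"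
proof -
  have "(\<lambda>\<omega>. h k \<omega> * indicator {\<tau> k<..\<tau> (Suc k)} v) \<in> borel_measurable (F u)" if "k < m" for k
  proof (cases "\<tau> k \<le> u")
    case True
    have "h k \<in> borel_measurable (F (\<tau> k))"
      using adm that by (auto simp: admissible_elem_def)
    then have "h k \<in> borel_measurable (F u)"
      using True uv admissible_elem_times(2)[OF adm, of k] that by (intro measurable_F_mono[of "\<tau> k" u]) auto
    then show ?thesis by measurable
  next
    \<comment> \<open>Now \<open>\<tau> k \<ge> v\<close>, so the half-open cell misses
      \<open>v\<close> and the summand is 0.\<close>
    case False
    moreover have "\<tau> k \<notin> {u<..<v}" using free that by auto
    ultimately show ?thesis by simp
  qed
  then show ?thesis
    unfolding elem_proc_def[abs_def] by (intro borel_measurable_sum) auto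
qed

abbreviation "time_space \<equiv> restrict_space lborel {0..T} \<Otimes>\<^sub>M M"

lemma elem_proc_jointly_measurable:
  assumes adm: "admissible_elem M F T m \<tau> h"
  shows "(\<lambda>(s, \<omega>). elem_proc m \<tau> h s \<omega>) \<in> borel_measurable time_space"
proof -
  have "(\<lambda>p. h k (snd p) * indicator {\<tau> k<..\<tau> (Suc k)} (fst p)) \<in> borel_measurable time_space" if "k < m" for k
  proof -
    have "h k \<in> borel_measurable (F (\<tau> k))"
      using adm that by (auto simp: admissible_elem_def)
    then have [measurable]: "h k \<in> borel_measurable M"
      using admissible_elem_times(2,3)[OF adm, of k] that by (intro measurable_F[of "\<tau> k"]) auto
    have [measurable]: "indicator {\<tau> k<..\<tau> (Suc k)} \<in> borel_measurable (restrict_space lborel {0..T})"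
      by (intro measurable_restrict_space1) auto
    show ?thesis by measurable
  qed
  then show ?thesis
    unfolding elem_proc_def[abs_def] split_beta' by (intro borel_measurable_sum) auto
qed

lemma progressive_jointly_measurable:
  fixes f :: "real \<Rightarrow> 'a \<Rightarrow> 'b::{second_countable_topology, real_normed_vector}"
  assumes "progressive M F T f"
  shows "(\<lambda>(s, \<omega>). f s \<omega>) \<in> borel_measurable time_space"
proof -
  have T: "T \<in> {0..T}" using T_pos by simp
  have "(\<lambda>(s, \<omega>). f s \<omega>) \<in> borel_measurable (restrict_space borel {0..T} \<Otimes>\<^sub>M F T)"
    using assms T by (auto simp: progressive_def)
  moreover have "(\<lambda>p. (fst p, snd p)) \<in> time_space \<rightarrow>\<^sub>M restrict_space borel {0..T} \<Otimes>\<^sub>M F T"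
  proof (rule measurable_Pair)
    have "sets (restrict_space lborel {0..T}) = sets (restrict_space borel {0..T})"
      by (intro sets_restrict_space_cong) simp
    then show "fst \<in> time_space \<rightarrow>\<^sub>M restrict_space borel {0..T}"
      using measurable_fst measurable_cong_sets by blast
    show "snd \<in> time_space \<rightarrow>\<^sub>M F T"
      by (rule measurable_compose[OF measurable_snd measurable_from_subalg[OF subalgebra_F[OF T]]]) simp
  qed
  ultimately have "(\<lambda>p. case (fst p, snd p) of (s, \<omega>) \<Rightarrow> f s \<omega>) \<in> borel_measurable time_space"
    by (rule measurable_compose[rotated])
  then show ?thesis by (simp add: split_beta')
qed

end

subsection \<open>Ellipticity\<close>

text \<open>The rows of \<open>S\<close> are the images of the unit vectors under its transpose, so
  each has squared norm at most \<open>K\<close>.\<close>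

lemma norm_matrix_sq_le_of_quadratic_form:
  fixes S :: "real ^ 'n::finite ^ 'n"
  assumes "\<And>\<xi>. (norm (transpose S *v \<xi>))\<^sup>2 \<le> K * (norm \<xi>)\<^sup>2"
  shows "(norm S)\<^sup>2 \<le> real CARD('n) * K"
proof -
  have "S $ i = transpose S *v axis i 1" for i
    by (simp only: matrix_vector_mult_basis column_transpose) (simp add: row_def)
  then have "(norm (S $ i))\<^sup>2 \<le> K" for i
    using assms[of "axis i 1"] by (simp add: norm_Basis axis_in_Basis_iff)
  then have "(\<Sum>i\<in>UNIV. (norm (S $ i))\<^sup>2) \<le> (\<Sum>i\<in>(UNIV :: 'n set). K)"
    by (intro sum_mono)
  then show ?thesis by (simp add: norm_matrix_sq)
qed

lemma norm_add_sq_le: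
  fixes a b :: "'b::real_normed_vector"
  shows "(norm (a + b))\<^sup>2 \<le> 2 * (norm a)\<^sup>2 + 2 * (norm b)\<^sup>2"
proof -
  have "(norm (a + b))\<^sup>2 \<le> (norm a + norm b)\<^sup>2"
    by (intro power_mono norm_triangle_ineq) simp
  also have "\<dots> \<le> 2 * (norm a)\<^sup>2 + 2 * (norm b)\<^sup>2"
    using sum_squares_bound[of "norm a" "norm b"] by (simp add: power2_sum)
  finally show ?thesis .
qed

text \<open>Ellipticity is available for \<open>S\<close>, the true diffusion matrix, but not for
  its approximation \<open>H\<close>. Passing from one to the other by
  \<open>|a + b|^2 \<le> 2 |a|^2 + 2 |b|^2\<close> costs a factor 2 and the squared
  distance.\<close>

lemma generator_bound_ge:
  fixes S H :: "real ^ 'n::finite ^ 'n"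
  assumes S: "\<And>\<xi>. \<epsilon> * (norm \<xi>)\<^sup>2 \<le> (norm (transpose S *v \<xi>))\<^sup>2"
      "\<And>\<xi>. (norm (transpose S *v \<xi>))\<^sup>2 \<le> K * (norm \<xi>)\<^sup>2"
    and pos: "r > 0" "\<epsilon> > 0"
    and l: "l \<ge> (6 * r * c + 6 * (real CARD('n) * K) + 6 * \<epsilon>)\<^sup>2 / (24 * \<epsilon> * r\<^sup>2)"
  shows "generator_bound r l c H x \<ge> - 18 * r ^ 4 * (norm (H - S))\<^sup>2"
proof (cases "norm x < r")
  case False
  then have "max 0 (r\<^sup>2 - (norm x)\<^sup>2) = 0"
    using power_mono[of r "norm x" 2] pos by simp
  then show ?thesis by (simp add: generator_bound_def)
next
  case True
  define q where "q = r\<^sup>2 - (norm x)\<^sup>2"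
  have q: "0 < q" "q \<le> r\<^sup>2" "max 0 (r\<^sup>2 - (norm x)\<^sup>2) = q"
    using power_strict_mono[OF True] by (auto simp: q_def)
  define E where "E = (norm (H - S))\<^sup>2"
  have H: "H = S + (H - S)" by simp
  have "(norm H)\<^sup>2 \<le> 2 * (real CARD('n) * K) + 2 * E"
    using norm_add_sq_le[of S "H - S"] norm_matrix_sq_le_of_quadratic_form[OF S(2)]
    unfolding E_def H[symmetric] by linarith
  \<comment> \<open>Inside the ball \<open>|x|^2 = r^2 - q\<close>, so the lower ellipticity bound
    at \<open>x\<close> turns into a statement about \<open>q\<close> that is strongest near the
    sphere.\<close>
  moreover have "(norm (transpose H *v x))\<^sup>2 \<ge> \<epsilon> * (r\<^sup>2 - q) / 2 - r\<^sup>2 * E"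
  proof -
    have "transpose S *v x = transpose H *v x + (- (transpose (H - S) *v x))"
      by (simp add: transpose_def matrix_vector_mult_def vec_eq_iff sum_subtractf[symmetric] algebra_simps flip: sum_negf)
    then have "(norm (transpose S *v x))\<^sup>2 \<le> 2 * (norm (transpose H *v x))\<^sup>2 + 2 * (norm (transpose (H - S) *v x))\<^sup>2"
      using norm_add_sq_le[of "transpose H *v x" "- (transpose (H - S) *v x)"] by simp
    moreover have "(norm (transpose (H - S) *v x))\<^sup>2 \<le> (norm (H - S) * r)\<^sup>2"
    proof (rule power_mono)
      show "norm (transpose (H - S) *v x) \<le> norm (H - S) * r"
        using norm_matrix_vector_le[of "transpose (H - S)" x] True
        unfolding norm_transpose by (meson less_imp_le mult_left_mono norm_ge_zero order_trans)
    qed simp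
    moreover have "(norm x)\<^sup>2 = r\<^sup>2 - q" by (simp add: q_def)
    ultimately show ?thesis using S(1)[of x] by (simp add: E_def power_mult_distrib mult.commute)
  qed
  ultimately have "l * q ^ 3 - 6 * q\<^sup>2 * r * c - 3 * q\<^sup>2 * (norm H)\<^sup>2 + 12 * q * (norm (transpose H *v x))\<^sup>2 \<ge> - 18 * r ^ 4 * E"
    using q pos l by (intro drift_nonneg[where N = "real CARD('n) * K" and \<epsilon> = \<epsilon>]) (auto simp: E_def)
  then show ?thesis by (simp add: generator_bound_def q E_def)
qed

lemma borel_measurable_vec_lambda_comp:
  fixes f :: "'n::finite \<Rightarrow> 'a \<Rightarrow> 'b::euclidean_space"
  assumes "\<And>i. f i \<in> borel_measurable N"
  shows "(\<lambda>\<omega>. \<chi> i. f i \<omega>) \<in> borel_measurable N"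
proof (rule borel_measurable_euclidean_space[THEN iffD2], intro ballI)
  fix b :: "'b ^ 'n" assume "b \<in> Basis"
  then obtain i u where b: "b = axis i u" by (auto simp: Basis_vec_def)
  show "(\<lambda>\<omega>. (\<chi> i. f i \<omega>) \<bullet> b) \<in> borel_measurable N"
    using assms[of i] unfolding b inner_axis by simp
qed

section \<open>The Ito process and its elementary approximations\<close>

lemma (in filtered_brownian) finite_measure_time: "finite_measure (restrict_space lborel {0..T})"
  by (rule finite_measureI) (auto simp: emeasure_restrict_space space_restrict_space emeasure_lborel_Icc_eq)

sublocale filtered_brownian \<subseteq> time: finite_measure "restrict_space lborel {0..T}"
  by (rule finite_measure_time)

sublocale filtered_brownian \<subseteq> time_space: pair_sigma_finite "restrict_space lborel {0..T}" M ..

text \<open>The existential witnesses of the Ito integrals become parameters here. Each matrix entry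
  has its own approximating sequence, hence its own partitions and coefficients, indexed by
  \<open>i\<close>, \<nu> and the position \<open>j\<close> in the sequence.\<close>

locale elliptic_ito = filtered_brownian M F T W
  for M :: "'a measure" and F :: "real \<Rightarrow> 'a measure" and T :: real
    and W :: "real \<Rightarrow> 'a \<Rightarrow> real ^ 'n::finite" +
  fixes \<mu> :: "real \<Rightarrow> 'a \<Rightarrow> real ^ 'n" and \<sigma> :: "real \<Rightarrow> 'a \<Rightarrow> real ^ 'n ^ 'n"
    and X :: "real \<Rightarrow> 'a \<Rightarrow> real ^ 'n" and I :: "'n \<Rightarrow> 'n \<Rightarrow> real \<Rightarrow> 'a \<Rightarrow> real"
    and m :: "'n \<Rightarrow> 'n \<Rightarrow> nat \<Rightarrow> nat" and \<tau> :: "'n \<Rightarrow> 'n \<Rightarrow> nat \<Rightarrow> nat \<Rightarrow> real"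
    and h :: "'n \<Rightarrow> 'n \<Rightarrow> nat \<Rightarrow> nat \<Rightarrow> 'a \<Rightarrow> real"
    and C0 \<epsilon> K :: real
  assumes \<mu>_progressive: "progressive M F T \<mu>"
    and \<sigma>_progressive: "progressive M F T \<sigma>"
    and X_adapted: "\<And>t. t \<in> {0..T} \<Longrightarrow> X t \<in> borel_measurable (F t)"
    and X_continuous: "AE \<omega> in M. continuous_on {0..T} (\<lambda>t. X t \<omega>)"
    and I_adapted: "\<And>i \<nu> t. t \<in> {0..T} \<Longrightarrow> I i \<nu> t \<in> borel_measurable (F t)"
    and admissible: "\<And>i \<nu> j. admissible_elem M F T (m i \<nu> j) (\<tau> i \<nu> j) (h i \<nu> j)"
    and integrand_approx: "\<And>i \<nu>. (\<lambda>j. \<integral>\<^sup>+ \<omega>. (\<integral>\<^sup>+ s.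
          ennreal ((\<sigma> s \<omega> $ i $ \<nu> - elem_proc (m i \<nu> j) (\<tau> i \<nu> j) (h i \<nu> j) s \<omega>)\<^sup>2) * indicator {0..T} s \<partial>lborel) \<partial>M)
        \<longlonglongrightarrow> 0"
    and integral_approx: "\<And>i \<nu> t. t \<in> {0..T} \<Longrightarrow> (\<lambda>j. \<integral>\<^sup>+ \<omega>.
          ennreal ((I i \<nu> t \<omega> - elem_int (\<lambda>t \<omega>. W t \<omega> $ \<nu>) (m i \<nu> j) (\<tau> i \<nu> j) (h i \<nu> j) t \<omega>)\<^sup>2) \<partial>M)
        \<longlonglongrightarrow> 0"
    and X_eq: "\<And>t. t \<in> {0..T} \<Longrightarrow> AE \<omega> in M. \<forall>i.
          X t \<omega> $ i = X 0 \<omega> $ i + (LINT s:{0..t}|lborel. \<mu> s \<omega> $ i) + (\<Sum>\<nu>\<in>UNIV. I i \<nu> t \<omega>)"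
    and \<mu>_bound: "\<And>t. t \<in> {0..T} \<Longrightarrow> AE \<omega> in M. norm (\<mu> t \<omega>) \<le> C0"
    and \<epsilon>_pos: "\<epsilon> > 0"
    and elliptic: "\<And>t. t \<in> {0..T} \<Longrightarrow> AE \<omega> in M. \<forall>\<xi> :: real ^ 'n.
          \<epsilon> * (norm \<xi>)\<^sup>2 \<le> (norm (transpose (\<sigma> t \<omega>) *v \<xi>))\<^sup>2 \<and>
          (norm (transpose (\<sigma> t \<omega>) *v \<xi>))\<^sup>2 \<le> K * (norm \<xi>)\<^sup>2"
begin

lemma \<mu>_measurable [measurable]: "(\<lambda>p. \<mu> (fst p) (snd p)) \<in> borel_measurable time_space"
  using progressive_jointly_measurable[OF \<mu>_progressive] by (simp add: split_beta')

lemma \<sigma>_measurable [measurable]: "(\<lambda>p. \<sigma> (fst p) (snd p)) \<in> borel_measurable time_space"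
  using progressive_jointly_measurable[OF \<sigma>_progressive] by (simp add: split_beta')

text \<open>The hypothesis provides an exceptional set for each time separately. Fubini exchanges
  the quantifiers, so that along almost every path the bound holds at almost all times, which is
  what an integral over time can use.\<close>

lemma AE_drift_bound: "AE \<omega> in M. AE s in lborel. s \<in> {0..T} \<longrightarrow> norm (\<mu> s \<omega>) \<le> C0"
proof -
  have "AE s in restrict_space lborel {0..T}. AE \<omega> in M. norm (\<mu> s \<omega>) \<le> C0"
    using \<mu>_bound by (intro AE_I2[of "restrict_space lborel {0..T}"]) (auto simp: space_restrict_space)
  then have "AE \<omega> in M. AE s in restrict_space lborel {0..T}. norm (\<mu> s \<omega>) \<le> C0"
    by (subst (asm) time_space.AE_commute) (auto simp: split_beta')
  then show ?thesis
    by (simp add: AE_restrict_space_iff)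
qed

text \<open>Additivity over \<open>[0,u]\<close> and \<open>(u,v]\<close> rests on integrability of
  the drift along the path, obtained from joint measurability and the bound; the default value 0 of
  a nonexistent integral would destroy it.\<close>

lemma drift_increment:
  assumes uv: "0 \<le> u" "u < v" "v \<le> T"
  shows "AE \<omega> in M. \<forall>i. \<bar>(LINT s:{0..v}|lborel. \<mu> s \<omega> $ i) - (LINT s:{0..u}|lborel. \<mu> s \<omega> $ i)\<bar> \<le> C0 * (v - u)"
  using AE_drift_bound
proof (rule AE_mp, intro AE_I2 impI allI)
  fix \<omega> i assume \<omega>: "\<omega> \<in> space M" and bound: "AE s in lborel. s \<in> {0..T} \<longrightarrow> norm (\<mu> s \<omega>) \<le> C0"
  have "(\<lambda>s. \<mu> s \<omega> $ i) \<in> borel_measurable (restrict_space lborel {0..T})"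
    using measurable_compose[OF measurable_Pair2'[OF \<omega>] \<mu>_measurable]
    by (auto intro: borel_measurable_vec_nth_comp)
  then have "integrable (restrict_space lborel {0..T}) (\<lambda>s. \<mu> s \<omega> $ i)"
  proof (rule time.integrable_const_bound[of _ C0, rotated])
    show "AE s in restrict_space lborel {0..T}. norm (\<mu> s \<omega> $ i) \<le> C0"
    proof -
      have "AE s in lborel. s \<in> {0..T} \<longrightarrow> norm (\<mu> s \<omega> $ i) \<le> C0"
        using bound
      proof (rule AE_mp, intro AE_I2 impI)
        fix s assume "s \<in> {0..T} \<longrightarrow> norm (\<mu> s \<omega>) \<le> C0" "s \<in> {0..T}"
        then show "norm (\<mu> s \<omega> $ i) \<le> C0" using component_le_norm_cart[of "\<mu> s \<omega>" i] by simp
      qed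
      then show ?thesis by (simp add: AE_restrict_space_iff)
    qed
  qed
  then have int: "set_integrable lborel {0..T} (\<lambda>s. \<mu> s \<omega> $ i)"
    by (simp add: integrable_restrict_space set_integrable_def)
  have iu: "set_integrable lborel {0..u} (\<lambda>s. \<mu> s \<omega> $ i)" and iv: "set_integrable lborel {u<..v} (\<lambda>s. \<mu> s \<omega> $ i)"
    using uv by (auto intro!: set_integrable_subset[OF int])
  have disj: "{0..u} \<inter> {u<..v} = {}" by auto
  have "{0..v} = {0..u} \<union> {u<..v}" using uv by auto
  then have "(LINT s:{0..v}|lborel. \<mu> s \<omega> $ i) - (LINT s:{0..u}|lborel. \<mu> s \<omega> $ i) = (LINT s:{u<..v}|lborel. \<mu> s \<omega> $ i)"
    using set_integral_Un[OF disj iu iv] by simp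
  also have "\<bar>\<dots>\<bar> \<le> (LINT s:{u<..v}|lborel. C0)"
    unfolding set_lebesgue_integral_def
  proof (rule order_trans[OF integral_abs_bound], rule integral_mono_AE)
    show "integrable lborel (\<lambda>s. \<bar>indicat_real {u<..v} s *\<^sub>R \<mu> s \<omega> $ i\<bar>)"
      using iv unfolding set_integrable_def by (rule integrable_abs)
    show "integrable lborel (\<lambda>s. indicat_real {u<..v} s *\<^sub>R C0)"
      using uv by (simp add: integrable_real_mult_indicator)
    show "AE s in lborel. \<bar>indicat_real {u<..v} s *\<^sub>R \<mu> s \<omega> $ i\<bar> \<le> indicat_real {u<..v} s *\<^sub>R C0"
      using bound
    proof (rule AE_mp, intro AE_I2 impI)
      fix s assume "s \<in> {0..T} \<longrightarrow> norm (\<mu> s \<omega>) \<le> C0"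
      then show "\<bar>indicat_real {u<..v} s *\<^sub>R \<mu> s \<omega> $ i\<bar> \<le> indicat_real {u<..v} s *\<^sub>R C0"
        using component_le_norm_cart[of "\<mu> s \<omega>" i] uv by (auto simp: indicator_def)
    qed
  qed
  also have "\<dots> = C0 * (v - u)"
    using uv by (simp add: set_lebesgue_integral_def)
  finally show "\<bar>(LINT s:{0..v}|lborel. \<mu> s \<omega> $ i) - (LINT s:{0..u}|lborel. \<mu> s \<omega> $ i)\<bar> \<le> C0 * (v - u)" .
qed

text \<open>The matrices that satisfy both inequalities for all \<xi> form a closed set, being an
  intersection of closed conditions. This makes the event measurable in the product, and the
  statements for single times can be assembled.\<close>

lemma AE_elliptic:
  "AE p in time_space. \<forall>\<xi>. \<epsilon> * (norm \<xi>)\<^sup>2 \<le> (norm (transpose (\<sigma> (fst p) (snd p)) *v \<xi>))\<^sup>2 \<and>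
     (norm (transpose (\<sigma> (fst p) (snd p)) *v \<xi>))\<^sup>2 \<le> K * (norm \<xi>)\<^sup>2"
proof (rule time_space.AE_pair_measure)
  define E where "E = {S :: real ^ 'n ^ 'n. \<forall>\<xi>. \<epsilon> * (norm \<xi>)\<^sup>2 \<le> (norm (transpose S *v \<xi>))\<^sup>2 \<and>
     (norm (transpose S *v \<xi>))\<^sup>2 \<le> K * (norm \<xi>)\<^sup>2}"
  have "closed E"
    unfolding E_def
    by (intro closed_Collect_all closed_Collect_conj closed_Collect_le)
      (auto simp: transpose_def matrix_vector_mult_def intro!: continuous_intros)
  then have "(\<lambda>p. \<sigma> (fst p) (snd p)) -` E \<inter> space time_space \<in> sets time_space"
    by (intro measurable_sets[OF \<sigma>_measurable]) auto
  also have "(\<lambda>p. \<sigma> (fst p) (snd p)) -` E \<inter> space time_space = {p \<in> space time_space.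
      \<forall>\<xi>. \<epsilon> * (norm \<xi>)\<^sup>2 \<le> (norm (transpose (\<sigma> (fst p) (snd p)) *v \<xi>))\<^sup>2 \<and>
     (norm (transpose (\<sigma> (fst p) (snd p)) *v \<xi>))\<^sup>2 \<le> K * (norm \<xi>)\<^sup>2}"
    by (auto simp: E_def)
  finally show "\<dots> \<in> sets time_space" .
  show "AE s in restrict_space lborel {0..T}. AE \<omega> in M. \<forall>\<xi>.
     \<epsilon> * (norm \<xi>)\<^sup>2 \<le> (norm (transpose (\<sigma> (fst (s, \<omega>)) (snd (s, \<omega>))) *v \<xi>))\<^sup>2 \<and>
     (norm (transpose (\<sigma> (fst (s, \<omega>)) (snd (s, \<omega>))) *v \<xi>))\<^sup>2 \<le> K * (norm \<xi>)\<^sup>2"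
    using elliptic by (intro AE_I2[of "restrict_space lborel {0..T}"]) (auto simp: space_restrict_space)
qed

definition H_elem :: "nat \<Rightarrow> real \<Rightarrow> 'a \<Rightarrow> real ^ 'n ^ 'n" where
  "H_elem j s \<omega> = (\<chi> i \<nu>. elem_proc (m i \<nu> j) (\<tau> i \<nu> j) (h i \<nu> j) s \<omega>)"

text \<open>Only the stochastic integrals are exchanged; the drift of \<open>X\<close> is kept
  exactly. Written as a correction of \<open>X\<close>, its distance to \<open>X\<close> is visibly
  the error that \<open>integral_approx\<close> controls.\<close>

definition X_elem :: "nat \<Rightarrow> real \<Rightarrow> 'a \<Rightarrow> real ^ 'n" where
  "X_elem j t \<omega> = (\<chi> i. X t \<omega> $ i + (\<Sum>\<nu>\<in>UNIV.
     elem_int (\<lambda>t \<omega>. W t \<omega> $ \<nu>) (m i \<nu> j) (\<tau> i \<nu> j) (h i \<nu> j) t \<omega> - I i \<nu> t \<omega>))"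

lemma W_component_adapted: "s \<in> {0..T} \<Longrightarrow> (\<lambda>\<omega>. W s \<omega> $ \<nu>) \<in> borel_measurable (F s)"
  using W_measurable_F by measurable

lemma X_elem_adapted: "t \<in> {0..T} \<Longrightarrow> X_elem j t \<in> borel_measurable (F t)"
  unfolding X_elem_def[abs_def]
  by (intro borel_measurable_vec_lambda_comp borel_measurable_add borel_measurable_sum borel_measurable_diff
      borel_measurable_vec_nth_comp X_adapted I_adapted elem_int_measurable[OF admissible] W_component_adapted)

lemma H_elem_jointly_measurable [measurable]: "(\<lambda>p. H_elem j (fst p) (snd p)) \<in> borel_measurable time_space"
  unfolding H_elem_def
  using elem_proc_jointly_measurable[OF admissible]
  by (intro borel_measurable_vec_lambda_comp) (simp add: split_beta')

lemma H_elem_bounded: "\<exists>B. \<forall>s. \<forall>\<omega>\<in>space M. norm (H_elem j s \<omega>) \<le> B"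
proof -
  obtain C where C: "\<And>i \<nu> s \<omega>. \<omega> \<in> space M \<Longrightarrow> \<bar>elem_proc (m i \<nu> j) (\<tau> i \<nu> j) (h i \<nu> j) s \<omega>\<bar> \<le> C i \<nu>"
    using elem_proc_bounded[OF admissible[of _ _ j]] by metis
  have "norm (H_elem j s \<omega>) \<le> (\<Sum>i\<in>UNIV. \<Sum>\<nu>\<in>UNIV. C i \<nu>)" if "\<omega> \<in> space M" for s \<omega>
  proof -
    have "norm (H_elem j s \<omega>) \<le> (\<Sum>i\<in>UNIV. norm (H_elem j s \<omega> $ i))"
      unfolding norm_vec_def[of "H_elem j s \<omega>"] by (rule L2_set_le_sum) simp
    also have "\<dots> \<le> (\<Sum>i\<in>UNIV. \<Sum>\<nu>\<in>UNIV. \<bar>H_elem j s \<omega> $ i $ \<nu>\<bar>)"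
      by (intro sum_mono norm_le_l1_cart)
    also have "\<dots> \<le> (\<Sum>i\<in>UNIV. \<Sum>\<nu>\<in>UNIV. C i \<nu>)"
      using C[OF that] by (intro sum_mono) (simp add: H_elem_def)
    finally show ?thesis .
  qed
  then show ?thesis by blast
qed

text \<open>Convergence is given entry by entry, with the time integral inside. Adding the entries
  produces the Frobenius norm, and Tonelli moves the statement to the product space.\<close>

lemma integrand_error_tendsto:
  "(\<lambda>j. \<integral>\<^sup>+ p. ennreal ((norm (H_elem j (fst p) (snd p) - \<sigma> (fst p) (snd p)))\<^sup>2) \<partial>time_space) \<longlonglongrightarrow> 0"
proof -
  have sq: "ennreal ((norm (H_elem j s \<omega> - \<sigma> s \<omega>))\<^sup>2) = (\<Sum>i\<in>UNIV. \<Sum>\<nu>\<in>UNIV.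
      ennreal ((\<sigma> s \<omega> $ i $ \<nu> - elem_proc (m i \<nu> j) (\<tau> i \<nu> j) (h i \<nu> j) s \<omega>)\<^sup>2))" for j s \<omega>
    unfolding norm_matrix_sq
    by (simp add: norm_vec_def L2_set_def sum_nonneg H_elem_def power2_commute sum_ennreal)
  have [measurable]: "(\<lambda>p. elem_proc (m i \<nu> j) (\<tau> i \<nu> j) (h i \<nu> j) (fst p) (snd p)) \<in> borel_measurable time_space" for i \<nu> j
    using elem_proc_jointly_measurable[OF admissible] by (simp add: split_beta')
  have "(\<integral>\<^sup>+ p. ennreal ((norm (H_elem j (fst p) (snd p) - \<sigma> (fst p) (snd p)))\<^sup>2) \<partial>time_space)
    = (\<Sum>i\<in>UNIV. \<Sum>\<nu>\<in>UNIV. \<integral>\<^sup>+ \<omega>. (\<integral>\<^sup>+ s.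
          ennreal ((\<sigma> s \<omega> $ i $ \<nu> - elem_proc (m i \<nu> j) (\<tau> i \<nu> j) (h i \<nu> j) s \<omega>)\<^sup>2) * indicator {0..T} s \<partial>lborel) \<partial>M)" for j
  proof -
    have "(\<integral>\<^sup>+ p. ennreal ((norm (H_elem j (fst p) (snd p) - \<sigma> (fst p) (snd p)))\<^sup>2) \<partial>time_space)
      = (\<Sum>i\<in>UNIV. \<Sum>\<nu>\<in>UNIV. \<integral>\<^sup>+ p. ennreal ((\<sigma> (fst p) (snd p) $ i $ \<nu>
          - elem_proc (m i \<nu> j) (\<tau> i \<nu> j) (h i \<nu> j) (fst p) (snd p))\<^sup>2) \<partial>time_space)"
      unfolding sq by (simp add: nn_integral_sum del: sum_ennreal)
    also have "\<dots> = (\<Sum>i\<in>UNIV. \<Sum>\<nu>\<in>UNIV. \<integral>\<^sup>+ \<omega>. (\<integral>\<^sup>+ s. ennreal ((\<sigma> s \<omega> $ i $ \<nu>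
          - elem_proc (m i \<nu> j) (\<tau> i \<nu> j) (h i \<nu> j) s \<omega>)\<^sup>2) \<partial>restrict_space lborel {0..T}) \<partial>M)"
      by (intro sum.cong refl, subst time_space.nn_integral_snd[symmetric]) auto
    finally show ?thesis by (simp add: nn_integral_restrict_space)
  qed
  moreover have "(\<lambda>j. \<Sum>i\<in>UNIV. \<Sum>\<nu>\<in>UNIV. \<integral>\<^sup>+ \<omega>. (\<integral>\<^sup>+ s.
          ennreal ((\<sigma> s \<omega> $ i $ \<nu> - elem_proc (m i \<nu> j) (\<tau> i \<nu> j) (h i \<nu> j) s \<omega>)\<^sup>2) * indicator {0..T} s \<partial>lborel) \<partial>M)
      \<longlonglongrightarrow> (\<Sum>i\<in>(UNIV :: 'n set). \<Sum>\<nu>\<in>(UNIV :: 'n set). 0)"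
    by (intro tendsto_sum integrand_approx)
  ultimately show ?thesis by simp
qed

end

text \<open>A crude bound whose only purpose is integrability: \<open>B\<close> may depend on the
  approximation.\<close>

lemma generator_bound_abs_le:
  assumes H: "norm H \<le> B" and pos: "r > 0" "l \<ge> 0" "c \<ge> 0"
  shows "\<bar>generator_bound r l c H x\<bar> \<le> l * r ^ 6 + 6 * r ^ 4 * r * c + 3 * r ^ 4 * B\<^sup>2 + 12 * r\<^sup>2 * (B * r)\<^sup>2"
proof -
  define q where "q = max 0 (r\<^sup>2 - (norm x)\<^sup>2)"
  have q: "0 \<le> q" "q \<le> r\<^sup>2" by (auto simp: q_def)
  have B: "0 \<le> B" using H norm_ge_zero order_trans by blast
  have q2: "q\<^sup>2 \<le> r ^ 4" and q3: "q ^ 3 \<le> r ^ 6"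
    using power_mono[OF q(2) q(1), of 2] power_mono[OF q(2) q(1), of 3] by (auto simp flip: power_mult)
  have 1: "0 \<le> l * q ^ 3" "l * q ^ 3 \<le> l * r ^ 6" using q3 q pos by (auto intro: mult_left_mono)
  have 2: "0 \<le> 6 * q\<^sup>2 * r * c" "6 * q\<^sup>2 * r * c \<le> 6 * r ^ 4 * r * c"
    using q2 q pos by (auto intro!: mult_right_mono mult_left_mono)
  have 3: "0 \<le> 3 * q\<^sup>2 * (norm H)\<^sup>2" "3 * q\<^sup>2 * (norm H)\<^sup>2 \<le> 3 * r ^ 4 * B\<^sup>2"
    using q2 H by (auto intro!: mult_mono power_mono)
  have 4: "0 \<le> 12 * q * (norm (transpose H *v x))\<^sup>2"
    "12 * q * (norm (transpose H *v x))\<^sup>2 \<le> 12 * r\<^sup>2 * (B * r)\<^sup>2"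
  proof -
    show "0 \<le> 12 * q * (norm (transpose H *v x))\<^sup>2" using q by simp
    show "12 * q * (norm (transpose H *v x))\<^sup>2 \<le> 12 * r\<^sup>2 * (B * r)\<^sup>2"
    proof (cases "norm x < r")
      case True
      then have "norm (transpose H *v x) \<le> B * r"
        using norm_matrix_vector_le[of "transpose H" x] mult_mono[OF H less_imp_le[OF True] B]
        unfolding norm_transpose by simp
      then show ?thesis using q by (intro mult_mono power_mono) auto
    next
      case False
      then have "q = 0" using power_mono[of r "norm x" 2] pos by (simp add: q_def)
      then show ?thesis by simp
    qed
  qed
  show ?thesis
    using 1 2 3 4 by (simp only: generator_bound_def Let_def q_def[symmetric] abs_le_iff) linarith
qed

section \<open>Summing the steps for one elementary approximation\<close>

context elliptic_ito
begin

text \<open>On an interval whose interior avoids these points all matrix entries are constant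
  simultaneously, up to the left end.\<close>

definition grid :: "nat \<Rightarrow> real set" where
  "grid j = (\<Union>i. \<Union>\<nu>. \<tau> i \<nu> j ` {..m i \<nu> j})"

lemma finite_grid: "finite (grid j)"
  by (simp add: grid_def)

context
  fixes j :: nat and u v :: real
  assumes uv: "0 \<le> u" "u < v" "v \<le> T" and free: "{u<..<v} \<inter> grid j = {}"
begin

lemma entry_free: "{u<..<v} \<inter> \<tau> i \<nu> j ` {..m i \<nu> j} = {}"
  using free by (auto simp: grid_def)

lemma entry_mono: "k < m i \<nu> j \<Longrightarrow> \<tau> i \<nu> j k < \<tau> i \<nu> j (Suc k)"
  using admissible[of i \<nu> j] by (simp add: admissible_elem_def)

lemma H_elem_predictable: "H_elem j v \<in> borel_measurable (F u)"
  unfolding H_elem_def[abs_def]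
  by (intro borel_measurable_vec_lambda_comp elem_proc_predictable[OF admissible uv entry_free])

lemma H_elem_const:
  assumes "s \<in> {u<..v}"
  shows "H_elem j s \<omega> = H_elem j v \<omega>"
proof -
  have "elem_proc (m i \<nu> j) (\<tau> i \<nu> j) (h i \<nu> j) s \<omega> = elem_proc (m i \<nu> j) (\<tau> i \<nu> j) (h i \<nu> j) v \<omega>" for i \<nu>
    by (rule elem_step(2)[OF uv(2) entry_free entry_mono assms])
  then show ?thesis by (simp add: H_elem_def)
qed

text \<open>The elementary integrals contribute precisely \<open>H_elem\<close> at \<open>v\<close>
  times the Brownian increment. The drift remains, at most \<open>C0 * (v - u)\<close> in each
  coordinate; the dimension enters by summing coordinates.\<close>

lemma X_elem_increment:
  "AE \<omega> in M. norm (X_elem j v \<omega> - X_elem j u \<omega> - H_elem j v \<omega> *v (W v \<omega> - W u \<omega>)) \<le> real CARD('n) * C0 * (v - u)"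
proof -
  have "AE \<omega> in M. \<forall>i. X v \<omega> $ i = X 0 \<omega> $ i + (LINT s:{0..v}|lborel. \<mu> s \<omega> $ i) + (\<Sum>\<nu>\<in>UNIV. I i \<nu> v \<omega>)"
    "AE \<omega> in M. \<forall>i. X u \<omega> $ i = X 0 \<omega> $ i + (LINT s:{0..u}|lborel. \<mu> s \<omega> $ i) + (\<Sum>\<nu>\<in>UNIV. I i \<nu> u \<omega>)"
    using uv by (auto intro!: X_eq)
  with drift_increment[OF uv] show ?thesis
  proof eventually_elim
    case (elim \<omega>)
    define Y where "Y = X_elem j v \<omega> - X_elem j u \<omega> - H_elem j v \<omega> *v (W v \<omega> - W u \<omega>)"
    have Y: "\<bar>Y $ i\<bar> \<le> C0 * (v - u)" for i
    proof -
      define ev where "ev \<nu> = elem_int (\<lambda>t \<omega>. W t \<omega> $ \<nu>) (m i \<nu> j) (\<tau> i \<nu> j) (h i \<nu> j) v \<omega>" for \<nu>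
      define eu where "eu \<nu> = elem_int (\<lambda>t \<omega>. W t \<omega> $ \<nu>) (m i \<nu> j) (\<tau> i \<nu> j) (h i \<nu> j) u \<omega>" for \<nu>
      have "ev \<nu> - eu \<nu> = H_elem j v \<omega> $ i $ \<nu> * (W v \<omega> - W u \<omega>) $ \<nu>" for \<nu>
        using elem_step(1)[OF uv(2) entry_free entry_mono, where B = "\<lambda>t \<omega>. W t \<omega> $ \<nu>"]
        by (simp add: ev_def eu_def H_elem_def)
      then have "(H_elem j v \<omega> *v (W v \<omega> - W u \<omega>)) $ i = (\<Sum>\<nu>\<in>UNIV. ev \<nu> - eu \<nu>)"
        by (simp add: matrix_vector_mult_def)
      then have "Y $ i = X v \<omega> $ i - X u \<omega> $ i - (\<Sum>\<nu>\<in>UNIV. I i \<nu> v \<omega>) + (\<Sum>\<nu>\<in>UNIV. I i \<nu> u \<omega>)"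
        unfolding Y_def X_elem_def by (simp add: ev_def eu_def sum_subtractf)
      also have "\<dots> = (LINT s:{0..v}|lborel. \<mu> s \<omega> $ i) - (LINT s:{0..u}|lborel. \<mu> s \<omega> $ i)"
        using elim by simp
      finally show ?thesis using elim by simp
    qed
    have "norm Y \<le> (\<Sum>i\<in>UNIV. \<bar>Y $ i\<bar>)" by (rule norm_le_l1_cart)
    also have "\<dots> \<le> (\<Sum>i\<in>(UNIV :: 'n set). C0 * (v - u))" by (intro sum_mono Y)
    finally show ?case by (simp add: Y_def)
  qed
qed

end

definition integrand_error :: "nat \<Rightarrow> real \<times> 'a \<Rightarrow> real" where
  "integrand_error j p = (norm (H_elem j (fst p) (snd p) - \<sigma> (fst p) (snd p)))\<^sup>2"

lemma integrand_error_measurable [measurable]: "integrand_error j \<in> borel_measurable time_space"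
  unfolding integrand_error_def[abs_def] by measurable

sublocale time_space: finite_measure time_space
  by (rule finite_measure_pair_measure) unfold_locales

text \<open>\<open>H_elem\<close> is close to \<sigma> only in mean square over time, so comparing
  the two at the single time \<open>v\<close> would be useless. As \<open>H_elem\<close> is constant
  on \<open>(u,v]\<close>, the left-hand side equals an integral over \<open>(u,v]\<close> and the
  probability space, and there the comparison with \<sigma> is made pointwise.\<close>

lemma generator_lower_bound:
  assumes uv: "0 \<le> u" "u < v" "v \<le> T" and free: "{u<..<v} \<inter> grid j = {}"
    and err: "integrable time_space (integrand_error j)"
    and A: "A \<in> sets M" and x: "x \<in> borel_measurable M"
    and pos: "r > 0" "c \<ge> 0"
    and l: "l \<ge> (6 * r * c + 6 * (real CARD('n) * K) + 6 * \<epsilon>)\<^sup>2 / (24 * \<epsilon> * r\<^sup>2)"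
  shows "(v - u) * expectation (\<lambda>\<omega>. indicator A \<omega> * generator_bound r l c (H_elem j v \<omega>) (x \<omega>))
    \<ge> - 18 * r ^ 4 * (\<integral>p. indicator {u<..v} (fst p) * integrand_error j p \<partial>time_space)"
proof -
  note [measurable] = A x
  have Hv [measurable]: "H_elem j v \<in> borel_measurable M"
    using H_elem_predictable[OF uv free] uv by (intro measurable_F[of u]) auto
  have [measurable]: "indicat_real {u<..v} \<in> borel_measurable (restrict_space lborel {0..T})"
    by (intro measurable_restrict_space1) auto
  have "0 \<le> (6 * r * c + 6 * (real CARD('n) * K) + 6 * \<epsilon>)\<^sup>2 / (24 * \<epsilon> * r\<^sup>2)"
    using \<epsilon>_pos by simp
  then have l0: "l \<ge> 0" using l by linarith
  obtain B where B: "\<And>\<omega>. \<omega> \<in> space M \<Longrightarrow> norm (H_elem j v \<omega>) \<le> B"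
    using H_elem_bounded[of j] by blast
  define g where "g \<omega> = indicator A \<omega> * generator_bound r l c (H_elem j v \<omega>) (x \<omega>)" for \<omega>
  have [measurable]: "g \<in> borel_measurable M" unfolding g_def by measurable
  define Cg where "Cg = l * r ^ 6 + 6 * r ^ 4 * r * c + 3 * r ^ 4 * B\<^sup>2 + 12 * r\<^sup>2 * (B * r)\<^sup>2"
  have g: "\<bar>g \<omega>\<bar> \<le> Cg" if "\<omega> \<in> space M" for \<omega>
    using generator_bound_abs_le[OF B[OF that] pos(1) l0 pos(2), of "x \<omega>"]
    unfolding g_def Cg_def[symmetric] by (auto simp: indicator_def)
  have int: "integrable time_space (\<lambda>p. indicat_real {u<..v} (fst p) * g (snd p))"
  proof (rule time_space.integrable_const_bound[of _ Cg])
    show "AE p in time_space. norm (indicat_real {u<..v} (fst p) * g (snd p)) \<le> Cg"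
    proof (intro AE_I2)
      fix p assume "p \<in> space time_space"
      then have "\<bar>g (snd p)\<bar> \<le> Cg" using g[of "snd p"] by (auto simp: space_pair_measure)
      then show "norm (indicat_real {u<..v} (fst p) * g (snd p)) \<le> Cg"
        by (auto simp: indicator_def)
    qed
  qed measurable
  have "(\<integral>p. indicat_real {u<..v} (fst p) * g (snd p) \<partial>time_space)
      = (\<integral>s. (\<integral>\<omega>. indicat_real {u<..v} s * g \<omega> \<partial>M) \<partial>restrict_space lborel {0..T})"
    using time_space.integral_fst'[OF int] by simp
  also have "\<dots> = (\<integral>s. indicat_real {u<..v} s \<partial>restrict_space lborel {0..T}) * expectation g"
    by simp
  also have "(\<integral>s. indicat_real {u<..v} s \<partial>restrict_space lborel {0..T}) = (\<integral>s. indicat_real {u<..v} s \<partial>lborel)"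
  proof -
    have "indicat_real {0..T} s *\<^sub>R indicat_real {u<..v} s = indicat_real {u<..v} s" for s
      using uv by (auto simp: indicator_def)
    then show ?thesis by (subst integral_restrict_space) (simp_all only:, simp)
  qed
  also have "\<dots> = v - u" using uv by simp
  finally have G: "(v - u) * expectation g = (\<integral>p. indicat_real {u<..v} (fst p) * g (snd p) \<partial>time_space)" by simp
  have int2: "integrable time_space (\<lambda>p. indicat_real {u<..v} (fst p) * integrand_error j p)"
  proof (rule Bochner_Integration.integrable_bound[OF err])
    show "(\<lambda>p. indicat_real {u<..v} (fst p) * integrand_error j p) \<in> borel_measurable time_space" by measurable
  qed (auto simp: indicator_def)
  have "(\<integral>p. - 18 * r ^ 4 * (indicator {u<..v} (fst p) * integrand_error j p) \<partial>time_space)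
      \<le> (\<integral>p. indicat_real {u<..v} (fst p) * g (snd p) \<partial>time_space)"
  proof (rule integral_mono_AE)
    show "integrable time_space (\<lambda>p. - 18 * r ^ 4 * (indicator {u<..v} (fst p) * integrand_error j p))"
      using int2 by (rule integrable_mult_right)
    show "integrable time_space (\<lambda>p. indicat_real {u<..v} (fst p) * g (snd p))" by fact
    show "AE p in time_space. - 18 * r ^ 4 * (indicator {u<..v} (fst p) * integrand_error j p)
        \<le> indicat_real {u<..v} (fst p) * g (snd p)"
      using AE_elliptic
    proof eventually_elim
      case (elim p)
      show ?case
      proof (cases "fst p \<in> {u<..v}")
        case True
        have "generator_bound r l c (H_elem j (fst p) (snd p)) (x (snd p)) \<ge> - 18 * r ^ 4 * integrand_error j p"
          unfolding integrand_error_def using elim pos \<epsilon>_pos l by (intro generator_bound_ge) auto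
        moreover have "H_elem j (fst p) (snd p) = H_elem j v (snd p)"
          by (rule H_elem_const[OF uv free True])
        moreover have "- 18 * r ^ 4 * integrand_error j p \<le> 0"
          by (simp add: integrand_error_def)
        ultimately show ?thesis using True by (simp add: g_def indicator_def)
      qed simp
    qed
  qed
  then show ?thesis unfolding g_def[symmetric] G using int2 by simp
qed

text \<open>The slope \<open>Lp\<close> of the moving centre acts as additional drift, hence the
  condition on \<open>c\<close>. The defect on the right is all that lack of ellipticity of the
  approximation can cause over the whole time interval.\<close>

lemma elem_almost_submartingale:
  assumes err: "integrable time_space (integrand_error j)"
    and st: "0 \<le> s" "s \<le> t" "t \<le> T" and A: "A \<in> sets (F s)"
    and pos: "r > 0" "c \<ge> 1" and c: "real CARD('n) * C0 + Lp \<le> c"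
    and p: "\<And>u v. 0 \<le> u \<Longrightarrow> u \<le> v \<Longrightarrow> v \<le> T \<Longrightarrow> norm (p v - p u) \<le> Lp * (v - u)"
    and l: "l \<ge> (6 * r * c + 6 * (real CARD('n) * K) + 6 * \<epsilon>)\<^sup>2 / (24 * \<epsilon> * r\<^sup>2)"
  shows "exp (l * s) * expectation (\<lambda>\<omega>. indicator A \<omega> * bump r (X_elem j s \<omega> - p s))
     \<le> exp (l * t) * expectation (\<lambda>\<omega>. indicator A \<omega> * bump r (X_elem j t \<omega> - p t))
       + exp (l * T) * 18 * r ^ 4 * (\<integral>p. integrand_error j p \<partial>time_space)"
proof -
  have "0 \<le> (6 * r * c + 6 * (real CARD('n) * K) + 6 * \<epsilon>)\<^sup>2 / (24 * \<epsilon> * r\<^sup>2)"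
    using \<epsilon>_pos by simp
  then have l0: "l \<ge> 0" using l by linarith
  obtain B where B: "\<And>s \<omega>. \<omega> \<in> space M \<Longrightarrow> norm (H_elem j s \<omega>) \<le> B"
    using H_elem_bounded[of j] by blast
  define \<Phi> where "\<Phi> t = expectation (\<lambda>\<omega>. indicator A \<omega> * bump r (X_elem j t \<omega> - p t))" for t
  \<comment> \<open>Cumulative up to time \<open>v\<close>, so that the errors of consecutive steps
    telescope.\<close>
  define Err where "Err v = (\<integral>p. indicator {..v} (fst p) * integrand_error j p \<partial>time_space)" for v
  define Cs where "Cs = step_error r l * 64 * (c ^ 6 + 15 * (real CARD('n) * B) ^ 6)"
  have Cs: "Cs \<ge> 0" unfolding Cs_def step_error_def using pos l0 by simp
  have [measurable]: "indicat_real {..v} \<in> borel_measurable (restrict_space lborel {0..T})" for v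
    by (intro measurable_restrict_space1) auto
  have [measurable]: "indicat_real {u<..v} \<in> borel_measurable (restrict_space lborel {0..T})" for u v
    by (intro measurable_restrict_space1) auto
  have ierr: "integrable time_space (\<lambda>p. indicat_real {..v} (fst p) * integrand_error j p)" for v
  proof (rule Bochner_Integration.integrable_bound[OF err])
    show "(\<lambda>p. indicat_real {..v} (fst p) * integrand_error j p) \<in> borel_measurable time_space" by measurable
  qed (auto simp: indicator_def)
  have err0: "integrand_error j p \<ge> 0" for p by (simp add: integrand_error_def)
  have Err_diff: "Err v - Err u = (\<integral>p. indicator {u<..v} (fst p) * integrand_error j p \<partial>time_space)" if "u < v" for u v
  proof -
    have "indicat_real {..v} x * e - indicat_real {..u} x * e = indicat_real {u<..v} x * e" for x e :: real
      using that by (auto simp: indicator_def)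
    then show ?thesis
      unfolding Err_def Bochner_Integration.integral_diff[OF ierr ierr, symmetric] by simp
  qed
  have Err_ge: "0 \<le> Err v" for v unfolding Err_def using err0 by (intro integral_nonneg_AE AE_I2) (simp add: indicator_def)
  have Err_le: "Err v \<le> (\<integral>p. integrand_error j p \<partial>time_space)" for v
    unfolding Err_def using err0 by (intro integral_mono ierr err) (simp add: indicator_def)

  have limit: "exp (l * s) * \<Phi> s \<le> exp (l * t) * \<Phi> t + exp (l * T) * (18 * r ^ 4 * Err t + Cs * d * T)"
    if d: "0 < d" "d \<le> 1" for d
  proof -
    \<comment> \<open>Both corrections grow just fast enough to make \<open>f\<close> nondecreasing
      over steps of length at most \<open>d^2\<close>: \<open>Err\<close> pays for missing
      ellipticity, and \<open>Cs * d * v\<close> pays for the remainder, because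
      \<open>sqrt (v - u) \<le> d\<close>.\<close>
    define f where "f v = exp (l * v) * \<Phi> v + exp (l * T) * (18 * r ^ 4 * Err v + Cs * d * v)" for v
    have "f s \<le> f t"
    proof (rule le_by_local_steps[OF finite_grid[of j] _ st(2)])
      show "0 < d\<^sup>2" using d by simp
      fix u v assume uv: "s \<le> u" "u < v" "v \<le> t" "{u<..<v} \<inter> grid j = {}" "v - u \<le> d\<^sup>2"
      have uv3: "0 \<le> u" "u < v" "v \<le> T" using uv st by auto
      have "d\<^sup>2 \<le> 1" using d by (simp add: power_le_one)
      then have vu1: "v - u \<le> 1" using uv by linarith
      have Au: "A \<in> sets (F u)" using sets_F_mono[of s u A] st uv A by auto
      have xu: "(\<lambda>\<omega>. X_elem j u \<omega> - p u) \<in> borel_measurable (F u)"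
        using X_elem_adapted[of u j] uv3 by simp
      have xvF: "X_elem j v \<in> borel_measurable (F v)" using X_elem_adapted[of v j] uv3 by simp
      have xv: "(\<lambda>\<omega>. X_elem j v \<omega> - p v) \<in> borel_measurable M"
        using measurable_F[OF _ xvF] uv3 by simp
      have incr: "AE \<omega> in M. norm ((X_elem j v \<omega> - p v) - (X_elem j u \<omega> - p u) - H_elem j v \<omega> *v (W v \<omega> - W u \<omega>)) \<le> c * (v - u)"
        using X_elem_increment[OF uv3 uv(4)]
      proof eventually_elim
        case (elim \<omega>)
        have "(X_elem j v \<omega> - p v) - (X_elem j u \<omega> - p u) - H_elem j v \<omega> *v (W v \<omega> - W u \<omega>)
            = (X_elem j v \<omega> - X_elem j u \<omega> - H_elem j v \<omega> *v (W v \<omega> - W u \<omega>)) - (p v - p u)"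
          by (simp add: algebra_simps)
        then have "norm ((X_elem j v \<omega> - p v) - (X_elem j u \<omega> - p u) - H_elem j v \<omega> *v (W v \<omega> - W u \<omega>))
            \<le> real CARD('n) * C0 * (v - u) + Lp * (v - u)"
          using norm_triangle_ineq4 elim p[of u v] uv3 by (smt (verit))
        also have "\<dots> \<le> c * (v - u)"
          using c uv by (simp flip: distrib_right)
        finally show ?case .
      qed
      have step: "(1 + l * (v - u)) * \<Phi> v - \<Phi> u
          \<ge> (v - u) * expectation (\<lambda>\<omega>. indicator A \<omega> * generator_bound r l c (H_elem j v \<omega>) (X_elem j u \<omega> - p u))
            - Cs * (v - u) * sqrt (v - u)"
        unfolding \<Phi>_def Cs_def
        by (rule bump_step[OF uv3 vu1 pos(1) l0 pos(2) Au xu H_elem_predictable[OF uv3 uv(4)] B xv incr])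
      have "A \<in> sets M" using sets_F[OF _ Au] uv3 by auto
      moreover have "(\<lambda>\<omega>. X_elem j u \<omega> - p u) \<in> borel_measurable M"
        using measurable_F[OF _ xu] uv3 by auto
      ultimately have gen: "(v - u) * expectation (\<lambda>\<omega>. indicator A \<omega> * generator_bound r l c (H_elem j v \<omega>) (X_elem j u \<omega> - p u))
          \<ge> - 18 * r ^ 4 * (Err v - Err u)"
        unfolding Err_diff[OF uv(2)] using pos
        by (intro generator_lower_bound[OF uv3 uv(4) err _ _ _ _ l]) auto
      have "sqrt (v - u) \<le> d" using uv d by (simp add: real_le_lsqrt)
      then have sq: "Cs * (v - u) * sqrt (v - u) \<le> Cs * (v - u) * d"
        using Cs uv by (intro mult_left_mono) auto
      have Er: "0 \<le> Err v - Err u"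
        unfolding Err_diff[OF uv(2)] using err0 by (intro integral_nonneg_AE AE_I2) (simp add: indicator_def)
      define R where "R = 18 * r ^ 4 * (Err v - Err u) + Cs * (v - u) * d"
      have R0: "0 \<le> R" unfolding R_def using Er Cs uv d by simp
      have "(1 + l * (v - u)) * \<Phi> v - \<Phi> u \<ge> - R"
        using step gen sq unfolding R_def by linarith
      then have "exp (l * u) * ((1 + l * (v - u)) * \<Phi> v - \<Phi> u) \<ge> exp (l * u) * (- R)"
        by (intro mult_left_mono) auto
      \<comment> \<open>The discrete growth factor \<open>1 + l (v - u)\<close> is dominated by the
        exponential one, and the expectation it multiplies is nonnegative.\<close>
      moreover have "exp (l * v) * \<Phi> v \<ge> exp (l * u) * ((1 + l * (v - u)) * \<Phi> v)"
      proof -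
        have "exp (l * v) = exp (l * u) * exp (l * (v - u))" by (simp flip: exp_add add: algebra_simps)
        moreover have "exp (l * (v - u)) \<ge> 1 + l * (v - u)" by (rule exp_ge_add_one_self)
        moreover have "\<Phi> v \<ge> 0" unfolding \<Phi>_def by (intro integral_nonneg_AE AE_I2) (simp add: bump_nonneg)
        ultimately show ?thesis by (simp add: mult.assoc mult_left_mono mult_right_mono)
      qed
      moreover have "exp (l * u) * R \<le> exp (l * T) * R"
        using R0 l0 uv3 by (intro mult_right_mono) (auto intro: mult_left_mono)
      ultimately have "exp (l * v) * \<Phi> v - exp (l * u) * \<Phi> u \<ge> - (exp (l * T) * R)"
        by (simp add: algebra_simps)
      then show "f u \<le> f v" unfolding f_def R_def by (simp add: algebra_simps)
    qed
    moreover have "0 \<le> exp (l * T) * (18 * r ^ 4 * Err s + Cs * d * s)"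
      using Err_ge[of s] Cs d st by simp
    moreover have "exp (l * T) * (18 * r ^ 4 * Err t + Cs * d * t) \<le> exp (l * T) * (18 * r ^ 4 * Err t + Cs * d * T)"
      using Cs d st by (intro mult_left_mono add_left_mono) auto
    ultimately show ?thesis unfolding f_def by linarith
  qed
  \<comment> \<open>The first limit: \<open>Cs\<close> involves the bound \<open>B\<close> of this
    particular approximation, but it is a fixed number while \<open>d\<close> tends to 0.\<close>
  have "exp (l * s) * \<Phi> s \<le> exp (l * t) * \<Phi> t + exp (l * T) * (18 * r ^ 4 * Err t + Cs * 0 * T)"
  proof (rule tendsto_lowerbound)
    show "((\<lambda>d. exp (l * t) * \<Phi> t + exp (l * T) * (18 * r ^ 4 * Err t + Cs * d * T)) \<longlongrightarrow>
        exp (l * t) * \<Phi> t + exp (l * T) * (18 * r ^ 4 * Err t + Cs * 0 * T)) (at_right 0)"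
      by (intro tendsto_intros)
    show "\<forall>\<^sub>F d in at_right 0. exp (l * s) * \<Phi> s \<le> exp (l * t) * \<Phi> t + exp (l * T) * (18 * r ^ 4 * Err t + Cs * d * T)"
      using limit by (intro eventually_at_rightI[of 0 1]) auto
  qed simp
  also have "\<dots> \<le> exp (l * t) * \<Phi> t + exp (l * T) * 18 * r ^ 4 * (\<integral>p. integrand_error j p \<partial>time_space)"
    using Err_le[of t] pos by (simp add: mult.assoc mult_left_mono)
  finally show ?thesis unfolding \<Phi>_def .
qed

end

subsection \<open>The submartingale property\<close>

text \<open>Integrating \<open>\<bar>y\<bar> \<le> e + y^2 / e\<close> works in
  \<open>ennreal\<close> directly, where second moments of early members of the sequence may be
  infinite.\<close>

lemma (in prob_space) nn_integral_abs_tendsto_0: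
  fixes Y :: "nat \<Rightarrow> 'a \<Rightarrow> real"
  assumes [measurable]: "\<And>j. Y j \<in> borel_measurable M"
    and lim: "(\<lambda>j. \<integral>\<^sup>+ \<omega>. ennreal ((Y j \<omega>)\<^sup>2) \<partial>M) \<longlonglongrightarrow> 0"
  shows "(\<lambda>j. \<integral>\<^sup>+ \<omega>. ennreal \<bar>Y j \<omega>\<bar> \<partial>M) \<longlonglongrightarrow> 0"
proof (rule order_tendstoI)
  fix a :: ennreal assume "0 < a"
  then obtain e where e: "0 < e" "ennreal e < a"
  proof (cases a)
    case (real x)
    then show ?thesis using that[of "x / 2"] \<open>0 < a\<close> by (auto simp: ennreal_less_iff)
  qed (use that[of 1] in auto)
  have bound: "(\<integral>\<^sup>+ \<omega>. ennreal \<bar>Y j \<omega>\<bar> \<partial>M) \<le> ennreal e + ennreal (1 / e) * (\<integral>\<^sup>+ \<omega>. ennreal ((Y j \<omega>)\<^sup>2) \<partial>M)" for j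
  proof -
    have "\<bar>y\<bar> \<le> e + 1 / e * y\<^sup>2" for y :: real
    proof -
      have "2 * (e * \<bar>y\<bar>) \<le> e\<^sup>2 + y\<^sup>2" using sum_squares_bound[of e "\<bar>y\<bar>"] by simp
      moreover have "0 \<le> e * \<bar>y\<bar>" using e by simp
      ultimately have "e * \<bar>y\<bar> \<le> e\<^sup>2 + y\<^sup>2" by linarith
      then show ?thesis using e by (simp add: field_simps power2_eq_square)
    qed
    then have "(\<integral>\<^sup>+ \<omega>. ennreal \<bar>Y j \<omega>\<bar> \<partial>M) \<le> (\<integral>\<^sup>+ \<omega>. ennreal e + ennreal (1 / e) * ennreal ((Y j \<omega>)\<^sup>2) \<partial>M)"
      using e by (intro nn_integral_mono) (simp flip: ennreal_mult' ennreal_plus)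
    also have "\<dots> = ennreal e + ennreal (1 / e) * (\<integral>\<^sup>+ \<omega>. ennreal ((Y j \<omega>)\<^sup>2) \<partial>M)"
      by (simp add: nn_integral_add nn_integral_cmult emeasure_space_1)
    finally show ?thesis .
  qed
  have "(\<lambda>j. ennreal e + ennreal (1 / e) * (\<integral>\<^sup>+ \<omega>. ennreal ((Y j \<omega>)\<^sup>2) \<partial>M)) \<longlonglongrightarrow> ennreal e + ennreal (1 / e) * 0"
    by (intro tendsto_add tendsto_const ennreal_tendsto_cmult lim) simp
  then have "\<forall>\<^sub>F j in sequentially. ennreal e + ennreal (1 / e) * (\<integral>\<^sup>+ \<omega>. ennreal ((Y j \<omega>)\<^sup>2) \<partial>M) < a"
    using e by (intro order_tendstoD) auto
  then show "\<forall>\<^sub>F j in sequentially. (\<integral>\<^sup>+ \<omega>. ennreal \<bar>Y j \<omega>\<bar> \<partial>M) < a"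
    by eventually_elim (use bound in \<open>auto intro: le_less_trans\<close>)
qed simp

context elliptic_ito
begin

lemma X_measurable: "t \<in> {0..T} \<Longrightarrow> X t \<in> borel_measurable M"
  using X_adapted measurable_F by blast

text \<open>The bump is Lipschitz, so \<open>L^1\<close> convergence of the elementary integrals at
  the fixed time \<open>t\<close> suffices; no uniformity in time enters.\<close>

lemma elem_bump_tendsto:
  assumes t: "t \<in> {0..T}" and A: "A \<in> sets M" and r: "r > 0"
  shows "(\<lambda>j. expectation (\<lambda>\<omega>. indicator A \<omega> * bump r (X_elem j t \<omega> - q)))
     \<longlonglongrightarrow> expectation (\<lambda>\<omega>. indicator A \<omega> * bump r (X t \<omega> - q))"
proof (rule tendsto_L1_int)
  define Y where "Y i \<nu> j \<omega> = I i \<nu> t \<omega> - elem_int (\<lambda>t \<omega>. W t \<omega> $ \<nu>) (m i \<nu> j) (\<tau> i \<nu> j) (h i \<nu> j) t \<omega>" for i \<nu> j \<omega>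
  have Y [measurable]: "Y i \<nu> j \<in> borel_measurable M" for i \<nu> j
    unfolding Y_def
    using measurable_F[OF t I_adapted[OF t, of i \<nu>]]
      measurable_F[OF t elem_int_measurable[OF admissible[of i \<nu> j] t W_component_adapted]]
    by measurable
  have [measurable]: "X t \<in> borel_measurable M" "X_elem j t \<in> borel_measurable M" for j
    using X_measurable[OF t] measurable_F[OF t X_elem_adapted[OF t]] by auto
  note [measurable] = A
  show "integrable M (\<lambda>\<omega>. indicator A \<omega> * bump r (X_elem j t \<omega> - q))" for j
    by (rule integrable_indicator_bump) measurable
  show "integrable M (\<lambda>\<omega>. indicator A \<omega> * bump r (X t \<omega> - q))"
    by (rule integrable_indicator_bump) measurable
  have norm_le: "norm (X_elem j t \<omega> - X t \<omega>) \<le> (\<Sum>i\<in>UNIV. \<Sum>\<nu>\<in>UNIV. \<bar>Y i \<nu> j \<omega>\<bar>)" for j \<omega>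
  proof -
    have "(X_elem j t \<omega> - X t \<omega>) $ i = - (\<Sum>\<nu>\<in>UNIV. Y i \<nu> j \<omega>)" for i
      by (simp add: X_elem_def Y_def flip: sum_negf)
    then have "\<bar>(X_elem j t \<omega> - X t \<omega>) $ i\<bar> \<le> (\<Sum>\<nu>\<in>UNIV. \<bar>Y i \<nu> j \<omega>\<bar>)" for i
      by (metis abs_minus_cancel sum_abs)
    then show ?thesis
      using norm_le_l1_cart[of "X_elem j t \<omega> - X t \<omega>"] by (meson order_trans sum_mono)
  qed
  have bound: "(\<integral>\<^sup>+ \<omega>. ennreal (norm (indicator A \<omega> * bump r (X_elem j t \<omega> - q) - indicator A \<omega> * bump r (X t \<omega> - q))) \<partial>M)
      \<le> ennreal (6 * r ^ 5) * (\<Sum>i\<in>UNIV. \<Sum>\<nu>\<in>UNIV. \<integral>\<^sup>+ \<omega>. ennreal \<bar>Y i \<nu> j \<omega>\<bar> \<partial>M)" for j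
  proof -
    have "(\<integral>\<^sup>+ \<omega>. ennreal (norm (indicator A \<omega> * bump r (X_elem j t \<omega> - q) - indicator A \<omega> * bump r (X t \<omega> - q))) \<partial>M)
      \<le> (\<integral>\<^sup>+ \<omega>. ennreal (6 * r ^ 5) * (\<Sum>i\<in>UNIV. \<Sum>\<nu>\<in>UNIV. ennreal \<bar>Y i \<nu> j \<omega>\<bar>) \<partial>M)"
    proof (rule nn_integral_mono)
      fix \<omega>
      have "norm (indicator A \<omega> * bump r (X_elem j t \<omega> - q) - indicator A \<omega> * bump r (X t \<omega> - q))
          \<le> \<bar>bump r (X_elem j t \<omega> - q) - bump r (X t \<omega> - q)\<bar>"
        by (auto simp: indicator_def)
      also have "\<dots> \<le> 6 * r ^ 5 * norm (X_elem j t \<omega> - X t \<omega>)"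
        using bump_lipschitz[OF r, of "X_elem j t \<omega> - q" "X t \<omega> - q"] by simp
      also have "\<dots> \<le> 6 * r ^ 5 * (\<Sum>i\<in>UNIV. \<Sum>\<nu>\<in>UNIV. \<bar>Y i \<nu> j \<omega>\<bar>)"
        using norm_le r by (intro mult_left_mono) auto
      finally show "ennreal (norm (indicator A \<omega> * bump r (X_elem j t \<omega> - q) - indicator A \<omega> * bump r (X t \<omega> - q)))
          \<le> ennreal (6 * r ^ 5) * (\<Sum>i\<in>UNIV. \<Sum>\<nu>\<in>UNIV. ennreal \<bar>Y i \<nu> j \<omega>\<bar>)"
        using r by (simp add: sum_nonneg ennreal_mult'[symmetric] ennreal_leI)
    qed
    also have "\<dots> = ennreal (6 * r ^ 5) * (\<Sum>i\<in>UNIV. \<Sum>\<nu>\<in>UNIV. \<integral>\<^sup>+ \<omega>. ennreal \<bar>Y i \<nu> j \<omega>\<bar> \<partial>M)"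
      by (simp add: nn_integral_cmult nn_integral_sum del: sum_ennreal)
    finally show ?thesis .
  qed
  have "(\<lambda>j. ennreal (6 * r ^ 5) * (\<Sum>i\<in>UNIV. \<Sum>\<nu>\<in>UNIV. \<integral>\<^sup>+ \<omega>. ennreal \<bar>Y i \<nu> j \<omega>\<bar> \<partial>M))
      \<longlonglongrightarrow> ennreal (6 * r ^ 5) * (\<Sum>i\<in>(UNIV :: 'n set). \<Sum>\<nu>\<in>(UNIV :: 'n set). 0)"
  proof (intro ennreal_tendsto_cmult tendsto_sum nn_integral_abs_tendsto_0 Y)
    show "(\<lambda>j. \<integral>\<^sup>+ \<omega>. ennreal ((Y i \<nu> j \<omega>)\<^sup>2) \<partial>M) \<longlonglongrightarrow> 0" for i \<nu>
      unfolding Y_def by (rule integral_approx[OF t])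
  qed simp
  then have up: "(\<lambda>j. ennreal (6 * r ^ 5) * (\<Sum>i\<in>UNIV. \<Sum>\<nu>\<in>UNIV. \<integral>\<^sup>+ \<omega>. ennreal \<bar>Y i \<nu> j \<omega>\<bar> \<partial>M)) \<longlonglongrightarrow> 0"
    by simp
  show "(\<lambda>j. \<integral>\<^sup>+ \<omega>. ennreal (norm (indicator A \<omega> * bump r (X_elem j t \<omega> - q) - indicator A \<omega> * bump r (X t \<omega> - q))) \<partial>M) \<longlonglongrightarrow> 0"
  proof (rule tendsto_sandwich[OF _ _ tendsto_const up])
    show "\<forall>\<^sub>F j in sequentially. (\<integral>\<^sup>+ \<omega>. ennreal (norm (indicator A \<omega> * bump r (X_elem j t \<omega> - q) - indicator A \<omega> * bump r (X t \<omega> - q))) \<partial>M)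
      \<le> ennreal (6 * r ^ 5) * (\<Sum>i\<in>UNIV. \<Sum>\<nu>\<in>UNIV. \<integral>\<^sup>+ \<omega>. ennreal \<bar>Y i \<nu> j \<omega>\<bar> \<partial>M)"
      by (rule always_eventually, rule allI, rule bound)
  qed simp
qed

lemma exp_bump_submartingale:
  assumes st: "0 \<le> s" "s \<le> t" "t \<le> T" and A: "A \<in> sets (F s)"
    and pos: "r > 0" "c \<ge> 1" and c: "real CARD('n) * C0 + Lp \<le> c"
    and p: "\<And>u v. 0 \<le> u \<Longrightarrow> u \<le> v \<Longrightarrow> v \<le> T \<Longrightarrow> norm (p v - p u) \<le> Lp * (v - u)"
    and l: "l \<ge> (6 * r * c + 6 * (real CARD('n) * K) + 6 * \<epsilon>)\<^sup>2 / (24 * \<epsilon> * r\<^sup>2)"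
  shows "exp (l * s) * expectation (\<lambda>\<omega>. indicator A \<omega> * bump r (X s \<omega> - p s))
     \<le> exp (l * t) * expectation (\<lambda>\<omega>. indicator A \<omega> * bump r (X t \<omega> - p t))"
proof -
  have AM: "A \<in> sets M" using sets_F[OF _ A] st by auto
  have lim: "(\<lambda>j. \<integral>\<^sup>+ p. ennreal (integrand_error j p) \<partial>time_space) \<longlonglongrightarrow> 0"
    using integrand_error_tendsto unfolding integrand_error_def .
  have real_eq: "(\<integral>p. integrand_error j p \<partial>time_space) = enn2real (\<integral>\<^sup>+ p. ennreal (integrand_error j p) \<partial>time_space)" for j
    by (rule integral_eq_nn_integral) (auto simp: integrand_error_def)
  have lim_real: "(\<lambda>j. \<integral>p. integrand_error j p \<partial>time_space) \<longlonglongrightarrow> 0"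
    unfolding real_eq using lim by (intro tendsto_enn2real) auto
  have "\<forall>\<^sub>F j in sequentially. (\<integral>\<^sup>+ p. ennreal (integrand_error j p) \<partial>time_space) < \<infinity>"
    using lim by (intro order_tendstoD) auto
  \<comment> \<open>Convergence to 0 in \<open>ennreal\<close> excludes infinite values only from
    some index on, so the error is integrable only eventually.\<close>
  then have ev: "\<forall>\<^sub>F j in sequentially. integrable time_space (integrand_error j)"
    by eventually_elim (auto intro!: integrableI_nonneg simp: integrand_error_def)
  have "exp (l * s) * expectation (\<lambda>\<omega>. indicator A \<omega> * bump r (X s \<omega> - p s))
     \<le> exp (l * t) * expectation (\<lambda>\<omega>. indicator A \<omega> * bump r (X t \<omega> - p t)) + exp (l * T) * 18 * r ^ 4 * 0"
  proof (rule tendsto_le[OF sequentially_bot])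
    show "(\<lambda>j. exp (l * s) * expectation (\<lambda>\<omega>. indicator A \<omega> * bump r (X_elem j s \<omega> - p s)))
        \<longlonglongrightarrow> exp (l * s) * expectation (\<lambda>\<omega>. indicator A \<omega> * bump r (X s \<omega> - p s))"
      using st pos by (intro tendsto_mult tendsto_const elem_bump_tendsto AM) auto
    show "(\<lambda>j. exp (l * t) * expectation (\<lambda>\<omega>. indicator A \<omega> * bump r (X_elem j t \<omega> - p t))
          + exp (l * T) * 18 * r ^ 4 * (\<integral>p. integrand_error j p \<partial>time_space))
        \<longlonglongrightarrow> exp (l * t) * expectation (\<lambda>\<omega>. indicator A \<omega> * bump r (X t \<omega> - p t)) + exp (l * T) * 18 * r ^ 4 * 0"
      using st pos by (intro tendsto_add tendsto_mult tendsto_const elem_bump_tendsto AM lim_real) auto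
    show "\<forall>\<^sub>F j in sequentially. exp (l * s) * expectation (\<lambda>\<omega>. indicator A \<omega> * bump r (X_elem j s \<omega> - p s))
        \<le> exp (l * t) * expectation (\<lambda>\<omega>. indicator A \<omega> * bump r (X_elem j t \<omega> - p t))
          + exp (l * T) * 18 * r ^ 4 * (\<integral>p. integrand_error j p \<partial>time_space)"
      using ev by eventually_elim (rule elem_almost_submartingale[OF _ st A pos c p l])
  qed
  then show ?thesis by simp
qed

text \<open>The bump vanishes outside the ball, so the submartingale inequality survives when the event is
  cut down to the paths inside the ball at each of finitely many times; the resulting lower bound on
  the probability does not depend on those times.\<close>

lemma stay_in_tube:
  assumes t: "t \<in> {0..T}" and A: "A \<in> sets (F t)" "prob A > 0"
    and start: "\<And>\<omega>. \<omega> \<in> A \<Longrightarrow> norm (X t \<omega> - p t) < r"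
    and r: "r > 0"
    and p: "\<And>u v. 0 \<le> u \<Longrightarrow> u \<le> v \<Longrightarrow> v \<le> T \<Longrightarrow> norm (p v - p u) \<le> Lp * (v - u)"
    and Q: "countable Q" "Q \<subseteq> {t..T}"
  shows "prob {\<omega> \<in> A. \<forall>s\<in>Q. norm (X s \<omega> - p s) < r} > 0"
proof -
  define c where "c = max 1 (real CARD('n) * C0 + Lp)"
  define l where "l = (6 * r * c + 6 * (real CARD('n) * K) + 6 * \<epsilon>)\<^sup>2 / (24 * \<epsilon> * r\<^sup>2)"
  have l0: "l \<ge> 0" unfolding l_def using \<epsilon>_pos by simp
  have sub: "exp (l * u) * expectation (\<lambda>\<omega>. indicator B \<omega> * bump r (X u \<omega> - p u))
     \<le> exp (l * v) * expectation (\<lambda>\<omega>. indicator B \<omega> * bump r (X v \<omega> - p v))"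
    if "0 \<le> u" "u \<le> v" "v \<le> T" "B \<in> sets (F u)" for u v B
    by (rule exp_bump_submartingale[OF that r _ _ p, where c = c]) (auto simp: c_def l_def)
  define \<kappa> where "\<kappa> = exp (l * t) * expectation (\<lambda>\<omega>. indicator A \<omega> * bump r (X t \<omega> - p t))"
  have AM: "A \<in> sets M" using sets_F[OF t A(1)] .
  have mX: "X s \<in> borel_measurable M" if "s \<in> {0..T}" for s using X_measurable[OF that] .
  have int: "integrable M (\<lambda>\<omega>. indicator B \<omega> * bump r (X s \<omega> - p s))" if "B \<in> sets M" "s \<in> {0..T}" for B s
    using that mX[of s] by (intro integrable_indicator_bump) auto
  have \<kappa>: "\<kappa> > 0"
  proof -
    have "0 \<le> expectation (\<lambda>\<omega>. indicator A \<omega> * bump r (X t \<omega> - p t))"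
      by (intro integral_nonneg_AE AE_I2) (simp add: bump_nonneg)
    moreover have "expectation (\<lambda>\<omega>. indicator A \<omega> * bump r (X t \<omega> - p t)) \<noteq> 0"
    proof
      assume "expectation (\<lambda>\<omega>. indicator A \<omega> * bump r (X t \<omega> - p t)) = 0"
      then have "AE \<omega> in M. indicator A \<omega> * bump r (X t \<omega> - p t) = 0"
        using integral_nonneg_eq_0_iff_AE[OF int[OF AM t]] by (simp add: bump_nonneg)
      then have "AE \<omega> in M. \<omega> \<notin> A"
      proof eventually_elim
        case (elim \<omega>)
        then show ?case using start[of \<omega>] bump_pos_iff[OF r, of "X t \<omega> - p t"] by auto
      qed
      then have "prob A = 0" using AM by (simp add: prob_eq_0)
      then show False using A by simp
    qed
    ultimately show ?thesis unfolding \<kappa>_def by simp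
  qed
  define tube where "tube S = {\<omega> \<in> A. \<forall>s\<in>S. norm (X s \<omega> - p s) < r}" for S
  have tubeF: "tube S \<in> sets (F u)" if "finite S" "t \<le> u" "u \<le> T" "S \<subseteq> {t..u}" for S u
  proof -
    have "{\<omega> \<in> space (F u). norm (X s \<omega> - p s) < r} \<in> sets (F u)" if "s \<in> S" for s
    proof -
      have "0 \<le> s" "s \<le> u" using that \<open>S \<subseteq> {t..u}\<close> t by auto
      then have "X s \<in> borel_measurable (F u)"
        using \<open>u \<le> T\<close> by (intro measurable_F_mono[of s u] X_adapted) auto
      then show ?thesis by measurable
    qed
    then have "{\<omega> \<in> space (F u). \<forall>s\<in>S. norm (X s \<omega> - p s) < r} \<in> sets (F u)"
      using \<open>finite S\<close> by (rule sets.sets_Collect_finite_All)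
    moreover have Au: "A \<in> sets (F u)" using t that A(1) by (intro sets_F_mono[of t u]) auto
    ultimately have "A \<inter> {\<omega> \<in> space (F u). \<forall>s\<in>S. norm (X s \<omega> - p s) < r} \<in> sets (F u)"
      by (intro sets.Int)
    moreover have "A \<subseteq> space (F u)" using sets.sets_into_space[OF Au] .
    then have "A \<inter> {\<omega> \<in> space (F u). \<forall>s\<in>S. norm (X s \<omega> - p s) < r} = tube S"
      by (auto simp: tube_def)
    ultimately show ?thesis by simp
  qed
  \<comment> \<open>The times are added in increasing order, and \<open>u\<close> is the last one so
    far, or \<open>t\<close>. The inequality is transported from \<open>u\<close> to the new time,
    where the vanishing of the bump outside the ball allows that time to be added to the event for
    free. Membership of \<open>u\<close> in \<open>insert t S\<close> guarantees that the new time
    is not earlier.\<close>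
  have finite_tube: "\<exists>u\<in>{t..T}. S \<subseteq> {t..u} \<and> u \<in> insert t S \<and> \<kappa> \<le> exp (l * u) * expectation (\<lambda>\<omega>. indicator (tube S) \<omega> * bump r (X u \<omega> - p u))"
    if "finite S" "S \<subseteq> {t..T}" for S
    using that
  proof (induction S rule: finite_linorder_max_induct)
    case empty
    then show ?case using t by (intro bexI[of _ t]) (auto simp: tube_def \<kappa>_def)
  next
    case (insert b S)
    then have "S \<subseteq> {t..T}" by simp
    from insert.IH[OF this] obtain u where u: "u \<in> {t..T}" "S \<subseteq> {t..u}" "u \<in> insert t S"
      and le: "\<kappa> \<le> exp (l * u) * expectation (\<lambda>\<omega>. indicator (tube S) \<omega> * bump r (X u \<omega> - p u))" by blast
    have b: "u \<le> b" "b \<le> T" "t \<le> b" using u insert by auto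
    note le
    also have "exp (l * u) * expectation (\<lambda>\<omega>. indicator (tube S) \<omega> * bump r (X u \<omega> - p u))
        \<le> exp (l * b) * expectation (\<lambda>\<omega>. indicator (tube S) \<omega> * bump r (X b \<omega> - p b))"
      using u b t insert.hyps by (intro sub tubeF) auto
    also have "(\<lambda>\<omega>. indicator (tube S) \<omega> * bump r (X b \<omega> - p b)) = (\<lambda>\<omega>. indicator (tube (insert b S)) \<omega> * bump r (X b \<omega> - p b))"
    proof
      fix \<omega>
      have "bump r (X b \<omega> - p b) = 0" if "\<not> norm (X b \<omega> - p b) < r"
        using that bump_pos_iff[OF r, of "X b \<omega> - p b"] bump_nonneg[of r "X b \<omega> - p b"] by simp
      then show "indicator (tube S) \<omega> * bump r (X b \<omega> - p b) = indicator (tube (insert b S)) \<omega> * bump r (X b \<omega> - p b)"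
        by (cases "norm (X b \<omega> - p b) < r") (auto simp: tube_def indicator_def)
    qed
    finally show ?case
      using u b insert by (intro bexI[of _ b]) auto
  qed
  \<comment> \<open>The bump is at most \<open>r^6\<close> and the exponential at most its value at
    \<open>T\<close>, so this bound does not see how many times are prescribed.\<close>
  define \<eta> where "\<eta> = \<kappa> / (exp (l * T) * r ^ 6)"
  have \<eta>: "\<eta> > 0" using \<kappa> r by (simp add: \<eta>_def)
  have prob_tube: "\<eta> \<le> prob (tube S)" if S: "finite S" "S \<subseteq> {t..T}" for S
  proof -
    obtain u where u: "u \<in> {t..T}" "S \<subseteq> {t..u}"
      and le: "\<kappa> \<le> exp (l * u) * expectation (\<lambda>\<omega>. indicator (tube S) \<omega> * bump r (X u \<omega> - p u))"
      using finite_tube[OF S] by blast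
    have u0: "u \<in> {0..T}" using u t by auto
    have tS: "tube S \<in> sets M"
      using tubeF[OF S(1) _ _ u(2)] u u0 sets_F by auto
    have "expectation (\<lambda>\<omega>. indicator (tube S) \<omega> * bump r (X u \<omega> - p u)) \<le> expectation (\<lambda>\<omega>. indicator (tube S) \<omega> * r ^ 6)"
    proof (rule integral_mono[OF int[OF tS u0]])
      have "integrable M (indicat_real (tube S))"
        using tS by (intro integrable_real_indicator) (auto simp: less_top[symmetric])
      then show "integrable M (\<lambda>\<omega>. indicator (tube S) \<omega> * r ^ 6)" by (rule integrable_mult_left)
    qed (auto intro!: mult_left_mono bump_le)
    also have "\<dots> = prob (tube S) * r ^ 6" using tS by simp
    finally have "exp (l * u) * expectation (\<lambda>\<omega>. indicator (tube S) \<omega> * bump r (X u \<omega> - p u)) \<le> exp (l * T) * (prob (tube S) * r ^ 6)"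
      using l0 u by (intro mult_mono) (auto intro!: mult_left_mono integral_nonneg_AE AE_I2 simp: bump_nonneg)
    with le have "\<kappa> \<le> prob (tube S) * (exp (l * T) * r ^ 6)" by (simp add: mult_ac)
    then show ?thesis unfolding \<eta>_def using r by (simp add: pos_divide_le_eq)
  qed
  show ?thesis
  proof (cases "Q = {}")
    case True
    then show ?thesis using A by simp
  next
    case False
    define e where "e = from_nat_into Q"
    have e: "range e = Q" unfolding e_def by (rule range_from_nat_into[OF False Q(1)])
    \<comment> \<open>Prescribing the first \<open>N\<close> times of an enumeration gives
      decreasing events, and the uniform lower bound survives their intersection.\<close>
    define D where "D N = tube (e ` {..<N})" for N
    have fin: "finite (e ` {..<N})" "e ` {..<N} \<subseteq> {t..T}" for N using e Q by auto
    have D: "D N \<in> sets M" for N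
      using tubeF[OF fin(1) _ _ fin(2)] t sets_F[of T] T_pos unfolding D_def by auto
    have "(\<lambda>N. prob (D N)) \<longlonglongrightarrow> prob (\<Inter>N. D N)"
    proof (rule finite_Lim_measure_decseq)
      show "range D \<subseteq> sets M" using D by auto
      show "decseq D" unfolding decseq_def D_def tube_def by auto
    qed
    then have "\<eta> \<le> prob (\<Inter>N. D N)"
      by (rule tendsto_lowerbound) (use prob_tube fin in \<open>auto simp: D_def\<close>)
    moreover have "(\<Inter>N. D N) = {\<omega> \<in> A. \<forall>s\<in>Q. norm (X s \<omega> - p s) < r}"
      unfolding D_def tube_def e[symmetric] by auto
    ultimately show ?thesis using \<eta> by simp
  qed
qed

end

subsection \<open>Countably many tubes\<close>

text \<open>Bernstein polynomials serve as tube centres, and centres must be Lipschitz to count as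
  bounded drift. Any constant will do; this one follows from the product rule on the unit
  interval.\<close>

lemma Bernstein_lipschitz:
  assumes "x \<in> {0..1}" "y \<in> {0..1}"
  shows "\<bar>Bernstein n k x - Bernstein n k y\<bar> \<le> real (n choose k) * real (k + (n - k)) * \<bar>x - y\<bar>"
proof -
  have pw: "\<bar>a ^ i - b ^ i\<bar> \<le> real i * \<bar>a - b\<bar>" if "a \<in> {0..1}" "b \<in> {0..1}" for a b :: real and i
  proof -
    have "norm a \<le> 1" "norm b \<le> 1" using that by auto
    from norm_power_diff[OF this, of i] show ?thesis by (simp only: real_norm_def)
  qed
  have 1: "\<bar>x ^ k - y ^ k\<bar> \<le> real k * \<bar>x - y\<bar>" using pw[OF assms] .
  have 2: "\<bar>(1 - x) ^ (n - k) - (1 - y) ^ (n - k)\<bar> \<le> real (n - k) * \<bar>x - y\<bar>"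
  proof -
    have "1 - x \<in> {0..1}" "1 - y \<in> {0..1}" using assms by auto
    moreover have "\<bar>1 - x - (1 - y)\<bar> = \<bar>x - y\<bar>" by arith
    ultimately show ?thesis using pw[of "1 - x" "1 - y" "n - k"] by metis
  qed
  have le1: "\<bar>(1 - x) ^ (n - k)\<bar> \<le> 1" "\<bar>y ^ k\<bar> \<le> 1"
    using assms by (auto simp: power_abs intro!: power_le_one)
  have prod: "\<bar>a * b - c * d\<bar> \<le> \<bar>a - c\<bar> + \<bar>b - d\<bar>" if "\<bar>b\<bar> \<le> 1" "\<bar>c\<bar> \<le> 1" for a b c d :: real
  proof -
    have "a * b - c * d = (a - c) * b + c * (b - d)" by (simp add: algebra_simps)
    then have "\<bar>a * b - c * d\<bar> \<le> \<bar>a - c\<bar> * \<bar>b\<bar> + \<bar>c\<bar> * \<bar>b - d\<bar>"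
      using abs_triangle_ineq[of "(a - c) * b" "c * (b - d)"] unfolding abs_mult by linarith
    also have "\<dots> \<le> \<bar>a - c\<bar> * 1 + 1 * \<bar>b - d\<bar>"
      using that by (intro add_mono mult_mono) auto
    finally show ?thesis by simp
  qed
  have 3: "\<bar>x ^ k * (1 - x) ^ (n - k) - y ^ k * (1 - y) ^ (n - k)\<bar> \<le> real (k + (n - k)) * \<bar>x - y\<bar>"
    using prod[OF le1, of "x ^ k" "(1 - y) ^ (n - k)"] 1 2 unfolding of_nat_add distrib_right by linarith
  have "Bernstein n k x - Bernstein n k y = real (n choose k) * (x ^ k * (1 - x) ^ (n - k) - y ^ k * (1 - y) ^ (n - k))"
    unfolding Bernstein_def right_diff_distrib mult.assoc ..
  then have "\<bar>Bernstein n k x - Bernstein n k y\<bar>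
      = real (n choose k) * \<bar>x ^ k * (1 - x) ^ (n - k) - y ^ k * (1 - y) ^ (n - k)\<bar>"
    by (simp only: abs_mult abs_of_nat)
  also have "\<dots> \<le> real (n choose k) * (real (k + (n - k)) * \<bar>x - y\<bar>)"
    using 3 by (rule mult_left_mono) simp
  finally show ?thesis by (simp only: mult.assoc)
qed

text \<open>The list holds the coefficients and determines the degree, so that lists over a
  countable dense set give countably many centres. The empty list does no harm: it gives degree 0
  and a constant path.\<close>

definition bernstein_path :: "real \<Rightarrow> 'b::real_vector list \<Rightarrow> real \<Rightarrow> 'b" where
  "bernstein_path T cs s = (\<Sum>k\<le>length cs - 1. Bernstein (length cs - 1) k (s / T) *\<^sub>R (cs ! k))"

lemma bernstein_path_lipschitz:
  fixes cs :: "'b::real_normed_vector list"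
  assumes "T > 0"
  shows "\<exists>L. \<forall>u v. 0 \<le> u \<longrightarrow> u \<le> v \<longrightarrow> v \<le> T \<longrightarrow> norm (bernstein_path T cs v - bernstein_path T cs u) \<le> L * (v - u)"
proof (intro exI allI impI)
  let ?n = "length cs - 1"
  fix u v assume uv: "0 \<le> u" "u \<le> v" "v \<le> T"
  have "bernstein_path T cs v - bernstein_path T cs u
      = (\<Sum>k\<le>?n. (Bernstein ?n k (v / T) - Bernstein ?n k (u / T)) *\<^sub>R (cs ! k))"
    by (simp add: bernstein_path_def scaleR_diff_left sum_subtractf)
  also have "norm \<dots> \<le> (\<Sum>k\<le>?n. (real (?n choose k) * real (k + (?n - k)) * norm (cs ! k) / T) * (v - u))"
  proof (rule sum_norm_le)
    fix k
    have "\<bar>Bernstein ?n k (v / T) - Bernstein ?n k (u / T)\<bar> \<le> real (?n choose k) * real (k + (?n - k)) * \<bar>v / T - u / T\<bar>"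
      using uv assms by (intro Bernstein_lipschitz) auto
    also have "\<bar>v / T - u / T\<bar> = (v - u) / T"
      using uv assms by (simp flip: diff_divide_distrib)
    finally have "\<bar>Bernstein ?n k (v / T) - Bernstein ?n k (u / T)\<bar> * norm (cs ! k)
        \<le> real (?n choose k) * real (k + (?n - k)) * ((v - u) / T) * norm (cs ! k)"
      by (rule mult_right_mono) simp
    then show "norm ((Bernstein ?n k (v / T) - Bernstein ?n k (u / T)) *\<^sub>R (cs ! k))
        \<le> (real (?n choose k) * real (k + (?n - k)) * norm (cs ! k) / T) * (v - u)"
      by (simp add: mult_ac)
  qed
  finally show "norm (bernstein_path T cs v - bernstein_path T cs u)
      \<le> (\<Sum>k\<le>?n. real (?n choose k) * real (k + (?n - k)) * norm (cs ! k) / T) * (v - u)"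
    by (simp only: sum_distrib_right)
qed

text \<open>One half of \<open>e\<close> goes to Weierstrass approximation of each coordinate, the
  other to moving the coefficients into \<open>D\<close>; the latter error is not amplified, because
  the Bernstein weights are nonnegative and add up to 1.\<close>

lemma bernstein_path_dense:
  fixes g :: "real \<Rightarrow> real ^ 'n::finite" and D :: "(real ^ 'n) set"
  assumes T: "T > 0" and g: "continuous_on {0..T} g" and D: "closure D = UNIV" and e: "e > 0"
  shows "\<exists>cs\<in>lists D. \<forall>s\<in>{0..T}. norm (g s - bernstein_path T cs s) < e"
proof -
  \<comment> \<open>The norm is estimated by the sum over the coordinates, which turns
    \<open>e'\<close> into \<open>e / 2\<close>.\<close>
  define e' where "e' = e / (2 * real CARD('n))"
  have e': "e' > 0" using e by (simp add: e'_def)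
  have "\<exists>N. \<forall>n x. N \<le> n \<and> x \<in> {0..1} \<longrightarrow>
      \<bar>g (T * x) $ i - (\<Sum>k\<le>n. g (T * (real k / real n)) $ i * Bernstein n k x)\<bar> < e'" for i
  proof (rule Bernstein_Weierstrass[OF _ e'])
    show "continuous_on {0..1} (\<lambda>x. g (T * x) $ i)"
      using T by (intro continuous_on_component continuous_on_compose2[OF g] continuous_intros)
        (auto intro: mult_left_le)
  qed
  then have "\<forall>i. \<exists>N. \<forall>n x. N \<le> n \<and> x \<in> {0..1} \<longrightarrow>
      \<bar>g (T * x) $ i - (\<Sum>k\<le>n. g (T * (real k / real n)) $ i * Bernstein n k x)\<bar> < e'" by (rule allI)
  from choice[OF this] obtain N where N: "\<And>i n x. N i \<le> n \<Longrightarrow> x \<in> {0..1} \<Longrightarrow>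
      \<bar>g (T * x) $ i - (\<Sum>k\<le>n. g (T * (real k / real n)) $ i * Bernstein n k x)\<bar> < e'"
    by blast
  define n where "n = Max (range N)"
  have n: "N i \<le> n" for i unfolding n_def by (intro Max_ge) auto
  have "\<exists>d\<in>D. norm (y - d) < e / 2" for y
  proof -
    have "y \<in> closure D" using D by simp
    moreover have "e / 2 > 0" using e by simp
    ultimately obtain d where "d \<in> D" "dist d y < e / 2" unfolding closure_approachable by blast
    then show ?thesis by (auto simp: dist_norm norm_minus_commute)
  qed
  then have "\<forall>y. \<exists>d. d \<in> D \<and> norm (y - d) < e / 2" by blast
  from choice[OF this] obtain d where d: "\<And>y. d y \<in> D" "\<And>y. norm (y - d y) < e / 2" by blast
  define cs where "cs = map (\<lambda>k. d (g (T * (real k / real n)))) [0..<Suc n]"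
  have len: "length cs - 1 = n" by (simp add: cs_def)
  have nth: "cs ! k = d (g (T * (real k / real n)))" if "k \<le> n" for k
    unfolding cs_def using that by (simp del: upt_Suc)
  have "norm (g s - bernstein_path T cs s) < e" if s: "s \<in> {0..T}" for s
  proof -
    define x where "x = s / T"
    have x: "x \<in> {0..1}" and sx: "s = T * x" using s T by (auto simp: x_def)
    define B where "B k = Bernstein n k x" for k
    have B: "B k \<ge> 0" for k unfolding B_def using x by (auto intro: Bernstein_nonneg)
    have B1: "(\<Sum>k\<le>n. B k) = 1" unfolding B_def by (rule sum_Bernstein)
    define b where "b = (\<Sum>k\<le>n. B k *\<^sub>R g (T * (real k / real n)))"
    have "norm (g s - b) \<le> (\<Sum>i\<in>UNIV. \<bar>(g s - b) $ i\<bar>)" by (rule norm_le_l1_cart)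
    also have "\<dots> \<le> (\<Sum>i\<in>(UNIV :: 'n set). e')"
    proof (rule sum_mono)
      fix i
      show "\<bar>(g s - b) $ i\<bar> \<le> e'"
      proof -
        have "b $ i = (\<Sum>k\<le>n. g (T * (real k / real n)) $ i * Bernstein n k x)"
          unfolding b_def B_def sum_component by (intro sum.cong refl) (simp add: mult.commute)
        then show ?thesis using N[OF n x, of i] unfolding sx vector_minus_component by linarith
      qed
    qed
    also have "\<dots> = e / 2" by (simp add: e'_def)
    finally have 1: "norm (g s - b) \<le> e / 2" .
    have "b - bernstein_path T cs s = (\<Sum>k\<le>n. B k *\<^sub>R (g (T * (real k / real n)) - cs ! k))"
      unfolding b_def bernstein_path_def len B_def x_def scaleR_diff_right sum_subtractf ..
    also have "norm \<dots> \<le> (\<Sum>k\<le>n. B k * norm (g (T * (real k / real n)) - cs ! k))"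
      using B by (intro sum_norm_le) simp
    also have "\<dots> < (\<Sum>k\<le>n. B k * (e / 2))"
    proof -
      \<comment> \<open>Weights may vanish, so a strict inequality between the weighted sums needs
        one index with positive weight.\<close>
      have "\<exists>k\<in>{..n}. B k \<noteq> 0"
      proof (rule ccontr)
        assume "\<not> ?thesis"
        then have "(\<Sum>k\<le>n. B k) = 0" by (intro sum.neutral) auto
        with B1 show False by simp
      qed
      then obtain k where k: "k \<le> n" "B k > 0" using B[THEN antisym_conv2] by auto
      show ?thesis
      proof (rule sum_strict_mono_ex1)
        show "\<forall>k\<in>{..n}. B k * norm (g (T * (real k / real n)) - cs ! k) \<le> B k * (e / 2)"
        proof
          fix k assume "k \<in> {..n}"
          then have "norm (g (T * (real k / real n)) - cs ! k) \<le> e / 2"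
            using d(2)[of "g (T * (real k / real n))"] nth[of k] by simp
          then show "B k * norm (g (T * (real k / real n)) - cs ! k) \<le> B k * (e / 2)"
            by (rule mult_left_mono[OF _ B])
        qed
        show "\<exists>k\<in>{..n}. B k * norm (g (T * (real k / real n)) - cs ! k) < B k * (e / 2)"
          using k d(2)[of "g (T * (real k / real n))"] nth[of k] by (intro bexI[of _ k] mult_strict_left_mono) auto
      qed simp
    qed
    also have "\<dots> = e / 2" by (simp only: B1 mult_1 flip: sum_distrib_right)
    finally have 2: "norm (b - bernstein_path T cs s) < e / 2" .
    have "norm (g s - bernstein_path T cs s) \<le> norm (g s - b) + norm (b - bernstein_path T cs s)"
      using norm_triangle_ineq[of "g s - b" "b - bernstein_path T cs s"] by simp
    then show ?thesis using 1 2 by linarith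
  qed
  moreover have "cs \<in> lists D" using d(1) by (auto simp: cs_def)
  ultimately show ?thesis by blast
qed

lemma sets_Collect_ball_countable:
  assumes "countable Q" "\<And>s. s \<in> Q \<Longrightarrow> {\<omega> \<in> space N. P s \<omega>} \<in> sets N"
  shows "{\<omega> \<in> space N. \<forall>s\<in>Q. P s \<omega>} \<in> sets N"
proof (cases "Q = {}")
  case False
  then have "{\<omega> \<in> space N. \<forall>s\<in>Q. P s \<omega>} = (\<Inter>s\<in>Q. {\<omega> \<in> space N. P s \<omega>})" by auto
  then show ?thesis using assms False by (auto intro!: sets.countable_INT')
qed simp

lemma norm_le_from_dense:
  fixes f :: "real \<Rightarrow> 'b::real_normed_vector"
  assumes "continuous_on {a..b} f" "Q \<subseteq> {a..b}" "{a..b} \<subseteq> closure Q" "\<And>s. s \<in> Q \<Longrightarrow> norm (f s) \<le> r" "s \<in> {a..b}"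
  shows "norm (f s) \<le> r"
proof -
  have "closed {x \<in> {a..b}. norm (f x) \<le> r}"
    using continuous_on_closed_Collect_le[of "{a..b}" "\<lambda>x. norm (f x)" "\<lambda>_. r"] assms(1)
    by (auto intro: continuous_intros)
  then have "closure Q \<subseteq> {x \<in> {a..b}. norm (f x) \<le> r}"
    using assms by (intro closure_minimal) auto
  then show ?thesis using assms by auto
qed

section \<open>Conditional probabilities of open sets of paths\<close>

context elliptic_ito
begin

text \<open>The tube is closed because a bound known on a dense set of times extends to all times
  only in its non-strict form.\<close>

definition tube_in :: "(real \<Rightarrow> real ^ 'n) set \<Rightarrow> (real \<Rightarrow> real ^ 'n) \<Rightarrow> real \<Rightarrow> bool" where
  "tube_in G p r \<longleftrightarrow> r > 0 \<and> (\<forall>g. continuous_on {0..T} g \<longrightarrow> (\<forall>s\<in>{0..T}. norm (g s - p s) \<le> r) \<longrightarrow> g \<in> G)"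

text \<open>With \<open>r < e / 2\<close>, a path in the closed tube is within
  \<open>r + r < e\<close> of \<open>g\<close>. Coefficients in \<open>D\<close> and a rational
  radius keep the family of tubes countable.\<close>

lemma tube_in_exists:
  assumes G: "uniform_open T G" "g \<in> G" and D: "closure D = UNIV"
  shows "\<exists>cs\<in>lists D. \<exists>r\<in>\<rat>. tube_in G (bernstein_path T cs) r \<and> (\<forall>s\<in>{0..T}. norm (g s - bernstein_path T cs s) < r)"
proof -
  obtain e where e: "e > 0" and cont: "continuous_on {0..T} g"
    and sub: "\<And>f. continuous_on {0..T} f \<Longrightarrow> (\<And>s. s \<in> {0..T} \<Longrightarrow> dist (f s) (g s) < e) \<Longrightarrow> f \<in> G"
    using G unfolding uniform_open_def by metis
  obtain r where r: "r \<in> \<rat>" "0 < r" "r < e / 2" using Rats_dense_in_real[of 0 "e / 2"] e by auto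
  obtain cs where cs: "cs \<in> lists D" "\<And>s. s \<in> {0..T} \<Longrightarrow> norm (g s - bernstein_path T cs s) < r"
    using bernstein_path_dense[OF T_pos cont D r(2)] by blast
  have "tube_in G (bernstein_path T cs) r"
    unfolding tube_in_def
  proof (intro conjI allI impI)
    fix f assume f: "continuous_on {0..T} f" "\<forall>s\<in>{0..T}. norm (f s - bernstein_path T cs s) \<le> r"
    show "f \<in> G"
    proof (rule sub[OF f(1)])
      fix s assume s: "s \<in> {0..T}"
      have "dist (f s) (g s) \<le> norm (f s - bernstein_path T cs s) + norm (g s - bernstein_path T cs s)"
        by (metis dist_norm dist_triangle2)
      also have "\<dots> < e" using f(2) cs(2)[OF s] r s by (smt (verit) field_sum_of_halves)
      finally show "dist (f s) (g s) < e" .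
    qed
  qed (use r in auto)
  then show ?thesis using cs r by blast
qed

lemma null_subset_sets: "N \<in> null_sets M \<Longrightarrow> A \<subseteq> N \<Longrightarrow> A \<in> sets M"
  using filtration by (auto simp: filtration_usual_def)

text \<open>\<open>G\<close> is an arbitrary set of functions on the reals, so measurability is not
  automatic. For continuous paths the event is a countable union of tubes, each tested at countably
  many times; the discontinuous paths lie in a null set, all of whose subsets are measurable by
  completeness.\<close>

lemma path_event_measurable:
  assumes G: "uniform_open T G"
  shows "{\<omega> \<in> space M. (\<lambda>s. X s \<omega>) \<in> G} \<in> sets M"
proof -
  obtain D :: "(real ^ 'n) set" where "countable D" "UNIV \<subseteq> closure D"
    by (rule separable[of UNIV]) blast
  then have D: "countable D" "closure D = UNIV" by blast+
  obtain Q where Q: "countable Q" "Q \<subseteq> {0..T}" "{0..T} \<subseteq> closure Q"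
    by (rule separable[of "{0..T}"]) blast
  define P where "P = {(cs, r). cs \<in> lists D \<and> r \<in> \<rat> \<and> tube_in G (bernstein_path T cs) r}"
  have P: "countable P"
  proof (rule countable_subset)
    show "P \<subseteq> lists D \<times> \<rat>" by (auto simp: P_def)
    show "countable (lists D \<times> (\<rat> :: real set))" using D(1) countable_rat by (intro countable_SIGMA) auto
  qed
  define U where "U = (\<Union>(cs, r)\<in>P. {\<omega> \<in> space M. \<forall>s\<in>Q. norm (X s \<omega> - bernstein_path T cs s) \<le> r})"
  have U: "U \<in> sets M"
    unfolding U_def
  proof (intro sets.countable_UN'[OF P] ballI, clarify)
    fix cs r
    have "{\<omega> \<in> space M. norm (X s \<omega> - bernstein_path T cs s) \<le> r} \<in> sets M" if "s \<in> Q" for s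
    proof -
      have "X s \<in> borel_measurable M" using X_measurable Q(2) that by blast
      then show ?thesis by measurable
    qed
    then show "{\<omega> \<in> space M. \<forall>s\<in>Q. norm (X s \<omega> - bernstein_path T cs s) \<le> r} \<in> sets M"
      using Q(1) by (intro sets_Collect_ball_countable)
  qed
  obtain N where N: "N \<in> null_sets M" "\<And>\<omega>. \<omega> \<in> space M \<Longrightarrow> \<omega> \<notin> N \<Longrightarrow> continuous_on {0..T} (\<lambda>t. X t \<omega>)"
    using X_continuous by (rule AE_E3) blast
  have "{\<omega> \<in> space M. (\<lambda>s. X s \<omega>) \<in> G} - N = U - N"
  proof (intro set_eqI iffI)
    fix \<omega> assume "\<omega> \<in> {\<omega> \<in> space M. (\<lambda>s. X s \<omega>) \<in> G} - N"
    then have \<omega>: "\<omega> \<in> space M" "\<omega> \<notin> N" "(\<lambda>s. X s \<omega>) \<in> G" by blast+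
    from tube_in_exists[OF G \<omega>(3) D(2)] obtain cs r
      where "(cs, r) \<in> P" "\<forall>s\<in>{0..T}. norm (X s \<omega> - bernstein_path T cs s) < r"
      unfolding P_def by blast
    moreover from this(2) Q(2) have "\<forall>s\<in>Q. norm (X s \<omega> - bernstein_path T cs s) \<le> r"
      by (meson less_imp_le subsetD)
    ultimately have "\<omega> \<in> U" using \<omega>(1) unfolding U_def by blast
    then show "\<omega> \<in> U - N" using \<omega>(2) by blast
  next
    fix \<omega> assume "\<omega> \<in> U - N"
    then obtain cs r where \<omega>: "\<omega> \<in> space M" "\<omega> \<notin> N" and csr: "(cs, r) \<in> P"
      and le: "\<And>s. s \<in> Q \<Longrightarrow> norm (X s \<omega> - bernstein_path T cs s) \<le> r"
      unfolding U_def by blast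
    have cont: "continuous_on {0..T} (\<lambda>s. X s \<omega>)" by (rule N(2)[OF \<omega>])
    have "continuous_on {0..T} (\<lambda>s. X s \<omega> - bernstein_path T cs s)"
      unfolding bernstein_path_def Bernstein_def by (intro continuous_intros cont) (use T_pos in auto)
    then have "norm (X s \<omega> - bernstein_path T cs s) \<le> r" if "s \<in> {0..T}" for s
      using norm_le_from_dense[OF _ Q(2,3) _ that, of "\<lambda>s. X s \<omega> - bernstein_path T cs s" r] le by blast
    then have "(\<lambda>s. X s \<omega>) \<in> G" using csr cont unfolding P_def tube_in_def by blast
    then show "\<omega> \<in> {\<omega> \<in> space M. (\<lambda>s. X s \<omega>) \<in> G} - N" using \<omega> by blast
  qed
  then have "{\<omega> \<in> space M. (\<lambda>s. X s \<omega>) \<in> G} = (U - N) \<union> ({\<omega> \<in> space M. (\<lambda>s. X s \<omega>) \<in> G} \<inter> N)"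
    by blast
  moreover have "(U - N) \<union> ({\<omega> \<in> space M. (\<lambda>s. X s \<omega>) \<in> G} \<inter> N) \<in> sets M"
    using U N(1) null_subset_sets[OF N(1)] by (intro sets.Un sets.Diff) auto
  ultimately show ?thesis by simp
qed

text \<open>Suppose that the past lies in the tube while the conditional probability is at most 0,
  with positive probability. This event belongs to \<open>F t\<close>, so
  \<open>stay_in_tube\<close> finds inside it a set of positive probability on which the whole path
  lies in \<open>G\<close>; but integrating the conditional expectation over the event gives at most
  0.\<close>

lemma cond_exp_positive_in_tube:
  assumes t: "t \<in> {0..T}" and G: "uniform_open T G" and tube: "tube_in G (bernstein_path T cs) r"
  shows "AE \<omega> in M. (\<forall>s\<in>{0..t}. norm (X s \<omega> - bernstein_path T cs s) < r) \<longrightarrow>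
    real_cond_exp M (F t) (indicator {\<omega>' \<in> space M. (\<lambda>s. X s \<omega>') \<in> G}) \<omega> > 0"
proof -
  interpret Ft: finite_measure_subalgebra M "F t"
    using subalgebra_F[OF t] by unfold_locales
  define p where "p = bernstein_path T cs"
  have r: "r > 0" using tube by (simp add: tube_in_def)
  obtain Lp where Lp: "\<And>u v. 0 \<le> u \<Longrightarrow> u \<le> v \<Longrightarrow> v \<le> T \<Longrightarrow> norm (p v - p u) \<le> Lp * (v - u)"
    using bernstein_path_lipschitz[OF T_pos, of cs] unfolding p_def by blast
  have pcont: "continuous_on {0..T} p"
    unfolding p_def bernstein_path_def Bernstein_def by (intro continuous_intros) (use T_pos in auto)
  define E where "E = {\<omega> \<in> space M. (\<lambda>s. X s \<omega>) \<in> G}"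
  have E [measurable]: "E \<in> sets M" unfolding E_def by (rule path_event_measurable[OF G])
  define Z where "Z = real_cond_exp M (F t) (indicator E)"
  have Zm: "Z \<in> borel_measurable (F t)" unfolding Z_def by (rule borel_measurable_cond_exp)
  obtain Q0 where Q0: "countable Q0" "Q0 \<subseteq> {0..t}" "{0..t} \<subseteq> closure Q0"
    by (rule separable[of "{0..t}"]) blast
  obtain Q1 where Q1: "countable Q1" "Q1 \<subseteq> {t..T}" "{t..T} \<subseteq> closure Q1"
    by (rule separable[of "{t..T}"]) blast
  \<comment> \<open>Countably many times and non-strict bounds put the past into \<open>F t\<close>.
    At time \<open>t\<close> itself the bound is strict, since the bump has to be positive at the
    start.\<close>
  define A where "A = {\<omega> \<in> space (F t). (\<forall>s\<in>Q0. norm (X s \<omega> - p s) \<le> r) \<and> norm (X t \<omega> - p t) < r \<and> Z \<omega> \<le> 0}"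
  have A: "A \<in> sets (F t)"
  proof -
    have "{\<omega> \<in> space (F t). norm (X s \<omega> - p s) \<le> r} \<in> sets (F t)" if "s \<in> Q0" for s
    proof -
      have "0 \<le> s" "s \<le> t" using that Q0(2) by auto
      then have "X s \<in> borel_measurable (F t)"
        using t by (intro measurable_F_mono[of s t] X_adapted) auto
      then show ?thesis by measurable
    qed
    then have "{\<omega> \<in> space (F t). \<forall>s\<in>Q0. norm (X s \<omega> - p s) \<le> r} \<in> sets (F t)"
      using Q0(1) by (intro sets_Collect_ball_countable)
    moreover have "{\<omega> \<in> space (F t). norm (X t \<omega> - p t) < r} \<in> sets (F t)"
      using X_adapted[OF t] by measurable
    moreover have "{\<omega> \<in> space (F t). Z \<omega> \<le> 0} \<in> sets (F t)"
      using Zm by measurable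
    ultimately show ?thesis unfolding A_def by (intro sets.sets_Collect_conj)
  qed
  have AM: "A \<in> sets M" using sets_F[OF t A] .
  have "prob A = 0"
  proof (rule ccontr)
    assume "prob A \<noteq> 0"
    then have "prob A > 0" by (simp add: zero_less_measure_iff)
    define A' where "A' = {\<omega> \<in> A. \<forall>s\<in>Q1. norm (X s \<omega> - p s) < r}"
    have A'pos: "prob A' > 0"
      unfolding A'_def using Lp
      by (intro stay_in_tube[OF t A \<open>prob A > 0\<close> _ r _ Q1(1,2)]) (auto simp: A_def)
    have "AE \<omega> in M. \<omega> \<in> A' \<longrightarrow> \<omega> \<in> A \<inter> E"
      using X_continuous
    proof (rule AE_mp, intro AE_I2 impI)
      fix \<omega> assume \<omega>: "\<omega> \<in> space M" "\<omega> \<in> A'" and cont: "continuous_on {0..T} (\<lambda>s. X s \<omega>)"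
      have c: "continuous_on {0..T} (\<lambda>s. X s \<omega> - p s)"
        by (intro continuous_on_diff cont pcont)
      have "norm (X s \<omega> - p s) \<le> r" if s: "s \<in> {0..T}" for s
      proof (cases "s \<le> t")
        case True
        have "continuous_on {0..t} (\<lambda>s. X s \<omega> - p s)"
          using continuous_on_subset[OF c] t by auto
        then show ?thesis
          using norm_le_from_dense[OF _ Q0(2,3), of "\<lambda>s. X s \<omega> - p s" r s] \<omega>(2) True s
          by (auto simp: A'_def A_def)
      next
        case False
        have "continuous_on {t..T} (\<lambda>s. X s \<omega> - p s)"
          using continuous_on_subset[OF c] t by auto
        then show ?thesis
          using norm_le_from_dense[OF _ Q1(2,3), of "\<lambda>s. X s \<omega> - p s" r s] \<omega>(2) False s
          by (auto simp: A'_def intro: less_imp_le)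
      qed
      then have "(\<lambda>s. X s \<omega>) \<in> G" using tube cont unfolding tube_in_def p_def by blast
      then show "\<omega> \<in> A \<inter> E" using \<omega> by (auto simp: A'_def E_def)
    qed
    then have "prob A' \<le> prob (A \<inter> E)"
      using AM E by (intro finite_measure_mono_AE) auto
    moreover have "prob (A \<inter> E) \<le> 0"
    proof -
      have "prob (A \<inter> E) = (\<integral>\<omega>\<in>A. indicator E \<omega> \<partial>M)"
        using AM E by (simp add: set_lebesgue_integral_def flip: indicator_inter_arith)
      also have "\<dots> = (\<integral>\<omega>\<in>A. Z \<omega> \<partial>M)"
        unfolding Z_def
      proof (rule Ft.real_cond_exp_intA[OF _ A])
        show "integrable M (indicat_real E)"
          using E by (intro integrable_real_indicator) (auto simp: less_top[symmetric])
      qed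
      also have "\<dots> \<le> 0"
      proof -
        have "0 \<le> (\<integral>\<omega>. - (indicat_real A \<omega> *\<^sub>R Z \<omega>) \<partial>M)"
          by (intro integral_nonneg_AE AE_I2) (auto simp: A_def indicator_def)
        then show ?thesis unfolding set_lebesgue_integral_def by simp
      qed
      finally show ?thesis .
    qed
    ultimately show False using A'pos by simp
  qed
  then have "AE \<omega> in M. \<omega> \<notin> A" using AM by (simp add: prob_eq_0)
  then show ?thesis
    unfolding E_def[symmetric] Z_def[symmetric] p_def[symmetric]
  proof (rule AE_mp, intro AE_I2 impI)
    fix \<omega> assume \<omega>: "\<omega> \<in> space M" "\<omega> \<notin> A" "\<forall>s\<in>{0..t}. norm (X s \<omega> - p s) < r"
    then have "(\<forall>s\<in>Q0. norm (X s \<omega> - p s) \<le> r) \<and> norm (X t \<omega> - p t) < r"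
      using Q0(2) t by (auto intro: less_imp_le)
    then show "Z \<omega> > 0" using \<omega> space_F[OF t] by (auto simp: A_def)
  qed
qed

text \<open>The exceptional null set depends on the tube. As countably many tubes exhaust
  \<open>G\<close>, one null set serves all functions \<open>g\<close> in \<open>G\<close>, of which
  there may be uncountably many.\<close>

lemma has_cond_full_support: "cond_full_support M F T X"
  unfolding cond_full_support_def
proof (intro ballI allI impI)
  fix t and G :: "(real \<Rightarrow> real ^ 'n) set"
  assume t: "t \<in> {0..T}" and G: "uniform_open T G"
  obtain D :: "(real ^ 'n) set" where "countable D" "UNIV \<subseteq> closure D"
    by (rule separable[of UNIV]) blast
  then have D: "countable D" "closure D = UNIV" by blast+
  define P where "P = {(cs, r). cs \<in> lists D \<and> r \<in> \<rat> \<and> tube_in G (bernstein_path T cs) r}"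
  have P: "countable P"
  proof (rule countable_subset)
    show "P \<subseteq> lists D \<times> \<rat>" by (auto simp: P_def)
    show "countable (lists D \<times> (\<rat> :: real set))" using D(1) countable_rat by (intro countable_SIGMA) auto
  qed
  let ?Z = "real_cond_exp M (F t) (indicator {\<omega>' \<in> space M. (\<lambda>s. X s \<omega>') \<in> G})"
  have "AE \<omega> in M. \<forall>q\<in>P. (\<forall>s\<in>{0..t}. norm (X s \<omega> - bernstein_path T (fst q) s) < snd q) \<longrightarrow> ?Z \<omega> > 0"
    using cond_exp_positive_in_tube[OF t G] by (subst AE_ball_countable[OF P]) (auto simp: P_def)
  then show "AE \<omega> in M. (\<exists>g\<in>G. \<forall>s\<in>{0..t}. X s \<omega> = g s) \<longrightarrow> ?Z \<omega> > 0"
  proof (rule AE_mp, intro AE_I2 impI)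
    fix \<omega> assume all: "\<forall>q\<in>P. (\<forall>s\<in>{0..t}. norm (X s \<omega> - bernstein_path T (fst q) s) < snd q) \<longrightarrow> ?Z \<omega> > 0"
      and "\<exists>g\<in>G. \<forall>s\<in>{0..t}. X s \<omega> = g s"
    then obtain g where g: "g \<in> G" "\<And>s. s \<in> {0..t} \<Longrightarrow> X s \<omega> = g s" by auto
    from tube_in_exists[OF G g(1) D(2)] obtain cs r
      where "(cs, r) \<in> P" "\<forall>s\<in>{0..T}. norm (g s - bernstein_path T cs s) < r"
      unfolding P_def by blast
    moreover from this g(2) t have "\<forall>s\<in>{0..t}. norm (X s \<omega> - bernstein_path T cs s) < r" by auto
    ultimately show "?Z \<omega> > 0" using all by fastforce
  qed
qed

end

theorem theorem2:
  fixes M :: "'a measure" and F :: "real \<Rightarrow> 'a measure" and T :: real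
    and W :: "real \<Rightarrow> 'a \<Rightarrow> real ^ 'n::finite"
    and \<mu> :: "real \<Rightarrow> 'a \<Rightarrow> real ^ 'n"
    and \<sigma> :: "real \<Rightarrow> 'a \<Rightarrow> real ^ 'n ^ 'n"
    and X :: "real \<Rightarrow> 'a \<Rightarrow> real ^ 'n"
  assumes "T > 0"
    and "prob_space M"
    and "filtration_usual M F T"
    and "trivial_sigma M (F 0)"
    and "brownian_motion M F T W"
    and "progressive M F T \<mu>"
    and "progressive M F T \<sigma>"
    and "ito_process M F T W \<mu> \<sigma> X"
    and "\<exists>C. \<forall>t\<in>{0..T}. AE \<omega> in M. norm (\<mu> t \<omega>) \<le> C"
    and "\<epsilon> > 0" and "K > 0"
    and "\<forall>t\<in>{0..T}. AE \<omega> in M. \<forall>\<xi> :: real ^ 'n.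
           \<epsilon> * (norm \<xi>)\<^sup>2 \<le> (norm (transpose (\<sigma> t \<omega>) *v \<xi>))\<^sup>2 \<and>
           (norm (transpose (\<sigma> t \<omega>) *v \<xi>))\<^sup>2 \<le> K * (norm \<xi>)\<^sup>2"
  shows "cond_full_support M F T X"
proof -
  obtain C where C: "\<And>t. t \<in> {0..T} \<Longrightarrow> AE \<omega> in M. norm (\<mu> t \<omega>) \<le> C"
    using assms(9) by blast
  obtain I where I: "\<And>i \<nu>. is_ito_integral M F T (\<lambda>t \<omega>. W t \<omega> $ \<nu>) (\<lambda>t \<omega>. \<sigma> t \<omega> $ i $ \<nu>) (I i \<nu>)"
    and X: "\<And>t. t \<in> {0..T} \<Longrightarrow> X t \<in> borel_measurable (F t)"
      "AE \<omega> in M. continuous_on {0..T} (\<lambda>t. X t \<omega>)"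
      "\<And>t. t \<in> {0..T} \<Longrightarrow> AE \<omega> in M. \<forall>i.
         X t \<omega> $ i = X 0 \<omega> $ i + (LINT s:{0..t}|lborel. \<mu> s \<omega> $ i) + (\<Sum>\<nu>\<in>UNIV. I i \<nu> t \<omega>)"
    using assms(8) unfolding ito_process_def by blast
  \<comment> \<open>Bundling the three conditions into one predicate lets the approximating data of
    all matrix entries be chosen simultaneously.\<close>
  define approximates where "approximates i \<nu> m \<tau> h \<longleftrightarrow>
      (\<forall>j. admissible_elem M F T (m j) (\<tau> j) (h j)) \<and>
      (\<lambda>j. \<integral>\<^sup>+ \<omega>. (\<integral>\<^sup>+ s. ennreal ((\<sigma> s \<omega> $ i $ \<nu> - elem_proc (m j) (\<tau> j) (h j) s \<omega>)\<^sup>2)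
               * indicator {0..T} s \<partial>lborel) \<partial>M) \<longlonglongrightarrow> 0 \<and>
      (\<forall>t\<in>{0..T}. (\<lambda>j. \<integral>\<^sup>+ \<omega>. ennreal ((I i \<nu> t \<omega> - elem_int (\<lambda>t \<omega>. W t \<omega> $ \<nu>) (m j) (\<tau> j) (h j) t \<omega>)\<^sup>2) \<partial>M)
               \<longlonglongrightarrow> 0)" for i \<nu> m \<tau> h
  have "\<forall>i \<nu>. \<exists>m \<tau> h. approximates i \<nu> m \<tau> h"
    using I unfolding is_ito_integral_def approximates_def by blast
  then obtain m \<tau> h where approx: "\<And>i \<nu>. approximates i \<nu> (m i \<nu>) (\<tau> i \<nu>) (h i \<nu>)"
    by metis
  have adapted: "\<And>i \<nu> t. t \<in> {0..T} \<Longrightarrow> I i \<nu> t \<in> borel_measurable (F t)"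
    using I unfolding is_ito_integral_def by blast
  interpret prob_space M by fact
  interpret filtered_brownian M F T W
    using assms by unfold_locales auto
  interpret elliptic_ito M F T W \<mu> \<sigma> X I m \<tau> h C \<epsilon> K
    using assms X adapted approx C unfolding approximates_def by unfold_locales blast+
  show ?thesis by (rule has_cond_full_support)
qed

end
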